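(* Let $p$ be a prime. For all $k\in\mathbb{N}$ the projection $\pi_k(\widetilde{\exp}_p)\in\mathcal{R}_p^{(k)}$ is algebraic over $\mathbb{F}_p(x,z_1,\ldots,z_k)$. Further, for each $\alpha\in\mathbb{N}^{(\mathbb{N})}$, the coefficient of $z^\alpha$ in $\widetilde{\exp}_p$, viewed as a Laurent series in $\mathbb{F}_p((x))$, is algebraic over $\mathbb{F}_p(x)$. The same two assertions hold with $\widetilde{\exp}_p$ replaced by $\exp_p$, and by any algebraic multiple of it, i.e. by $h\cdot\exp_p$ for any $h\in\mathbb{F}_p[z_1,z_2,\ldots]((x))$ that is algebraic over $\mathbb{F}_p(x,z_1,z_2,\ldots)$.
   Context: $\mathbb{N}=\{0,1,2,\ldots\}$; $\mathbb{N}^{(\mathbb{N})}$ is the set of finitely supported sequences $\alpha=(\alpha_1,\alpha_2,\ldots)$ of natural numbers and $z^\alpha=\prod_i z_i^{\alpha_i}$. $\mathcal{R}_p=\mathbb{F}_p(z_1,z_2,\ldots)((x))$ is the field of formal Laurent series in $x$ whose coefficients are rational functions over $\mathbb{F}_p$ in countably many variables $z_i$ (each single coefficient involves only finitely many of them), with the $\mathbb{F}_p$-derivation $y\mapsto y'$, acting termwise on series in $x$, given by $x'=1$, $z_1'=\frac1x$, $z_i'=\frac{1}{xz_1\cdots z_{i-1}}$ for $i\ge2$. $\mathcal{R}_p^{(k)}=\mathbb{F}_p(z_1,\ldots,z_k)((x))$. The projection $\pi_k:\mathbb{F}_p[z_1,z_2,\ldots]((x))\to\mathbb{F}_p[z_1,\ldots,z_k]((x))$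 sets $z_{k+1}=z_{k+2}=\cdots=0$. Let $H(t)=\prod_{j=1}^{p-1}\left(1-\frac{t}{j}\right)^j\in\mathbb{F}_p[t]$. For $f$ of positive order in $x$ let $\sigma(f)=\sum_{j=0}^\infty f^{p^j}$. Define $g_0=\sigma(x)$, $g_{i+1}=\sigma(g_i^pz_{i+1})$, and $\widetilde{\exp}_p=\prod_{i=0}^\infty H((-1)^ig_i)\in\mathbb{F}_p[z_1,z_2,\ldots][[x]]$ ($x$-adic convergence). $\exp_p$ is the xeric solution of $y'=y$: the unique solution $y\in\mathbb{F}_p[z_1,z_2,\ldots][[x]]$ of $y'=y$ in whose monomial expansion the only monomial $x^kz^\alpha$ with $p\mid k$ and $p\mid\alpha_i$ for all $i$ is the constant term $1$, occurring with coefficient $1$. *)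

theory Defs
  imports
    "HOL-Analysis.Infinite_Products"
    "HOL-Computational_Algebra.Computational_Algebra"
    "HOL-Library.Poly_Mapping"
    "Berlekamp_Zassenhaus.Finite_Field"
begin

unbundle fps_syntax

text \<open>
  Throughout, \<open>'p :: prime_card\<close> is a type of prime cardinality \<open>p = CARD('p)\<close>, so that
  \<open>'p mod_ring\<close> is the prime field with \<open>p\<close> elements.  Variables are numbered from 0: the index
  \<open>i :: nat\<close> stands for the variable called z with subscript \<open>i + 1\<close> in the usual notation, and
  the first \<open>k\<close> variables are those with index in \<open>{..<k}\<close>.
\<close>

type_synonym exponent = "nat \<Rightarrow>\<^sub>0 nat"
type_synonym 'p zpoly = "exponent \<Rightarrow>\<^sub>0 'p mod_ring"
type_synonym 'p zfrac = "'p zpoly fract"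
type_synonym 'p Rp = "'p zfrac fls"

definition Z :: "nat \<Rightarrow> 'p::prime_card zpoly" where
  "Z i = Poly_Mapping.single (Poly_Mapping.single i 1) 1"

definition Zfrac :: "nat \<Rightarrow> 'p::prime_card zfrac" where
  "Zfrac i = to_fract (Z i)"

definition Zser :: "nat \<Rightarrow> 'p::prime_card Rp" where
  "Zser i = fls_const (Zfrac i)"

text \<open>Only used for functions \<open>f\<close> with \<open>f 0 = 0\<close>.\<close>
definition map_fls :: "('a::zero \<Rightarrow> 'b::zero) \<Rightarrow> 'a fls \<Rightarrow> 'b fls" where
  "map_fls f F = Abs_fls (\<lambda>n. f (F $$ n))"

definition to_Rp :: "'p::prime_card zpoly fls \<Rightarrow> 'p Rp" where
  "to_Rp = map_fls to_fract"

inductive_set field_adjoin :: "'a::field set \<Rightarrow> 'a set" for S :: "'a set" where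
  base: "a \<in> S \<Longrightarrow> a \<in> field_adjoin S"
| one: "1 \<in> field_adjoin S"
| diff: "a \<in> field_adjoin S \<Longrightarrow> b \<in> field_adjoin S \<Longrightarrow> a - b \<in> field_adjoin S"
| mult: "a \<in> field_adjoin S \<Longrightarrow> b \<in> field_adjoin S \<Longrightarrow> a * b \<in> field_adjoin S"
| inverse: "a \<in> field_adjoin S \<Longrightarrow> inverse a \<in> field_adjoin S"

definition algebraic_over :: "'a::field set \<Rightarrow> 'a \<Rightarrow> bool" where
  "algebraic_over K y \<longleftrightarrow> (\<exists>P. P \<noteq> 0 \<and> (\<forall>i. Polynomial.coeff P i \<in> K) \<and> poly P y = 0)"

text \<open>
  In the following fields the constants need not be adjoined, since the prime field is
  generated by 1.
\<close>

definition Fp_x :: "'p::prime_card mod_ring fls set" where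
  "Fp_x = field_adjoin {fls_X}"

definition Fp_xz :: "nat set \<Rightarrow> 'p::prime_card Rp set" where
  "Fp_xz I = field_adjoin (insert fls_X (Zser ` I))"

definition Rp_sub :: "nat \<Rightarrow> 'p::prime_card Rp set" where
  "Rp_sub k = {F. \<forall>n. F $$ n \<in> field_adjoin (Zfrac ` {..<k})}"

definition kill_vars :: "nat \<Rightarrow> 'p::prime_card zpoly \<Rightarrow> 'p zpoly" where
  "kill_vars k P = (\<Sum>\<alpha>\<in>Poly_Mapping.keys P. Poly_Mapping.single 0 (Poly_Mapping.lookup P \<alpha>) *
     (\<Prod>i\<in>Poly_Mapping.keys \<alpha>. (if i < k then Z i else 0) ^ Poly_Mapping.lookup \<alpha> i))"

definition proj :: "nat \<Rightarrow> 'p::prime_card zpoly fls \<Rightarrow> 'p zpoly fls" where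
  "proj k = map_fls (kill_vars k)"

definition z_coeff :: "exponent \<Rightarrow> 'p::prime_card zpoly fls \<Rightarrow> 'p mod_ring fls" where
  "z_coeff \<alpha> = map_fls (\<lambda>P. Poly_Mapping.lookup P \<alpha>)"

text \<open>
  The derivation of \<open>'p Rp\<close> maps coefficients in \<open>'p zfrac\<close> to \<open>1/x\<close> times such coefficients.
  The functions \<open>xD_poly\<close> and \<open>xD_frac\<close> below are \<open>x\<close> times its restriction to polynomials and
  rational functions in the variables; here \<open>xD_Z i\<close> is the value at the variable with index \<open>i\<close>,
  and the derivative of a monomial is the monomial times its logarithmic derivative.
\<close>

definition xD_Z :: "nat \<Rightarrow> 'p::prime_card zfrac" where
  "xD_Z i = 1 / (\<Prod>j<i. Zfrac j)"

definition xD_log :: "exponent \<Rightarrow> 'p::prime_card zfrac" where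
  "xD_log \<alpha> = (\<Sum>i\<in>Poly_Mapping.keys \<alpha>. of_nat (Poly_Mapping.lookup \<alpha> i) * (xD_Z i / Zfrac i))"

definition xD_poly :: "'p::prime_card zpoly \<Rightarrow> 'p zfrac" where
  "xD_poly P = (\<Sum>\<alpha>\<in>Poly_Mapping.keys P. to_fract (Poly_Mapping.single \<alpha> (Poly_Mapping.lookup P \<alpha>)) * xD_log \<alpha>)"

lemma poly_mapping_sum_singles:
  "(\<Sum>\<alpha>\<in>Poly_Mapping.keys P. Poly_Mapping.single \<alpha> (Poly_Mapping.lookup P \<alpha>)) = (P :: 'a \<Rightarrow>\<^sub>0 'b::comm_monoid_add)"
proof (rule poly_mapping_eqI)
  fix k
  show "Poly_Mapping.lookup (\<Sum>\<alpha>\<in>Poly_Mapping.keys P. Poly_Mapping.single \<alpha> (Poly_Mapping.lookup P \<alpha>)) k = Poly_Mapping.lookup P k"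
    by (simp add: lookup_sum lookup_single when_def in_keys_iff)
qed

lemma xD_log_add: "xD_log (\<alpha> + \<beta>) = xD_log \<alpha> + xD_log \<beta>"
proof -
  have *: "xD_log \<gamma> = (\<Sum>i\<in>Poly_Mapping.keys \<alpha> \<union> Poly_Mapping.keys \<beta>. of_nat (Poly_Mapping.lookup \<gamma> i) * (xD_Z i / Zfrac i))"
    if "Poly_Mapping.keys \<gamma> \<subseteq> Poly_Mapping.keys \<alpha> \<union> Poly_Mapping.keys \<beta>" for \<gamma>
    unfolding xD_log_def using that by (intro sum.mono_neutral_left) (auto simp: in_keys_iff)
  have "Poly_Mapping.keys (\<alpha> + \<beta>) \<subseteq> Poly_Mapping.keys \<alpha> \<union> Poly_Mapping.keys \<beta>"
    by (rule keys_add)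
  from *[OF this] show ?thesis
    by (simp add: * lookup_add algebra_simps sum.distrib add_divide_distrib)
qed

lemma xD_poly_superset:
  assumes "finite A" "Poly_Mapping.keys P \<subseteq> A"
  shows "xD_poly P = (\<Sum>\<alpha>\<in>A. to_fract (Poly_Mapping.single \<alpha> (Poly_Mapping.lookup P \<alpha>)) * xD_log \<alpha>)"
  unfolding xD_poly_def using assms by (intro sum.mono_neutral_left) (auto simp: in_keys_iff)

lemma xD_poly_add: "xD_poly (P + Q) = xD_poly P + xD_poly Q"
proof -
  have "Poly_Mapping.keys (P + Q) \<subseteq> Poly_Mapping.keys P \<union> Poly_Mapping.keys Q"
    by (rule keys_add)
  then show ?thesis
    by (simp add: xD_poly_superset[of "Poly_Mapping.keys P \<union> Poly_Mapping.keys Q"] lookup_add single_add algebra_simps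
        sum.distrib)
qed

lemma xD_poly_0 [simp]: "xD_poly 0 = 0"
  by (simp add: xD_poly_def)

lemma xD_poly_sum: "xD_poly (\<Sum>i\<in>A. f i) = (\<Sum>i\<in>A. xD_poly (f i))"
  by (induction A rule: infinite_finite_induct) (auto simp: xD_poly_add)

lemma xD_poly_single:
  "xD_poly (Poly_Mapping.single \<alpha> c) = to_fract (Poly_Mapping.single \<alpha> c) * xD_log \<alpha>"
  by (simp add: xD_poly_def)

lemma xD_poly_mult: "xD_poly (P * Q) = xD_poly P * to_fract Q + to_fract P * xD_poly Q"
proof -
  let ?p = "\<lambda>\<alpha>. Poly_Mapping.single \<alpha> (Poly_Mapping.lookup P \<alpha>)"
  let ?q = "\<lambda>\<alpha>. Poly_Mapping.single \<alpha> (Poly_Mapping.lookup Q \<alpha>)"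
  have P: "P = (\<Sum>\<alpha>\<in>Poly_Mapping.keys P. ?p \<alpha>)" and Q: "Q = (\<Sum>\<alpha>\<in>Poly_Mapping.keys Q. ?q \<alpha>)"
    by (simp_all add: poly_mapping_sum_singles)
  have single: "xD_poly (?p \<alpha> * ?q \<beta>) =
      xD_poly (?p \<alpha>) * to_fract (?q \<beta>) + to_fract (?p \<alpha>) * xD_poly (?q \<beta>)" for \<alpha> \<beta>
  proof -
    have m: "?p \<alpha> * ?q \<beta> = Poly_Mapping.single (\<alpha> + \<beta>) (Poly_Mapping.lookup P \<alpha> * Poly_Mapping.lookup Q \<beta>)"
      by (simp add: mult_single)
    have "xD_poly (?p \<alpha> * ?q \<beta>) = to_fract (?p \<alpha> * ?q \<beta>) * xD_log (\<alpha> + \<beta>)"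
      unfolding m by (rule xD_poly_single)
    then show ?thesis
      by (simp add: xD_poly_single xD_log_add algebra_simps)
  qed
  have "xD_poly (P * Q) = xD_poly (\<Sum>\<alpha>\<in>Poly_Mapping.keys P. \<Sum>\<beta>\<in>Poly_Mapping.keys Q. ?p \<alpha> * ?q \<beta>)"
    by (subst P, subst Q) (simp add: sum_product)
  also have "\<dots> = (\<Sum>\<alpha>\<in>Poly_Mapping.keys P. \<Sum>\<beta>\<in>Poly_Mapping.keys Q. xD_poly (?p \<alpha>) * to_fract (?q \<beta>)) +
      (\<Sum>\<alpha>\<in>Poly_Mapping.keys P. \<Sum>\<beta>\<in>Poly_Mapping.keys Q. to_fract (?p \<alpha>) * xD_poly (?q \<beta>))"
    by (simp add: xD_poly_sum single sum.distrib)
  also have "\<dots> = xD_poly (\<Sum>\<alpha>\<in>Poly_Mapping.keys P. ?p \<alpha>) * to_fract (\<Sum>\<beta>\<in>Poly_Mapping.keys Q. ?q \<beta>) +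
      to_fract (\<Sum>\<alpha>\<in>Poly_Mapping.keys P. ?p \<alpha>) * xD_poly (\<Sum>\<beta>\<in>Poly_Mapping.keys Q. ?q \<beta>)"
    by (simp add: xD_poly_sum to_fract_sum sum_product)
  finally show ?thesis
    by (simp only: poly_mapping_sum_singles)
qed

lemma quotient_rule_well_defined:
  fixes P Q P' Q' :: "'p::prime_card zpoly"
  assumes "Q \<noteq> 0" "Q' \<noteq> 0" and eq: "P * Q' = P' * Q"
  shows "(xD_poly P * to_fract Q - to_fract P * xD_poly Q) / to_fract Q ^ 2 =
    (xD_poly P' * to_fract Q' - to_fract P' * xD_poly Q') / to_fract Q' ^ 2"
proof -
  have nz: "to_fract Q \<noteq> 0" "to_fract Q' \<noteq> 0"
    using assms by auto
  let ?p = "to_fract P" and ?q = "to_fract Q" and ?p' = "to_fract P'" and ?q' = "to_fract Q'"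
  let ?dp = "xD_poly P" and ?dq = "xD_poly Q" and ?dp' = "xD_poly P'" and ?dq' = "xD_poly Q'"
  have 1: "?p * ?q' = ?p' * ?q"
    using eq by (metis to_fract_mult)
  have 2: "?dp * ?q' + ?p * ?dq' = ?dp' * ?q + ?p' * ?dq"
    using eq by (metis xD_poly_mult)
  have "(?dp * ?q - ?p * ?dq) * ?q'^2 - (?dp' * ?q' - ?p' * ?dq') * ?q^2 =
      ?q * ?q' * ((?dp * ?q' + ?p * ?dq') - (?dp' * ?q + ?p' * ?dq)) -
      (?q' * ?dq + ?q * ?dq') * (?p * ?q' - ?p' * ?q)"
    by (simp add: algebra_simps power2_eq_square)
  then have "(?dp * ?q - ?p * ?dq) * ?q'^2 = (?dp' * ?q' - ?p' * ?dq') * ?q^2"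
    using 1 2 by simp
  then show ?thesis
    using nz by (simp add: frac_eq_eq)
qed

definition xD_frac :: "'p::prime_card zfrac \<Rightarrow> 'p zfrac" where
  "xD_frac q = (THE r. \<exists>P Q. Q \<noteq> 0 \<and> q = Fract P Q \<and>
     r = (xD_poly P * to_fract Q - to_fract P * xD_poly Q) / to_fract Q ^ 2)"

lemma xD_frac_Fract:
  assumes "Q \<noteq> 0"
  shows "xD_frac (Fract P Q) = (xD_poly P * to_fract Q - to_fract P * xD_poly Q) / to_fract Q ^ 2"
  unfolding xD_frac_def
proof (rule the_equality)
  fix r
  assume "\<exists>P' Q'. Q' \<noteq> 0 \<and> Fract P Q = Fract P' Q' \<and>
    r = (xD_poly P' * to_fract Q' - to_fract P' * xD_poly Q') / to_fract Q' ^ 2"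
  then obtain P' Q' where r: "Q' \<noteq> 0" "Fract P Q = Fract P' Q'"
    "r = (xD_poly P' * to_fract Q' - to_fract P' * xD_poly Q') / to_fract Q' ^ 2"
    by blast
  then have "P * Q' = P' * Q"
    using assms by (simp add: eq_fract)
  with assms r show "r = (xD_poly P * to_fract Q - to_fract P * xD_poly Q) / to_fract Q ^ 2"
    using quotient_rule_well_defined by metis
qed (use assms in blast)

lemma xD_poly_1 [simp]: "xD_poly 1 = 0"
  by (simp add: xD_poly_def xD_log_def)

lemma xD_frac_to_fract: "xD_frac (to_fract P) = xD_poly P"
  unfolding to_fract_def[of P] by (subst xD_frac_Fract) simp_all

lemma xD_frac_0 [simp]: "xD_frac 0 = 0"
  using xD_frac_to_fract[of 0] by simp

lemma xD_frac_1 [simp]: "xD_frac 1 = 0"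
  using xD_frac_to_fract[of 1] by simp

lemma xD_frac_Zfrac: "xD_frac (Zfrac i) = xD_Z i"
proof -
  have "Z i \<noteq> (0 :: 'a zpoly)"
    unfolding Z_def by (metis lookup_single_eq lookup_zero one_neq_zero)
  then have "Zfrac i \<noteq> (0 :: 'a zfrac)"
    by (simp add: Zfrac_def)
  then show ?thesis
    by (simp add: Zfrac_def xD_frac_to_fract Z_def xD_poly_single xD_log_def)
qed

lemma xD_frac_mult: "xD_frac (a * b) = xD_frac a * b + a * xD_frac b"
proof -
  obtain P Q where a: "a = Fract P Q" "Q \<noteq> 0" by (cases a)
  obtain P' Q' where b: "b = Fract P' Q'" "Q' \<noteq> 0" by (cases b)
  have F: "Fract P Q = to_fract P / to_fract Q" "Fract P' Q' = to_fract P' / to_fract Q'"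
    by (simp_all add: to_fract_def)
  have nz: "to_fract Q \<noteq> 0" "to_fract Q' \<noteq> 0" "Q * Q' \<noteq> 0"
    using a b by auto
  have ab: "xD_frac (a * b) = (xD_poly (P * P') * to_fract (Q * Q') -
      to_fract (P * P') * xD_poly (Q * Q')) / to_fract (Q * Q') ^ 2"
    unfolding a b mult_fract using nz by (intro xD_frac_Fract)
  show ?thesis
    unfolding ab unfolding a b xD_frac_Fract[OF a(2)] xD_frac_Fract[OF b(2)]
    unfolding F xD_poly_mult to_fract_mult
    using nz by (simp add: field_simps power2_eq_square)
qed

lemma xD_frac_add: "xD_frac (a + b) = xD_frac a + xD_frac b"
proof -
  obtain P Q where a: "a = Fract P Q" "Q \<noteq> 0" by (cases a)
  obtain P' Q' where b: "b = Fract P' Q'" "Q' \<noteq> 0" by (cases b)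
  have nz: "to_fract Q \<noteq> 0" "to_fract Q' \<noteq> 0" "Q * Q' \<noteq> 0"
    using a b by auto
  show ?thesis
    unfolding a b add_fract[OF a(2) b(2)] xD_frac_Fract[OF a(2)] xD_frac_Fract[OF b(2)]
      xD_frac_Fract[OF nz(3)] xD_poly_mult xD_poly_add to_fract_mult to_fract_add
    using nz by (simp add: field_simps power2_eq_square)
qed

lemma xD_frac_sum: "xD_frac (\<Sum>i\<in>A. f i) = (\<Sum>i\<in>A. xD_frac (f i))"
  by (induction A rule: infinite_finite_induct) (auto simp: xD_frac_add)

definition Rp_deriv :: "'p::prime_card Rp \<Rightarrow> 'p Rp" where
  "Rp_deriv F = fls_deriv F + map_fls xD_frac F / fls_X"

lemma map_fls_nth:
  assumes "f 0 = 0"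
  shows "map_fls f F $$ n = f (F $$ n)"
  unfolding map_fls_def
  by (rule nth_Abs_fls_lower_bound[of "fls_subdegree F"]) (simp add: assms)

lemma fls_times_nth_bounds:
  fixes F G :: "'a::semiring_0 fls"
  assumes F: "\<And>i. i < a \<Longrightarrow> F $$ i = 0" and G: "\<And>i. i < b \<Longrightarrow> G $$ i = 0"
  shows "(F * G) $$ n = (\<Sum>i=a..n - b. F $$ i * G $$ (n - i))"
proof (cases "F = 0 \<or> G = 0")
  case False
  then have "a \<le> fls_subdegree F" "b \<le> fls_subdegree G"
    using F G by (auto intro: fls_subdegree_geI)
  then have "(\<Sum>i=fls_subdegree F..n - fls_subdegree G. F $$ i * G $$ (n - i)) =
      (\<Sum>i=a..n - b. F $$ i * G $$ (n - i))"
    by (intro sum.mono_neutral_left) auto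
  then show ?thesis
    by (simp add: fls_times_nth(2))
qed auto

text \<open>
  The next lemmas say that \<open>Rp_deriv\<close> is a derivation with the prescribed values on \<open>x\<close> and on
  the variables.
\<close>

lemma Rp_deriv_add: "Rp_deriv (F + G) = Rp_deriv F + Rp_deriv G"
proof -
  have "map_fls xD_frac (F + G) = map_fls xD_frac F + map_fls xD_frac G"
    by (rule fls_eqI) (simp add: map_fls_nth xD_frac_add)
  then show ?thesis
    by (simp add: Rp_deriv_def add_divide_distrib)
qed

lemma Rp_deriv_mult: "Rp_deriv (F * G) = Rp_deriv F * G + F * Rp_deriv G"
proof -
  let ?a = "fls_subdegree F" and ?b = "fls_subdegree G"
  have "map_fls xD_frac (F * G) = map_fls xD_frac F * G + F * map_fls xD_frac G"
  proof (rule fls_eqI)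
    fix n
    have "map_fls xD_frac (F * G) $$ n = (\<Sum>i=?a..n - ?b. xD_frac (F $$ i * G $$ (n - i)))"
      by (simp add: map_fls_nth fls_times_nth(2) xD_frac_sum)
    also have "\<dots> = (map_fls xD_frac F * G) $$ n + (F * map_fls xD_frac G) $$ n"
      by (simp add: fls_times_nth_bounds[of ?a _ ?b] map_fls_nth xD_frac_mult sum.distrib)
    finally show "map_fls xD_frac (F * G) $$ n =
        (map_fls xD_frac F * G + F * map_fls xD_frac G) $$ n"
      by simp
  qed
  then show ?thesis
    by (simp add: Rp_deriv_def add_divide_distrib algebra_simps del: fls_divide_X)
qed

lemma Rp_deriv_X: "Rp_deriv fls_X = 1"
proof -
  have "map_fls xD_frac fls_X = (0 :: 'a Rp)"
    by (intro fls_eqI) (simp add: map_fls_nth)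
  then show ?thesis
    by (simp add: Rp_deriv_def)
qed

lemma Rp_deriv_Zser: "Rp_deriv (Zser i) = 1 / (fls_X * (\<Prod>j<i. Zser j))"
proof -
  have "map_fls xD_frac (Zser i) = (fls_const (xD_Z i) :: 'a Rp)"
    by (intro fls_eqI) (simp add: map_fls_nth Zser_def xD_frac_Zfrac)
  moreover have "fls_const (\<Prod>j<i. Zfrac j) = (\<Prod>j<i. Zser j :: 'a Rp)"
    by (induction i) (simp_all add: Zser_def fls_const_mult_const[symmetric])
  then have "fls_const (xD_Z i) = (1 / (\<Prod>j<i. Zser j) :: 'a Rp)"
    by (metis xD_Z_def fls_const_divide_const fls_const_1)
  ultimately show ?thesis
    by (simp add: Rp_deriv_def Zser_def mult.commute del: fls_divide_X)
qed

definition const_ser :: "'p::prime_card mod_ring \<Rightarrow> 'p zpoly fps" where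
  "const_ser c = fps_const (Poly_Mapping.single 0 c)"

definition H_poly :: "'p::prime_card mod_ring poly" where
  "H_poly = (\<Prod>j=1..<CARD('p). [:1, - (1 / of_nat j):] ^ j)"

definition H_at :: "'p::prime_card zpoly fps \<Rightarrow> 'p zpoly fps" where
  "H_at f = poly (map_poly const_ser H_poly) f"

text \<open>
  Infinite sums and products are taken in the metric topology of \<open>fps\<close> from the library, which
  is the \<open>x\<close>-adic one.
\<close>

definition sigma :: "'p::prime_card zpoly fps \<Rightarrow> 'p zpoly fps" where
  "sigma f = suminf (\<lambda>j. f ^ (CARD('p) ^ j))"

fun gser :: "nat \<Rightarrow> 'p::prime_card zpoly fps" where
  "gser 0 = sigma fps_X"
| "gser (Suc i) = sigma (gser i ^ CARD('p) * fps_const (Z i))"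

definition exp_tilde :: "'p::prime_card zpoly fps" where
  "exp_tilde = prodinf (\<lambda>i. H_at ((- 1) ^ i * gser i))"

definition xeric_exp :: "'p::prime_card zpoly fps \<Rightarrow> bool" where
  "xeric_exp y \<longleftrightarrow>
     Rp_deriv (to_Rp (fps_to_fls y)) = to_Rp (fps_to_fls y) \<and>
     (\<forall>k \<alpha>. CARD('p) dvd k \<and> (\<forall>i. CARD('p) dvd Poly_Mapping.lookup \<alpha> i) \<longrightarrow>
        Poly_Mapping.lookup (fps_nth y k) \<alpha> = (if k = 0 \<and> \<alpha> = 0 then 1 else 0))"

definition exp_p :: "'p::prime_card zpoly fps" where
  "exp_p = (THE y. xeric_exp y)"

end

theory Submission
  imports Defs "HOL-Algebra.Algebraic_Closure_Type"
begin

text \<open>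
  The infinite product involves infinitely many variables, but setting all but finitely many of them
  to zero leaves a finite product of polynomials in algebraic series.  Write \<open>p\<close> for the characteristic and \<open>g\<^sub>0, g\<^sub>1, \<dots>\<close> for the series \<open>gser i\<close>.  Telescoping
  gives the Artin-Schreier equations \<open>g\<^sub>0 - g\<^sub>0 ^ p = x\<close> and
  \<open>g\<^sub>i\<^sub>+\<^sub>1 - g\<^sub>i\<^sub>+\<^sub>1 ^ p = g\<^sub>i ^ p * z\<^sub>i\<close> (\<open>sigma_equation\<close>), so all \<open>g\<^sub>i\<close> are algebraic, and the projection
  to the first \<open>k\<close> variables kills \<open>g\<^sub>i\<close> for \<open>i > k\<close> (\<open>proj_gs_eq_0\<close>).

  To pass from the product to \<open>exp_p\<close>, one shows that both solve the same differential equation.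
  The polynomial \<open>H\<close> satisfies \<open>H' * (1 - t ^ (p - 1)) = H\<close> (\<open>H_poly_equation\<close>); together with the
  Artin-Schreier equations this makes the sum of the logarithmic derivatives of the factors
  telescope (\<open>Rp_deriv_exp_partial\<close>), so the product solves \<open>y' = y\<close> (\<open>exp_tilde_ode\<close>).  Let \<open>c\<close> be
  the sum of those terms of the product in which all exponents are divisible by \<open>p\<close>.  It is a
  constant of the derivation, and the product divided by \<open>c\<close> is a xeric solution.  The
  xeric solution is unique because a solution of \<open>n * P + x * P' = 0\<close> with \<open>P\<close> a nonzero polynomial in
  the variables has a lexicographically largest monomial that is a \<open>p\<close>-th power, with \<open>p\<close> dividing
  \<open>n\<close> (\<open>top_monomial_of_kernel\<close>).  Hence \<open>exp_p * c\<close> equals the product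
  (\<open>exp_p_times_const_part\<close>).

  It remains to see that the projections of \<open>c\<close> are algebraic.  The operator extracting the
  exponents divisible by \<open>p\<close> in one variable is \<open>1 - \<theta> ^ (p - 1)\<close> for the Euler derivation \<open>\<theta>\<close>
  of this variable, by Fermat.  The equations above show that \<open>\<theta>\<close> maps the ring generated by \<open>x\<close>,
  the variables and the projected \<open>g\<^sub>i\<close> to itself (\<open>weight_gring\<close>).  This ring consists of algebraic
  series and contains the projected product, hence also the projection of \<open>c\<close>.

  The multiples \<open>h * exp_p\<close> and the coefficients need one more tool: if a series is algebraic, so
  is its value at \<open>z\<^sub>i = 0\<close>, because an algebraic relation can be divided by \<open>z\<^sub>i\<close> until one of its
  coefficients survives this specialisation (\<open>drop_var_relation\<close>).  A relation involves finitely
  many variables, which gives the projections of \<open>h\<close>.  Alternating specialisation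
  with division by \<open>z\<^sub>i\<close> extracts the coefficients of the powers of \<open>z\<^sub>i\<close>, one variable at a time
  (\<open>algebraic_z_coeff\<close>).
\<close>

section \<open>Algebraic elements over a generated subfield\<close>

abbreviation "type_ring \<equiv> (ring_of_type_algebra :: 'a::Fields.field ring)"

lemma type_ring_simps:
  "carrier (type_ring :: 'a::Fields.field ring) = UNIV" "\<zero>\<^bsub>type_ring :: 'a ring\<^esub> = 0" "\<one>\<^bsub>type_ring :: 'a ring\<^esub> = 1"
  "x \<oplus>\<^bsub>type_ring\<^esub> y = x + y" "x \<otimes>\<^bsub>type_ring\<^esub> y = x * y"
  by (simp_all add: ring_of_type_algebra_def)

lemma type_ring_pow: "x [^]\<^bsub>type_ring\<^esub> (n::nat) = x ^ n"
  by (induction n) (simp_all add: nat_pow_def type_ring_simps mult.commute)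

lemma type_ring_eval: "ring.eval type_ring p x = poly (Poly (rev p)) x"
proof -
  interpret field "type_ring :: 'a ring" by (rule field_from_type_algebra)
  show ?thesis
    by (induction p) (auto simp: type_ring_simps type_ring_pow Poly_append poly_monom)
qed

lemma type_ring_a_inv: "\<ominus>\<^bsub>type_ring\<^esub> x = - x"
proof -
  interpret field "type_ring :: 'a ring" by (rule field_from_type_algebra)
  show ?thesis
    by (rule minus_equality) (simp_all add: type_ring_simps)
qed

lemma type_ring_m_inv: "x \<noteq> 0 \<Longrightarrow> inv\<^bsub>type_ring\<^esub> x = Fields.inverse x"
proof -
  interpret field "type_ring :: 'a ring" by (rule field_from_type_algebra)
  assume "x \<noteq> 0"
  then show ?thesis
    by (intro comm_inv_char) (simp_all add: type_ring_simps)
qed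

lemma field_adjoin_0: "0 \<in> field_adjoin S"
  using field_adjoin.diff[OF field_adjoin.one field_adjoin.one, of S] by simp

lemma field_adjoin_uminus: "a \<in> field_adjoin S \<Longrightarrow> - a \<in> field_adjoin S"
  using field_adjoin.diff[OF field_adjoin_0] by fastforce

lemma field_adjoin_add: "a \<in> field_adjoin S \<Longrightarrow> b \<in> field_adjoin S \<Longrightarrow> a + b \<in> field_adjoin S"
  using field_adjoin.diff[OF _ field_adjoin_uminus] by fastforce

lemma subfield_field_adjoin: "subfield (field_adjoin S) type_ring"
proof -
  interpret field "type_ring :: 'a ring" by (rule field_from_type_algebra)
  show ?thesis
    by (rule subfieldI'[OF subringI])
      (auto simp: type_ring_simps type_ring_a_inv type_ring_m_inv
        intro: field_adjoin.intros field_adjoin_uminus field_adjoin_add)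
qed

text \<open>
  Algebraic dependence in the sense of ring records has a ready proof that the algebraic elements
  form a subfield; the equivalence makes it available for type classes.
\<close>
lemma algebraic_over_iff_type_ring:
  "algebraic_over (field_adjoin S) y \<longleftrightarrow>
     (ring.algebraic type_ring over field_adjoin S) (y :: 'a::Fields.field)"
proof -
  interpret field "type_ring :: 'a ring" by (rule field_from_type_algebra)
  have K: "subring (field_adjoin S) type_ring"
    by (rule subfieldE(1)[OF subfield_field_adjoin])
  show ?thesis
  proof
    assume "algebraic_over (field_adjoin S) y"
    then obtain P where P: "P \<noteq> 0" "\<And>i. Polynomial.coeff P i \<in> field_adjoin S" "poly P y = 0"
      unfolding algebraic_over_def by auto
    show "(algebraic over field_adjoin S) y"
    proof (rule algebraicI)
      show "rev (coeffs P) \<in> carrier (univ_poly type_ring (field_adjoin S))"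
        using P by (auto simp: univ_poly_def polynomial_def type_ring_simps hd_rev last_coeffs_eq_coeff_degree
            coeffs_def)
    qed (use P in \<open>auto simp: type_ring_eval type_ring_simps\<close>)
  next
    assume "(algebraic over field_adjoin S) y"
    then obtain p where p: "p \<in> carrier (univ_poly type_ring (field_adjoin S))" "p \<noteq> []"
      "eval p y = \<zero>\<^bsub>type_ring\<^esub>"
      using algebraicE[OF K] by (auto simp: type_ring_simps)
    have c: "coeffs (Poly (rev p)) = rev p"
      using p(1,2) by (cases p) (auto simp: univ_poly_def polynomial_def type_ring_simps)
    show "algebraic_over (field_adjoin S) y"
      unfolding algebraic_over_def
    proof (intro exI conjI allI)
      show "Poly (rev p) \<noteq> 0"
        using c p(2) by (metis coeffs_0_eq_Nil rev_is_Nil_conv)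
      show "poly (Poly (rev p)) y = 0"
        using p(3) by (simp add: type_ring_eval type_ring_simps)
      fix i
      have "set p \<subseteq> field_adjoin S"
        using p(1,2) by (auto simp: univ_poly_def polynomial_def)
      then show "Polynomial.coeff (Poly (rev p)) i \<in> field_adjoin S"
        by (auto simp: nth_default_def field_adjoin_0 rev_nth)
    qed
  qed
qed

lemma subfield_algebraic_over:
  "subfield {y. algebraic_over (field_adjoin S) y} (type_ring :: 'a::Fields.field ring)"
proof -
  interpret field "type_ring :: 'a ring" by (rule field_from_type_algebra)
  show ?thesis
    using subfield_of_algebraics[OF subfield_field_adjoin]
    by (simp add: algebraic_over_iff_type_ring type_ring_simps)
qed

lemma
  fixes a b :: "'a::Fields.field"
  assumes "algebraic_over (field_adjoin S) a" "algebraic_over (field_adjoin S) b"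
  shows algebraic_over_add: "algebraic_over (field_adjoin S) (a + b)"
    and algebraic_over_mult: "algebraic_over (field_adjoin S) (a * b)"
proof -
  interpret field "type_ring :: 'a ring" by (rule field_from_type_algebra)
  note s = subringE[OF subfieldE(1)[OF subfield_algebraic_over[of S]], unfolded mem_Collect_eq type_ring_simps]
  show "algebraic_over (field_adjoin S) (a + b)" "algebraic_over (field_adjoin S) (a * b)"
    using s(6-7) assms by auto
qed

lemma algebraic_over_uminus:
  fixes a :: "'a::Fields.field"
  assumes "algebraic_over (field_adjoin S) a"
  shows "algebraic_over (field_adjoin S) (- a)"
proof -
  interpret field "type_ring :: 'a ring" by (rule field_from_type_algebra)
  note s = subringE[OF subfieldE(1)[OF subfield_algebraic_over[of S]], unfolded mem_Collect_eq type_ring_simps]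
  show ?thesis
    using s(5) assms by (auto simp: type_ring_a_inv)
qed

lemma algebraic_over_diff:
  "algebraic_over (field_adjoin S) a \<Longrightarrow> algebraic_over (field_adjoin S) b \<Longrightarrow> algebraic_over (field_adjoin S) (a - b)"
  using algebraic_over_add[OF _ algebraic_over_uminus, of S a b] by simp

lemma algebraic_over_base: "a \<in> field_adjoin S \<Longrightarrow> algebraic_over (field_adjoin S) a"
  unfolding algebraic_over_def
  by (rule exI[of _ "[:- a, 1:]"])
    (auto simp: coeff_pCons field_adjoin_uminus field_adjoin_0 field_adjoin.one split: nat.split)

lemma algebraic_over_inverse:
  fixes a :: "'a::Fields.field"
  assumes "algebraic_over (field_adjoin S) a"
  shows "algebraic_over (field_adjoin S) (Fields.inverse a)"
proof (cases "a = 0")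
  case True
  then show ?thesis using assms by simp
next
  case False
  interpret field "type_ring :: 'a ring" by (rule field_from_type_algebra)
  show ?thesis
    using subfield_m_inv(1)[OF subfield_algebraic_over[of S], of a] False assms
    by (simp add: type_ring_simps type_ring_m_inv)
qed

lemma algebraic_over_divide:
  "algebraic_over (field_adjoin S) a \<Longrightarrow> algebraic_over (field_adjoin S) b \<Longrightarrow>
    algebraic_over (field_adjoin S) (a / b)"
  unfolding divide_inverse by (intro algebraic_over_mult algebraic_over_inverse)

lemma field_adjoin_sum: "(\<And>i. i \<in> A \<Longrightarrow> f i \<in> field_adjoin S) \<Longrightarrow> (\<Sum>i\<in>A. f i) \<in> field_adjoin S"
  by (induction A rule: infinite_finite_induct) (auto simp: field_adjoin_0 field_adjoin_add)

lemma field_adjoin_power: "a \<in> field_adjoin S \<Longrightarrow> a ^ n \<in> field_adjoin S"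
  by (induction n) (auto intro: field_adjoin.intros)

lemma coeff_mult_field_adjoin:
  "(\<And>i. Polynomial.coeff P i \<in> field_adjoin S) \<Longrightarrow> (\<And>i. Polynomial.coeff Q i \<in> field_adjoin S) \<Longrightarrow>
    Polynomial.coeff (P * Q) i \<in> field_adjoin S"
  unfolding coeff_mult by (intro field_adjoin_sum field_adjoin.mult)

lemma coeff_pcompose_field_adjoin:
  assumes P: "\<And>i. Polynomial.coeff P i \<in> field_adjoin S" and Q: "\<And>i. Polynomial.coeff Q i \<in> field_adjoin S"
  shows "Polynomial.coeff (pcompose P Q) i \<in> field_adjoin S"
  using P
proof (induction P arbitrary: i)
  case (pCons a P)
  have "Polynomial.coeff P i \<in> field_adjoin S" for i
    using pCons.prems[of "Suc i"] by simp
  moreover have "a \<in> field_adjoin S"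
    using pCons.prems[of 0] by simp
  ultimately show ?case
    by (auto simp: pcompose_pCons coeff_pCons field_adjoin_0 split: nat.split
      intro!: field_adjoin_add coeff_mult_field_adjoin pCons.IH Q)
qed (simp add: field_adjoin_0)

text \<open>
  A polynomial relation for \<open>g - g ^ n\<close> becomes one for \<open>g\<close> on substituting \<open>t - t ^ n\<close> for the
  unknown, with coefficients in the same field.
\<close>
lemma algebraic_over_Artin_Schreier:
  fixes g :: "'a::Fields.field"
  assumes f: "algebraic_over (field_adjoin S) (g - g ^ n)" and n: "n > 1"
  shows "algebraic_over (field_adjoin S) g"
proof -
  obtain P where P: "P \<noteq> 0" "\<And>i. Polynomial.coeff P i \<in> field_adjoin S" "poly P (g - g ^ n) = 0"
    using f unfolding algebraic_over_def by auto
  define Q :: "'a poly" where "Q = [:0, 1:] - Polynomial.monom 1 n"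
  have Q: "Polynomial.coeff Q i \<in> field_adjoin S" for i
    by (auto simp: Q_def coeff_pCons field_adjoin_0 field_adjoin.one field_adjoin_uminus
        split: nat.split intro!: field_adjoin.diff)
  have "Polynomial.coeff Q n \<noteq> 0"
    using n by (auto simp: Q_def coeff_pCons split: nat.split)
  then have "Polynomial.degree Q > 0"
    using le_degree[of Q n] n by linarith
  then have "pcompose P Q \<noteq> 0"
    using P(1) pcompose_eq_0_iff by blast
  moreover have "poly (pcompose P Q) g = 0"
    using P(3) by (simp add: poly_pcompose Q_def poly_monom)
  ultimately show ?thesis
    unfolding algebraic_over_def using coeff_pcompose_field_adjoin[OF P(2) Q] by blast
qed

section \<open>Diagonal operators on series\<close>

type_synonym 'p zser = "'p zpoly fls"

abbreviation Zl :: "nat \<Rightarrow> 'p::prime_card zser" where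
  "Zl i \<equiv> fls_const (Z i)"

lemma lookup_single_times:
  fixes Q :: "'p::prime_card zpoly"
  shows "Poly_Mapping.lookup (Poly_Mapping.single \<beta> c * Q) \<gamma> =
    (\<Sum>\<alpha>\<in>Poly_Mapping.keys Q. c * Poly_Mapping.lookup Q \<alpha> when \<beta> + \<alpha> = \<gamma>)"
proof -
  have "Poly_Mapping.single \<beta> c * Q =
      Poly_Mapping.single \<beta> c * (\<Sum>\<alpha>\<in>Poly_Mapping.keys Q. Poly_Mapping.single \<alpha> (Poly_Mapping.lookup Q \<alpha>))"
    by (simp add: poly_mapping_sum_singles)
  then show ?thesis
    by (simp add: sum_distrib_left mult_single lookup_sum lookup_single)
qed

lemma lookup_single_times_shifted:
  fixes Q :: "'p::prime_card zpoly"
  shows "Poly_Mapping.lookup (Poly_Mapping.single \<beta> c * Q) (\<beta> + \<gamma>) = c * Poly_Mapping.lookup Q \<gamma>"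
proof -
  have "Poly_Mapping.lookup (Poly_Mapping.single \<beta> c * Q) (\<beta> + \<gamma>) =
      (\<Sum>\<alpha>\<in>Poly_Mapping.keys Q. if \<gamma> = \<alpha> then c * Poly_Mapping.lookup Q \<alpha> else 0)"
    unfolding lookup_single_times by (intro sum.cong) (auto simp: when_def)
  then show ?thesis
    by (auto simp: sum.delta' in_keys_iff)
qed

lemma lookup_single_times_eq_0:
  fixes Q :: "'p::prime_card zpoly"
  assumes "\<And>\<alpha>. \<beta> + \<alpha> \<noteq> \<gamma>"
  shows "Poly_Mapping.lookup (Poly_Mapping.single \<beta> c * Q) \<gamma> = 0"
  by (simp add: lookup_single_times assms)

text \<open>
  Operators that multiply each monomial by a scalar serve three purposes below: indicator functions
  of exponents set variables to zero or extract \<open>p\<close>-th powers, and additive functions of exponents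
  give the Euler derivations.
\<close>
definition diag :: "(exponent \<Rightarrow> 'p mod_ring) \<Rightarrow> 'p::prime_card zpoly \<Rightarrow> 'p zpoly" where
  "diag u P = Poly_Mapping.mapp (\<lambda>\<alpha> c. u \<alpha> * c) P"

lemma lookup_diag [simp]: "Poly_Mapping.lookup (diag u P) \<alpha> = u \<alpha> * Poly_Mapping.lookup P \<alpha>"
  by (auto simp: diag_def lookup_mapp in_keys_iff when_def)

lemma diag_0 [simp]: "diag u 0 = 0"
  by (rule poly_mapping_eqI) simp

lemma diag_add: "diag u (P + Q) = diag u P + diag u Q"
  by (rule poly_mapping_eqI) (simp add: lookup_add algebra_simps)

lemma diag_sum: "diag u (\<Sum>i\<in>A. f i) = (\<Sum>i\<in>A. diag u (f i))"
  by (induction A rule: infinite_finite_induct) (simp_all add: diag_add)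

lemma diag_single: "diag u (Poly_Mapping.single \<alpha> c) = Poly_Mapping.single \<alpha> (u \<alpha> * c)"
  by (rule poly_mapping_eqI) (simp add: lookup_single when_def)

text \<open>
  Both sides are bilinear, so it suffices to compare them on monomials.  The two summands on the
  right cover ring homomorphisms, derivations and linear maps at once.
\<close>
lemma diag_mult:
  assumes u: "\<And>\<alpha> \<beta>. \<alpha> \<in> Poly_Mapping.keys P \<Longrightarrow> \<beta> \<in> Poly_Mapping.keys Q \<Longrightarrow>
    u (\<alpha> + \<beta>) = v1 \<alpha> * w1 \<beta> + v2 \<alpha> * w2 \<beta>"
  shows "diag u (P * Q) = diag v1 P * diag w1 Q + diag v2 P * diag w2 Q"
proof -
  let ?p = "\<lambda>\<alpha>. Poly_Mapping.single \<alpha> (Poly_Mapping.lookup P \<alpha>)"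
  let ?q = "\<lambda>\<alpha>. Poly_Mapping.single \<alpha> (Poly_Mapping.lookup Q \<alpha>)"
  have P: "P = (\<Sum>\<alpha>\<in>Poly_Mapping.keys P. ?p \<alpha>)" and Q: "Q = (\<Sum>\<alpha>\<in>Poly_Mapping.keys Q. ?q \<alpha>)"
    by (simp_all add: poly_mapping_sum_singles)
  have "diag u (P * Q) = diag u ((\<Sum>\<alpha>\<in>Poly_Mapping.keys P. ?p \<alpha>) * (\<Sum>\<alpha>\<in>Poly_Mapping.keys Q. ?q \<alpha>))"
    by (simp add: poly_mapping_sum_singles)
  also have "\<dots> = (\<Sum>\<alpha>\<in>Poly_Mapping.keys P. \<Sum>\<beta>\<in>Poly_Mapping.keys Q. diag u (?p \<alpha> * ?q \<beta>))"
    by (simp add: sum_product diag_sum)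
  also have "\<dots> = (\<Sum>\<alpha>\<in>Poly_Mapping.keys P. \<Sum>\<beta>\<in>Poly_Mapping.keys Q.
      diag v1 (?p \<alpha>) * diag w1 (?q \<beta>) + diag v2 (?p \<alpha>) * diag w2 (?q \<beta>))"
    by (intro sum.cong refl)
      (simp add: diag_single mult_single u algebra_simps flip: single_add)
  also have "\<dots> = diag v1 (\<Sum>\<alpha>\<in>Poly_Mapping.keys P. ?p \<alpha>) * diag w1 (\<Sum>\<alpha>\<in>Poly_Mapping.keys Q. ?q \<alpha>) +
      diag v2 (\<Sum>\<alpha>\<in>Poly_Mapping.keys P. ?p \<alpha>) * diag w2 (\<Sum>\<alpha>\<in>Poly_Mapping.keys Q. ?q \<alpha>)"
    by (simp add: sum.distrib sum_product diag_sum)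
  finally show ?thesis
    by (simp only: poly_mapping_sum_singles)
qed

definition weight :: "(int \<Rightarrow> exponent \<Rightarrow> 'p mod_ring) \<Rightarrow> 'p::prime_card zser \<Rightarrow> 'p zser" where
  "weight u F = Abs_fls (\<lambda>n. diag (u n) (F $$ n))"

lemma weight_nth [simp]: "weight u F $$ n = diag (u n) (F $$ n)"
  unfolding weight_def by (rule nth_Abs_fls_lower_bound[of "fls_subdegree F"]) simp

lemma zser_eqI: "(\<And>n \<alpha>. Poly_Mapping.lookup (F $$ n) \<alpha> = Poly_Mapping.lookup (G $$ n) \<alpha>) \<Longrightarrow> F = (G :: 'p::prime_card zser)"
  by (intro fls_eqI poly_mapping_eqI)

lemma weight_0 [simp]: "weight u 0 = 0"
  by (rule zser_eqI) simp

lemma weight_add: "weight u (F + G) = weight u F + weight u G"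
  by (rule zser_eqI) (simp add: lookup_add algebra_simps)

lemma weight_diff: "weight u (F - G) = weight u F - weight u G"
  by (rule zser_eqI) (simp add: lookup_minus algebra_simps)

lemma weight_zero [simp]: "weight (\<lambda>n \<alpha>. 0) F = 0"
  by (rule zser_eqI) simp

lemma weight_weight: "weight u (weight v F) = weight (\<lambda>n \<alpha>. u n \<alpha> * v n \<alpha>) F"
  by (rule zser_eqI) (simp add: mult.assoc)

lemma weight_funpow: "(weight u ^^ k) F = weight (\<lambda>n \<alpha>. u n \<alpha> ^ k) F"
proof (induction k)
  case 0
  then show ?case by (auto intro: zser_eqI)
qed (simp add: weight_weight)

lemma weight_mult:
  assumes u: "\<And>n \<alpha> m \<beta>. \<alpha> \<in> Poly_Mapping.keys (F $$ n) \<Longrightarrow> \<beta> \<in> Poly_Mapping.keys (G $$ m) \<Longrightarrow>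
    u (n + m) (\<alpha> + \<beta>) = v1 n \<alpha> * w1 m \<beta> + v2 n \<alpha> * w2 m \<beta>"
  shows "weight u (F * G) = weight v1 F * weight w1 G + weight v2 F * weight w2 G"
proof (rule fls_eqI)
  fix n
  let ?a = "fls_subdegree F" and ?b = "fls_subdegree G"
  have "weight u (F * G) $$ n = (\<Sum>i=?a..n - ?b. diag (u n) (F $$ i * G $$ (n - i)))"
    by (simp add: fls_times_nth(2) diag_sum)
  also have "\<dots> = (\<Sum>i=?a..n - ?b. diag (v1 i) (F $$ i) * diag (w1 (n - i)) (G $$ (n - i)) +
      diag (v2 i) (F $$ i) * diag (w2 (n - i)) (G $$ (n - i)))"
    using u[of _ _ _ "n - _"] by (intro sum.cong refl diag_mult) (metis add.commute diff_add_cancel)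
  also have "\<dots> = (weight v1 F * weight w1 G + weight v2 F * weight w2 G) $$ n"
    by (simp add: fls_times_nth_bounds[of ?a _ ?b] sum.distrib)
  finally show "weight u (F * G) $$ n = (weight v1 F * weight w1 G + weight v2 F * weight w2 G) $$ n" .
qed

definition additive_weight :: "(int \<Rightarrow> exponent \<Rightarrow> 'p::prime_card mod_ring) \<Rightarrow> bool" where
  "additive_weight u \<longleftrightarrow> (\<forall>n m \<alpha> \<beta>. u (n + m) (\<alpha> + \<beta>) = u n \<alpha> + u m \<beta>)"

lemma weight_derivation:
  assumes "additive_weight u"
  shows "weight u (F * G) = weight u F * G + F * weight u G"
proof -
  have 1: "weight (\<lambda>n \<alpha>. 1) F = F" for F :: "'a zser"
    by (rule zser_eqI) simp
  show ?thesis
    using weight_mult[of F G u u "\<lambda>n \<alpha>. 1" "\<lambda>n \<alpha>. 1" u] assms by (simp add: additive_weight_def 1)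
qed

definition restrict_ser :: "(int \<Rightarrow> exponent \<Rightarrow> bool) \<Rightarrow> 'p::prime_card zser \<Rightarrow> 'p zser" where
  "restrict_ser A = weight (\<lambda>n \<alpha>. of_bool (A n \<alpha>))"

text \<open>
  If a product of monomials lies in \<open>A\<close> only when both factors do, then the monomials outside \<open>A\<close>
  span an ideal, and restriction to \<open>A\<close> is the projection modulo this ideal.
\<close>
definition is_face :: "(int \<Rightarrow> exponent \<Rightarrow> bool) \<Rightarrow> bool" where
  "is_face A \<longleftrightarrow> A 0 0 \<and> (\<forall>n m \<alpha> \<beta>. A (n + m) (\<alpha> + \<beta>) \<longleftrightarrow> A n \<alpha> \<and> A m \<beta>)"

lemma lookup_restrict_ser [simp]:
  "Poly_Mapping.lookup (restrict_ser A F $$ n) \<alpha> = (if A n \<alpha> then Poly_Mapping.lookup (F $$ n) \<alpha> else 0)"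
  by (simp add: restrict_ser_def)

lemma restrict_ser_0 [simp]: "restrict_ser A 0 = 0"
  by (simp add: restrict_ser_def)

lemma restrict_ser_add: "restrict_ser A (F + G) = restrict_ser A F + restrict_ser A G"
  by (simp add: restrict_ser_def weight_add)

lemma restrict_ser_diff: "restrict_ser A (F - G) = restrict_ser A F - restrict_ser A G"
  by (simp add: restrict_ser_def weight_diff)

lemma restrict_ser_mult:
  "is_face A \<Longrightarrow> restrict_ser A (F * G) = restrict_ser A F * restrict_ser A G"
  unfolding restrict_ser_def
  by (subst weight_mult[where ?v2.0 = "\<lambda>_ _. 0" and ?w2.0 = "\<lambda>_ _. 0"])
    (auto simp: is_face_def of_bool_conj weight_zero)

lemma restrict_ser_monomial:
  "restrict_ser A (fls_const (Poly_Mapping.single \<alpha> c)) = (if A 0 \<alpha> then fls_const (Poly_Mapping.single \<alpha> c) else 0)"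
  by (rule zser_eqI) (auto simp: lookup_single when_def)

lemma restrict_ser_1: "is_face A \<Longrightarrow> restrict_ser A 1 = 1"
  using restrict_ser_monomial[of A 0 1] by (simp add: is_face_def)

lemma restrict_ser_X: "restrict_ser A fls_X = (if A 1 0 then fls_X else 0)"
  by (rule zser_eqI) (auto simp: lookup_one when_def)

lemma restrict_ser_power: "is_face A \<Longrightarrow> restrict_ser A (F ^ n) = restrict_ser A F ^ n"
  by (induction n) (simp_all add: restrict_ser_1 restrict_ser_mult)

lemma prod_Z_power: "(\<Prod>i\<in>Poly_Mapping.keys \<alpha>. Z i ^ Poly_Mapping.lookup \<alpha> i) = (Poly_Mapping.single \<alpha> 1 :: 'p::prime_card zpoly)"
proof -
  have power: "Z i ^ n = (Poly_Mapping.single (Poly_Mapping.single i n) 1 :: 'p zpoly)" for i n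
    by (induction n) (simp_all add: Z_def mult_single flip: single_add)
  have "(\<Prod>i\<in>I. Poly_Mapping.single (f i) 1) = (Poly_Mapping.single (\<Sum>i\<in>I. f i) 1 :: 'p zpoly)"
    for I :: "nat set" and f :: "nat \<Rightarrow> exponent"
    by (induction I rule: infinite_finite_induct) (simp_all add: mult_single)
  then show ?thesis
    by (simp add: power poly_mapping_sum_singles)
qed

text \<open>
  Substituting zero for a variable removes exactly the monomials in which it occurs, so projections
  are instances of \<open>restrict_ser\<close>.
\<close>
lemma kill_vars_eq_diag: "kill_vars k P = diag (\<lambda>\<alpha>. of_bool (Poly_Mapping.keys \<alpha> \<subseteq> {..<k})) P"
proof -
  have "Poly_Mapping.single 0 c * (\<Prod>i\<in>Poly_Mapping.keys \<alpha>. (if i < k then Z i else 0) ^ Poly_Mapping.lookup \<alpha> i) =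
      diag (\<lambda>\<alpha>. of_bool (Poly_Mapping.keys \<alpha> \<subseteq> {..<k})) (Poly_Mapping.single \<alpha> c)" for \<alpha> and c :: "'a mod_ring"
  proof (cases "Poly_Mapping.keys \<alpha> \<subseteq> {..<k}")
    case True
    then have "(\<Prod>i\<in>Poly_Mapping.keys \<alpha>. (if i < k then Z i else 0) ^ Poly_Mapping.lookup \<alpha> i) =
        (\<Prod>i\<in>Poly_Mapping.keys \<alpha>. (Z i :: 'a zpoly) ^ Poly_Mapping.lookup \<alpha> i)"
      by (intro prod.cong) auto
    then show ?thesis
      using True by (simp add: prod_Z_power mult_single diag_single)
  next
    case False
    then have "(\<Prod>i\<in>Poly_Mapping.keys \<alpha>. (if i < k then Z i else 0) ^ Poly_Mapping.lookup \<alpha> i) = (0 :: 'a zpoly)"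
      by (intro prod_zero) (auto simp: in_keys_iff)
    then show ?thesis
      using False by (simp add: diag_single)
  qed
  then have "kill_vars k P = diag (\<lambda>\<alpha>. of_bool (Poly_Mapping.keys \<alpha> \<subseteq> {..<k}))
      (\<Sum>\<alpha>\<in>Poly_Mapping.keys P. Poly_Mapping.single \<alpha> (Poly_Mapping.lookup P \<alpha>))"
    by (simp add: kill_vars_def diag_sum)
  then show ?thesis
    by (simp only: poly_mapping_sum_singles)
qed

lemma proj_eq_restrict_ser: "proj k F = restrict_ser (\<lambda>n \<alpha>. Poly_Mapping.keys \<alpha> \<subseteq> {..<k}) F"
  by (rule zser_eqI) (simp add: proj_def map_fls_nth kill_vars_eq_diag)

lemma keys_add_nat: "Poly_Mapping.keys (\<alpha> + \<beta> :: exponent) = Poly_Mapping.keys \<alpha> \<union> Poly_Mapping.keys \<beta>"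
  by (auto simp: in_keys_iff lookup_add)

lemma is_face_keys: "is_face (\<lambda>n \<alpha>. Poly_Mapping.keys \<alpha> \<subseteq> S)"
  by (auto simp: is_face_def keys_add_nat)

section \<open>Coefficientwise maps of Laurent series\<close>

lemma map_fls_0: "f 0 = 0 \<Longrightarrow> map_fls f 0 = 0"
  by (rule fls_eqI) (simp add: map_fls_nth)

lemma map_fls_1: "f 0 = 0 \<Longrightarrow> f 1 = 1 \<Longrightarrow> map_fls f 1 = 1"
  by (rule fls_eqI) (simp add: map_fls_nth)

lemma map_fls_X: "f 0 = 0 \<Longrightarrow> f 1 = 1 \<Longrightarrow> map_fls f fls_X = fls_X"
  by (rule fls_eqI) (simp add: map_fls_nth)

lemma map_fls_const: "f 0 = 0 \<Longrightarrow> map_fls f (fls_const c) = fls_const (f c)"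
  by (rule fls_eqI) (simp add: map_fls_nth)

lemma map_fls_mult:
  fixes f :: "'a::semiring_0 \<Rightarrow> 'b::semiring_0"
  assumes "f 0 = 0" "\<And>a b. f (a + b) = f a + f b" "\<And>a b. f (a * b) = f a * f b"
  shows "map_fls f (F * G) = map_fls f F * map_fls f G"
proof (rule fls_eqI)
  fix n
  let ?a = "fls_subdegree F" and ?b = "fls_subdegree G"
  have sum: "f (\<Sum>i\<in>I. g i) = (\<Sum>i\<in>I. f (g i))" for I :: "int set" and g
    by (induction I rule: infinite_finite_induct) (simp_all add: assms)
  show "map_fls f (F * G) $$ n = (map_fls f F * map_fls f G) $$ n"
    by (subst fls_times_nth_bounds[of ?a "map_fls f F" ?b])
      (simp_all add: map_fls_nth assms(1,3) fls_times_nth(2)[of F] sum)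
qed

lemma to_Rp_nth: "to_Rp F $$ n = to_fract (F $$ n)"
  by (simp add: to_Rp_def map_fls_nth)

lemma to_Rp_0 [simp]: "to_Rp 0 = 0" and to_Rp_1 [simp]: "to_Rp 1 = 1" and to_Rp_X [simp]: "to_Rp fls_X = fls_X"
  by (simp_all add: to_Rp_def map_fls_0 map_fls_1 map_fls_X)

lemma to_Rp_Z [simp]: "to_Rp (Zl i) = Zser i"
  by (simp add: to_Rp_def map_fls_const Zser_def Zfrac_def)

lemma to_Rp_add: "to_Rp (F + G) = to_Rp F + to_Rp G"
  by (rule fls_eqI) (simp add: to_Rp_nth)

lemma to_Rp_diff: "to_Rp (F - G) = to_Rp F - to_Rp G"
  by (rule fls_eqI) (simp add: to_Rp_nth)

lemma to_Rp_mult: "to_Rp (F * G) = to_Rp F * to_Rp G"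
  unfolding to_Rp_def by (rule map_fls_mult) simp_all

lemma to_Rp_eq_iff: "to_Rp F = to_Rp G \<longleftrightarrow> F = G"
  by (auto simp: fls_eq_iff to_Rp_nth)

lemma to_Rp_eq_0_iff [simp]: "to_Rp F = 0 \<longleftrightarrow> F = 0"
  using to_Rp_eq_iff[of F 0] by simp

lemma to_Rp_power: "to_Rp (F ^ n) = to_Rp F ^ n"
  by (induction n) (simp_all add: to_Rp_mult)

lemma z_coeff_nth: "z_coeff \<alpha> F $$ n = Poly_Mapping.lookup (F $$ n) \<alpha>"
  by (simp add: z_coeff_def map_fls_nth)

section \<open>Division by a variable\<close>

definition drop_var :: "nat \<Rightarrow> 'p::prime_card zser \<Rightarrow> 'p zser" where
  "drop_var i = restrict_ser (\<lambda>n \<alpha>. Poly_Mapping.lookup \<alpha> i = 0)"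

text \<open>
  The quotient on division by the variable with index \<open>i\<close>; the remainder is \<open>drop_var i\<close>.
\<close>
definition div_var :: "nat \<Rightarrow> 'p::prime_card zser \<Rightarrow> 'p zser" where
  "div_var i = map_fls (Poly_Mapping.map_key (\<lambda>\<alpha>. \<alpha> + Poly_Mapping.single i 1))"

lemma is_face_drop_var: "is_face (\<lambda>n \<alpha>. Poly_Mapping.lookup \<alpha> i = 0)"
  by (auto simp: is_face_def lookup_add)

lemma inj_add_exponent: "inj (\<lambda>\<alpha>::exponent. \<alpha> + \<beta>)"
  by (auto simp: inj_def)

lemma lookup_div_var [simp]:
  "Poly_Mapping.lookup (div_var i F $$ n) \<alpha> = Poly_Mapping.lookup (F $$ n) (\<alpha> + Poly_Mapping.single i 1)"
proof -
  have "Poly_Mapping.map_key (\<lambda>\<alpha>. \<alpha> + Poly_Mapping.single i 1) 0 = (0 :: 'a zpoly)"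
    by (rule poly_mapping_eqI) (simp add: map_key.rep_eq[OF inj_add_exponent])
  then show ?thesis
    by (simp add: div_var_def map_fls_nth map_key.rep_eq[OF inj_add_exponent])
qed

lemma drop_var_div_var: "F = drop_var i F + Zl i * div_var i F"
proof (rule zser_eqI)
  fix n \<alpha>
  let ?e = "Poly_Mapping.single i 1 :: exponent"
  have Z: "Z i = (Poly_Mapping.single ?e 1 :: 'a zpoly)"
    by (simp add: Z_def)
  show "Poly_Mapping.lookup (F $$ n) \<alpha> = Poly_Mapping.lookup ((drop_var i F + Zl i * div_var i F) $$ n) \<alpha>"
  proof (cases "Poly_Mapping.lookup \<alpha> i = 0")
    case True
    then have "Poly_Mapping.lookup (Poly_Mapping.single ?e 1 * div_var i F $$ n) \<alpha> = 0"
      by (intro lookup_single_times_eq_0) (auto simp: poly_mapping_eq_iff lookup_add fun_eq_iff intro!: exI[of _ i])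
    then show ?thesis
      using True by (simp add: lookup_add Z drop_var_def)
  next
    case False
    then have "?e + (\<alpha> - ?e) = \<alpha>"
      by (intro poly_mapping_eqI) (auto simp: lookup_add lookup_minus lookup_single when_def)
    then show ?thesis
      using False lookup_single_times_shifted[of ?e 1 "div_var i F $$ n" "\<alpha> - ?e"]
      by (simp add: lookup_add Z drop_var_def add.commute)
  qed
qed

section \<open>Algebraic relations with polynomial coefficients\<close>

inductive_set ring_adjoin :: "'a::comm_ring_1 set \<Rightarrow> 'a set" for S :: "'a set" where
  base: "a \<in> S \<Longrightarrow> a \<in> ring_adjoin S"
| one: "1 \<in> ring_adjoin S"
| diff: "a \<in> ring_adjoin S \<Longrightarrow> b \<in> ring_adjoin S \<Longrightarrow> a - b \<in> ring_adjoin S"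
| mult: "a \<in> ring_adjoin S \<Longrightarrow> b \<in> ring_adjoin S \<Longrightarrow> a * b \<in> ring_adjoin S"

lemma ring_adjoin_0: "0 \<in> ring_adjoin S"
  using ring_adjoin.diff[OF ring_adjoin.one ring_adjoin.one, of S] by simp

lemma ring_adjoin_uminus: "a \<in> ring_adjoin S \<Longrightarrow> - a \<in> ring_adjoin S"
  using ring_adjoin.diff[OF ring_adjoin_0] by fastforce

lemma ring_adjoin_add: "a \<in> ring_adjoin S \<Longrightarrow> b \<in> ring_adjoin S \<Longrightarrow> a + b \<in> ring_adjoin S"
  using ring_adjoin.diff[OF _ ring_adjoin_uminus] by fastforce

lemma ring_adjoin_power: "a \<in> ring_adjoin S \<Longrightarrow> a ^ n \<in> ring_adjoin S"
  by (induction n) (auto intro: ring_adjoin.intros)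

lemma ring_adjoin_of_nat: "of_nat n \<in> ring_adjoin S"
  by (induction n) (auto intro: ring_adjoin_0 ring_adjoin_add ring_adjoin.one)

lemma ring_adjoin_hom:
  assumes "a \<in> ring_adjoin S" "f 1 = 1" "\<And>a b. f (a - b) = f a - f b" "\<And>a b. f (a * b) = f a * f b"
    "\<And>a. a \<in> S \<Longrightarrow> f a \<in> ring_adjoin T"
  shows "f a \<in> ring_adjoin T"
  using assms(1) by induction (auto simp: assms intro: ring_adjoin.intros)

lemma ring_adjoin_mono: "S \<subseteq> T \<Longrightarrow> ring_adjoin S \<subseteq> ring_adjoin T"
proof
  fix a assume "S \<subseteq> T" "a \<in> ring_adjoin S"
  then show "a \<in> ring_adjoin T"
    by (intro ring_adjoin_hom[of a S "\<lambda>x. x" T]) (auto intro: ring_adjoin.base)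
qed

lemma field_adjoin_mono: "S \<subseteq> T \<Longrightarrow> field_adjoin S \<subseteq> field_adjoin T"
proof
  fix a assume "S \<subseteq> T" "a \<in> field_adjoin S"
  show "a \<in> field_adjoin T"
    using \<open>a \<in> field_adjoin S\<close> by induction (use \<open>S \<subseteq> T\<close> in \<open>auto intro: field_adjoin.intros\<close>)
qed

text \<open>
  The polynomials over the prime field in \<open>x\<close> and the variables with index in \<open>I\<close>, as series.
\<close>
definition zpolys :: "nat set \<Rightarrow> 'p::prime_card zser set" where
  "zpolys I = ring_adjoin (insert fls_X (Zl ` I))"

lemma zpolys_mono: "I \<subseteq> J \<Longrightarrow> zpolys I \<subseteq> zpolys J"
  unfolding zpolys_def by (intro ring_adjoin_mono) auto

lemma to_Rp_zpolys: "a \<in> zpolys I \<Longrightarrow> to_Rp a \<in> Fp_xz I"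
  unfolding zpolys_def Fp_xz_def
  by (induction rule: ring_adjoin.induct)
    (auto simp: to_Rp_diff to_Rp_mult intro: field_adjoin.intros)

lemma Fp_xz_fraction:
  "a \<in> Fp_xz I \<Longrightarrow> \<exists>p\<in>zpolys I. \<exists>q\<in>zpolys I. q \<noteq> 0 \<and> a = to_Rp p / to_Rp q"
  unfolding Fp_xz_def
proof (induction rule: field_adjoin.induct)
  case (base a)
  have "1 \<in> zpolys I" "fls_X \<in> zpolys I" "i \<in> I \<Longrightarrow> Zl i \<in> zpolys I" for i
    by (auto simp: zpolys_def intro: ring_adjoin.intros)
  moreover have "a = fls_X \<or> (\<exists>i\<in>I. a = Zser i)"
    using base by auto
  ultimately show ?case
    by (metis to_Rp_X to_Rp_1 to_Rp_Z div_by_1 one_neq_zero)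
next
  case one
  have "1 \<in> zpolys I"
    by (auto simp: zpolys_def intro: ring_adjoin.intros)
  then show ?case by (intro bexI[of _ 1]) auto
next
  case (diff a b)
  then obtain p q p' q' where *: "p \<in> zpolys I" "q \<in> zpolys I" "p' \<in> zpolys I" "q' \<in> zpolys I"
    "q \<noteq> 0" "q' \<noteq> 0" "a = to_Rp p / to_Rp q" "b = to_Rp p' / to_Rp q'"
    by blast
  then have "a - b = to_Rp (p * q' - p' * q) / to_Rp (q * q')"
    by (simp add: to_Rp_diff to_Rp_mult diff_frac_eq)
  moreover have "p * q' - p' * q \<in> zpolys I" "q * q' \<in> zpolys I"
    using * unfolding zpolys_def by (auto intro: ring_adjoin.intros)
  ultimately show ?case
    using * by (metis mult_eq_0_iff)
next
  case (mult a b)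
  then obtain p q p' q' where *: "p \<in> zpolys I" "q \<in> zpolys I" "p' \<in> zpolys I" "q' \<in> zpolys I"
    "q \<noteq> 0" "q' \<noteq> 0" "a = to_Rp p / to_Rp q" "b = to_Rp p' / to_Rp q'"
    by blast
  then have "a * b = to_Rp (p * p') / to_Rp (q * q')"
    by (simp add: to_Rp_mult)
  moreover have "p * p' \<in> zpolys I" "q * q' \<in> zpolys I"
    using * unfolding zpolys_def by (auto intro: ring_adjoin.intros)
  ultimately show ?case
    using * by (metis mult_eq_0_iff)
next
  case (inverse a)
  then obtain p q where *: "p \<in> zpolys I" "q \<in> zpolys I" "q \<noteq> 0" "a = to_Rp p / to_Rp q"
    by blast
  show ?case
  proof (cases "p = 0")
    case True
    then show ?thesis using * by auto
  next
    case False
    then show ?thesis using * by (intro bexI[of _ q] bexI[of _ p]) auto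
  qed
qed

lemma poly_map_poly_hom:
  assumes "f 0 = 0" "\<And>a b. f (a + b) = f a + f b" "\<And>a b. f (a * b) = f a * f b"
  shows "poly (map_poly f P) (f x) = f (poly P x)"
  by (induction P) (simp_all add: Polynomial.map_poly_pCons assms)

lemma clear_denominators:
  assumes "\<And>i. Polynomial.coeff P i \<in> Fp_xz I"
  shows "\<exists>Q q. (\<forall>i. Polynomial.coeff Q i \<in> zpolys I) \<and> q \<noteq> 0 \<and> q \<in> zpolys I \<and>
    map_poly to_Rp Q = Polynomial.smult (to_Rp q) P"
  using assms
proof (induction P)
  case 0
  have "1 \<in> zpolys I" "0 \<in> zpolys I"
    by (auto simp: zpolys_def intro: ring_adjoin.intros ring_adjoin_0)
  then show ?case by (intro exI[of _ 0] exI[of _ 1]) auto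
next
  case (pCons a P)
  have "Polynomial.coeff P i \<in> Fp_xz I" for i
    using pCons.prems[of "Suc i"] by simp
  then obtain Q q where Q: "\<And>i. Polynomial.coeff Q i \<in> zpolys I" "q \<noteq> 0" "q \<in> zpolys I"
    "map_poly to_Rp Q = Polynomial.smult (to_Rp q) P"
    using pCons.IH by blast
  have "a \<in> Fp_xz I"
    using pCons.prems[of 0] by simp
  then obtain r s where rs: "r \<in> zpolys I" "s \<in> zpolys I" "s \<noteq> 0" "a = to_Rp r / to_Rp s"
    using Fp_xz_fraction[of a I] by blast
  have "map_poly to_Rp (Polynomial.smult s Q) = Polynomial.smult (to_Rp s) (map_poly to_Rp Q)"
    by (rule poly_eqI) (simp add: coeff_map_poly to_Rp_mult)
  then have "map_poly to_Rp (pCons (r * q) (Polynomial.smult s Q)) = Polynomial.smult (to_Rp (s * q)) (pCons a P)"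
    using Q(4) rs by (simp add: Polynomial.map_poly_pCons[of to_Rp] to_Rp_mult)
  moreover have "\<forall>i. Polynomial.coeff (pCons (r * q) (Polynomial.smult s Q)) i \<in> zpolys I"
    using Q rs by (auto simp: coeff_pCons zpolys_def split: nat.split intro: ring_adjoin.mult)
  moreover have "s * q \<noteq> 0" "s * q \<in> zpolys I"
    using Q rs by (auto simp: zpolys_def intro: ring_adjoin.mult)
  ultimately show ?case
    by blast
qed

text \<open>
  After clearing denominators, a relation lives in the ring of series with polynomial
  coefficients, where variables can be set to zero.
\<close>
lemma algebraic_over_Fp_xz_iff:
  "algebraic_over (Fp_xz I) (to_Rp F) \<longleftrightarrow>
    (\<exists>Q. Q \<noteq> 0 \<and> (\<forall>i. Polynomial.coeff Q i \<in> zpolys I) \<and> poly Q F = 0)"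
proof
  assume "algebraic_over (Fp_xz I) (to_Rp F)"
  then obtain P where P: "P \<noteq> 0" "\<And>i. Polynomial.coeff P i \<in> Fp_xz I" "poly P (to_Rp F) = 0"
    unfolding algebraic_over_def by blast
  obtain Q q where Q: "\<And>i. Polynomial.coeff Q i \<in> zpolys I" "q \<noteq> 0"
    "map_poly to_Rp Q = Polynomial.smult (to_Rp q) P"
    using clear_denominators[of P I] P(2) by blast
  have "Q \<noteq> 0"
    using Q P by auto
  moreover have "to_Rp (poly Q F) = 0"
    using P(3) by (simp add: Q(3) to_Rp_add to_Rp_mult flip: poly_map_poly_hom[of to_Rp])
  ultimately show "\<exists>Q. Q \<noteq> 0 \<and> (\<forall>i. Polynomial.coeff Q i \<in> zpolys I) \<and> poly Q F = 0"
    using Q(1) by auto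
next
  assume "\<exists>Q. Q \<noteq> 0 \<and> (\<forall>i. Polynomial.coeff Q i \<in> zpolys I) \<and> poly Q F = 0"
  then obtain Q where Q: "Q \<noteq> 0" "\<And>i. Polynomial.coeff Q i \<in> zpolys I" "poly Q F = 0"
    by blast
  have "map_poly to_Rp Q \<noteq> 0"
    using Q(1) by (auto simp: poly_eq_iff coeff_map_poly)
  moreover have "poly (map_poly to_Rp Q) (to_Rp F) = 0"
    using Q(3) by (simp add: poly_map_poly_hom to_Rp_add to_Rp_mult)
  ultimately show "algebraic_over (Fp_xz I) (to_Rp F)"
    unfolding algebraic_over_def using to_Rp_zpolys Q(2) by (intro exI[of _ "map_poly to_Rp Q"]) (auto simp: coeff_map_poly)
qed

section \<open>Setting a variable to zero in an algebraic relation\<close>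

lemma restrict_ser_Z: "restrict_ser A (Zl j) = (if A 0 (Poly_Mapping.single j 1) then Zl j else 0)"
  unfolding Z_def by (rule restrict_ser_monomial)

lemma restrict_zpolys:
  assumes A: "is_face A" "A 1 0" and J: "\<And>j. j \<in> I \<Longrightarrow> A 0 (Poly_Mapping.single j 1) \<Longrightarrow> j \<in> J"
    and a: "a \<in> zpolys I"
  shows "restrict_ser A a \<in> zpolys J"
  using a unfolding zpolys_def
proof (rule ring_adjoin_hom[where f = "restrict_ser A"])
  fix b :: "'a zser"
  assume "b \<in> insert fls_X (Zl ` I)"
  then consider "b = fls_X" | i where "i \<in> I" "b = Zl i"
    by auto
  then show "restrict_ser A b \<in> ring_adjoin (insert fls_X (Zl ` J))"
  proof cases
    case 1
    then show ?thesis
      using A by (simp add: restrict_ser_X ring_adjoin.base)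
  next
    case 2
    then show ?thesis
      using J[of i] unfolding 2(2) restrict_ser_Z by (simp add: ring_adjoin_0 ring_adjoin.base)
  qed
qed (use A in \<open>simp_all add: restrict_ser_1 restrict_ser_diff restrict_ser_mult\<close>)

lemma drop_var_Z: "drop_var i (Zl j) = (if j = i then 0 else Zl j)"
  by (simp add: drop_var_def restrict_ser_Z lookup_single when_def)

lemma restrict_zpolys_id:
  assumes A: "is_face A" "A 1 0" and I: "\<And>j. j \<in> I \<Longrightarrow> A 0 (Poly_Mapping.single j 1)" and a: "a \<in> zpolys I"
  shows "restrict_ser A a = a"
  using a unfolding zpolys_def
  by induction (use A I in \<open>auto simp: restrict_ser_1 restrict_ser_diff restrict_ser_mult restrict_ser_X restrict_ser_Z\<close>)

lemma drop_var_zpolys: "a \<in> zpolys I \<Longrightarrow> drop_var i a \<in> zpolys (I - {i})"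
  unfolding drop_var_def
  by (rule restrict_zpolys[OF is_face_drop_var, where I = I]) (auto simp: lookup_single)

lemma Z_nonzero [simp]: "Z i \<noteq> (0 :: 'p::prime_card zpoly)"
  unfolding Z_def by (metis lookup_single_eq lookup_zero one_neq_zero)

text \<open>
  Elements of the form \<open>drop_var i a + z\<^sub>i * b\<close> with \<open>b\<close> a polynomial form a ring, and
  all generators are of this form.
\<close>
lemma div_var_zpolys:
  assumes a: "a \<in> zpolys I" and i: "i \<in> I"
  shows "div_var i a \<in> zpolys I"
proof -
  have *: "drop_var i a \<in> zpolys I" if "a \<in> zpolys I" for a
    using drop_var_zpolys[OF that, of i] zpolys_mono[of "I - {i}" I] by auto
  have "\<exists>b\<in>zpolys I. a = drop_var i a + Zl i * b"
    using a unfolding zpolys_def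
  proof induction
    case (base a)
    show ?case
    proof (cases "a = Zl i")
      case True
      then show ?thesis
        by (intro bexI[of _ 1])
          (auto simp: drop_var_Z intro: ring_adjoin.one)
    next
      case False
      then have "drop_var i a = a"
        using base by (auto simp: drop_var_Z) (simp add: drop_var_def restrict_ser_X)
      then show ?thesis
        by (intro bexI[of _ 0]) (auto intro: ring_adjoin_0)
    qed
  next
    case one
    then show ?case
      by (intro bexI[of _ 0]) (auto simp: drop_var_def restrict_ser_1 is_face_drop_var intro: ring_adjoin_0)
  next
    case (diff a b)
    then obtain a' b' where "a' \<in> zpolys I" "a = drop_var i a + Zl i * a'"
      "b' \<in> zpolys I" "b = drop_var i b + Zl i * b'"
      unfolding zpolys_def by blast
    then show ?case
      by (intro bexI[of _ "a' - b'"])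
        (auto simp: drop_var_def restrict_ser_diff zpolys_def algebra_simps intro: ring_adjoin.diff)
  next
    case (mult a b)
    then obtain a' b' where ab: "a' \<in> zpolys I" "a = drop_var i a + Zl i * a'"
      "b' \<in> zpolys I" "b = drop_var i b + Zl i * b'"
      unfolding zpolys_def by blast
    have expand: "(x + z * u) * (y + z * v) = x * y + z * (x * v + u * y + z * (u * v))"
      for x y z u v :: "'a zser"
      by (simp add: algebra_simps)
    have d: "drop_var i (a * b) = drop_var i a * drop_var i b"
      by (simp add: drop_var_def restrict_ser_mult is_face_drop_var)
    have "a * b = (drop_var i a + Zl i * a') * (drop_var i b + Zl i * b')"
      using ab by metis
    also have "\<dots> = drop_var i a * drop_var i b + Zl i * (drop_var i a * b' + a' * drop_var i b + Zl i * (a' * b'))"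
      by (rule expand)
    finally have "a * b = drop_var i (a * b) + Zl i * (drop_var i a * b' + a' * drop_var i b + Zl i * (a' * b'))"
      unfolding d .
    moreover have "drop_var i a * b' + a' * drop_var i b + Zl i * (a' * b') \<in> zpolys I"
    proof -
      have "drop_var i a \<in> zpolys I" "drop_var i b \<in> zpolys I"
        using * mult.hyps by (auto simp: zpolys_def)
      then show ?thesis
        using ab i unfolding zpolys_def
        by (intro ring_adjoin_add ring_adjoin.mult) (auto intro: ring_adjoin.base)
    qed
    ultimately show ?case
      unfolding zpolys_def by blast
  qed
  then obtain b where b: "b \<in> zpolys I" "a = drop_var i a + Zl i * b" by blast
  then have "Zl i * b = Zl i * div_var i a"
    using drop_var_div_var[of a i] by (metis add_left_cancel)
  then show ?thesis
    using b by simp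
qed

lemma div_var_0 [simp]: "div_var i 0 = 0"
  by (rule zser_eqI) simp

lemma drop_var_0 [simp]: "drop_var i 0 = 0"
  by (simp add: drop_var_def)

text \<open>
  If some coefficient of the relation survives at \<open>z\<^sub>i = 0\<close>, then setting \<open>z\<^sub>i = 0\<close> gives the required
  relation.  Otherwise all coefficients are divisible by \<open>z\<^sub>i\<close>, and dividing by it lowers the
  exponent of \<open>z\<^sub>i\<close> in every monomial, so this case occurs at most as often as the exponent
  in one chosen monomial of a nonzero coefficient.
\<close>
lemma drop_var_relation:
  assumes Q: "\<And>j. Polynomial.coeff Q j \<in> zpolys I" "poly Q F = 0" and i: "i \<in> I"
    and \<alpha>: "Poly_Mapping.lookup (Polynomial.coeff Q j $$ m) \<alpha> \<noteq> 0"
  shows "\<exists>P. P \<noteq> 0 \<and> (\<forall>j. Polynomial.coeff P j \<in> zpolys (I - {i})) \<and> poly P (drop_var i F) = 0"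
  using Q \<alpha>
proof (induction "Poly_Mapping.lookup \<alpha> i" arbitrary: \<alpha> Q rule: less_induct)
  case (less \<alpha> Q)
  have drop: "poly (map_poly (drop_var i) Q) (drop_var i F) = 0"
    using less.prems(2)
    by (subst poly_map_poly_hom) (auto simp: drop_var_def restrict_ser_add restrict_ser_mult is_face_drop_var)
  show ?case
  proof (cases "map_poly (drop_var i) Q = 0")
    case False
    then show ?thesis
      using drop drop_var_zpolys[OF less.prems(1)]
      by (intro exI[of _ "map_poly (drop_var i) Q"]) (auto simp: coeff_map_poly drop_var_def)
  next
    case True
    have 0: "drop_var i (Polynomial.coeff Q j) = 0" for j
      using arg_cong[OF True, of "\<lambda>P. Polynomial.coeff P j"] by (simp add: coeff_map_poly)
    define Q' where "Q' = map_poly (div_var i) Q"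
    have "Polynomial.coeff Q j = Zl i * div_var i (Polynomial.coeff Q j)" for j
      by (metis 0 add_0 drop_var_div_var)
    then have "Q = Polynomial.smult (Zl i) Q'"
      by (intro poly_eqI) (metis Q'_def coeff_map_poly coeff_smult div_var_0)
    then have "poly Q' F = 0"
      using less.prems(2) by simp
    have "Poly_Mapping.lookup \<alpha> i \<noteq> 0"
    proof
      assume "Poly_Mapping.lookup \<alpha> i = 0"
      then have "Poly_Mapping.lookup (drop_var i (Polynomial.coeff Q j) $$ m) \<alpha> \<noteq> 0"
        using less.prems(3) by (simp add: drop_var_def)
      then show False
        by (simp add: 0)
    qed
    then have \<alpha>: "\<alpha> = (\<alpha> - Poly_Mapping.single i 1) + Poly_Mapping.single i 1"
      by (intro poly_mapping_eqI) (auto simp: lookup_add lookup_minus lookup_single when_def)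
    show ?thesis
    proof (rule less.hyps[of "\<alpha> - Poly_Mapping.single i 1" Q'])
      show "Poly_Mapping.lookup (\<alpha> - Poly_Mapping.single i 1) i < Poly_Mapping.lookup \<alpha> i"
        using \<open>Poly_Mapping.lookup \<alpha> i \<noteq> 0\<close> by (simp add: lookup_minus)
      show "Polynomial.coeff Q' j \<in> zpolys I" for j
        using div_var_zpolys[OF less.prems(1) i] by (simp add: Q'_def coeff_map_poly)
      show "poly Q' F = 0" by fact
      show "Poly_Mapping.lookup (Polynomial.coeff Q' j $$ m) (\<alpha> - Poly_Mapping.single i 1) \<noteq> 0"
        using less.prems(3) \<alpha> unfolding Q'_def by (metis coeff_map_poly div_var_0 lookup_div_var)
    qed
  qed
qed

lemma algebraic_drop_var:
  assumes F: "algebraic_over (Fp_xz I) (to_Rp F)" and i: "i \<in> I"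
  shows "algebraic_over (Fp_xz (I - {i})) (to_Rp (drop_var i F))"
proof -
  obtain Q where Q: "Q \<noteq> 0" "\<And>j. Polynomial.coeff Q j \<in> zpolys I" "poly Q F = 0"
    using F unfolding algebraic_over_Fp_xz_iff by blast
  obtain j where "Polynomial.coeff Q j \<noteq> 0"
    using Q(1) by (auto simp: poly_eq_iff)
  then obtain m \<alpha> where "Poly_Mapping.lookup (Polynomial.coeff Q j $$ m) \<alpha> \<noteq> 0"
    using zser_eqI[of "Polynomial.coeff Q j" 0] by auto
  then show ?thesis
    unfolding algebraic_over_Fp_xz_iff using drop_var_relation[OF Q(2,3) i] by metis
qed

lemma algebraic_div_var:
  assumes F: "algebraic_over (Fp_xz I) (to_Rp F)" and i: "i \<in> I"
  shows "algebraic_over (Fp_xz I) (to_Rp (div_var i F))"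
proof -
  have "to_Rp F = to_Rp (drop_var i F) + Zser i * to_Rp (div_var i F)"
    by (rule arg_cong[OF drop_var_div_var[of F i], of to_Rp, unfolded to_Rp_add to_Rp_mult to_Rp_Z])
  then have "to_Rp F - to_Rp (drop_var i F) = Zser i * to_Rp (div_var i F)"
    by (metis add_diff_cancel_left')
  moreover have "Zser i \<noteq> (0 :: 'a Rp)"
    by (simp add: Zser_def Zfrac_def)
  ultimately have "to_Rp (div_var i F) = (to_Rp F - to_Rp (drop_var i F)) / Zser i"
    by (metis nonzero_mult_div_cancel_left)
  moreover have "algebraic_over (Fp_xz I) (to_Rp (drop_var i F))"
  proof -
    have "Fp_xz (I - {i}) \<subseteq> (Fp_xz I :: 'a Rp set)"
      unfolding Fp_xz_def by (intro field_adjoin_mono) auto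
    then show ?thesis
      using algebraic_drop_var[OF F i] unfolding algebraic_over_def by blast
  qed
  moreover have "algebraic_over (Fp_xz I) (Zser i :: 'a Rp)"
    using i unfolding Fp_xz_def by (intro algebraic_over_base field_adjoin.base) auto
  ultimately show ?thesis
    using F unfolding Fp_xz_def by (metis algebraic_over_divide algebraic_over_diff)
qed

text \<open>
  The coefficient of the \<open>m\<close>-th power of a variable results from dividing \<open>m\<close> times by it,
  discarding remainders, and then setting it to zero; each of these steps preserves algebraicity.
\<close>
lemma algebraic_slice:
  assumes F: "algebraic_over (Fp_xz I) (to_Rp F)" and i: "i \<in> I"
  shows "\<exists>G. algebraic_over (Fp_xz (I - {i})) (to_Rp G) \<and>
    (\<forall>n \<alpha>. Poly_Mapping.lookup \<alpha> i = 0 \<longrightarrow>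
      Poly_Mapping.lookup (G $$ n) \<alpha> = Poly_Mapping.lookup (F $$ n) (\<alpha> + Poly_Mapping.single i m))"
  using F
proof (induction m arbitrary: F)
  case 0
  then show ?case
    using algebraic_drop_var[OF 0 i] by (intro exI[of _ "drop_var i F"]) (simp add: drop_var_def)
next
  case (Suc m)
  obtain G where G: "algebraic_over (Fp_xz (I - {i})) (to_Rp G)"
    "\<And>n \<alpha>. Poly_Mapping.lookup \<alpha> i = 0 \<Longrightarrow>
      Poly_Mapping.lookup (G $$ n) \<alpha> = Poly_Mapping.lookup (div_var i F $$ n) (\<alpha> + Poly_Mapping.single i m)"
    using Suc.IH[OF algebraic_div_var[OF Suc.prems i]] by blast
  have "\<alpha> + Poly_Mapping.single i m + Poly_Mapping.single i 1 = \<alpha> + Poly_Mapping.single i (Suc m)" for \<alpha>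
    by (simp add: add.assoc flip: single_add)
  then show ?case
    using G by (intro exI[of _ G]) simp
qed

section \<open>Coefficients and projections of algebraic series\<close>

lemma z_coeff_add: "z_coeff \<alpha> (F + G) = z_coeff \<alpha> F + z_coeff \<alpha> G"
  by (rule fls_eqI) (simp add: z_coeff_nth lookup_add)

lemma z_coeff_diff: "z_coeff \<alpha> (F - G) = z_coeff \<alpha> F - z_coeff \<alpha> G"
  by (rule fls_eqI) (simp add: z_coeff_nth lookup_minus)

lemma lookup_mult_0:
  fixes P Q :: "'p::prime_card zpoly"
  shows "Poly_Mapping.lookup (P * Q) 0 = Poly_Mapping.lookup P 0 * Poly_Mapping.lookup Q 0"
proof -
  have single: "diag (\<lambda>\<alpha>. of_bool (\<alpha> = 0)) P = Poly_Mapping.single 0 (Poly_Mapping.lookup P 0)" for P :: "'p zpoly"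
    by (rule poly_mapping_eqI) (auto simp: lookup_single)
  have zero: "diag (\<lambda>\<alpha>. 0) P = 0" for P :: "'p zpoly"
    by (rule poly_mapping_eqI) simp
  have "\<alpha> + \<beta> = 0 \<longleftrightarrow> \<alpha> = 0 \<and> \<beta> = 0" for \<alpha> \<beta> :: exponent
    by (auto simp: poly_mapping_eq_iff fun_eq_iff lookup_add)
  then have "diag (\<lambda>\<alpha>. of_bool (\<alpha> = 0)) (P * Q) =
      diag (\<lambda>\<alpha>. of_bool (\<alpha> = 0)) P * diag (\<lambda>\<alpha>. of_bool (\<alpha> = 0)) Q + diag (\<lambda>\<alpha>. 0) P * diag (\<lambda>\<alpha>. 0) Q"
    by (intro diag_mult) (auto simp: of_bool_conj)
  then show ?thesis
    by (simp add: single zero mult_single) (metis lookup_single_eq)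
qed

lemma z_coeff_0_mult: "z_coeff 0 (F * G) = z_coeff 0 F * z_coeff 0 G"
  unfolding z_coeff_def by (rule map_fls_mult) (simp_all add: lookup_add lookup_mult_0)

lemma z_coeff_0_Fp_x:
  assumes "a \<in> zpolys {}"
  shows "z_coeff 0 a \<in> Fp_x"
proof -
  have "z_coeff 0 fls_X = (fls_X :: 'a mod_ring fls)" "z_coeff 0 1 = (1 :: 'a mod_ring fls)"
    by (auto intro!: fls_eqI simp: z_coeff_nth lookup_one)
  with assms show ?thesis
    unfolding zpolys_def Fp_x_def
    by induction (auto simp: z_coeff_diff z_coeff_0_mult intro: field_adjoin.intros)
qed

text \<open>
  No information is lost on passing to constant terms when no variable occurs, so a nontrivial
  relation stays nontrivial.
\<close>
lemma z_coeff_0_eq_0: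
  assumes a: "a \<in> zpolys {}" and 0: "z_coeff 0 a = 0"
  shows "a = 0"
proof (rule zser_eqI)
  fix n \<alpha>
  have "restrict_ser (\<lambda>n \<alpha>. Poly_Mapping.keys \<alpha> \<subseteq> {}) a = a"
    using a by (intro restrict_zpolys_id[OF is_face_keys]) auto
  then have "Poly_Mapping.lookup (a $$ n) \<alpha> = (if \<alpha> = 0 then z_coeff 0 a $$ n else 0)"
    by (metis keys_eq_empty lookup_restrict_ser subset_empty z_coeff_nth)
  then show "Poly_Mapping.lookup (a $$ n) \<alpha> = Poly_Mapping.lookup (0 $$ n) \<alpha>"
    by (simp add: 0)
qed

lemma algebraic_z_coeff_0:
  assumes "algebraic_over (Fp_xz {}) (to_Rp F)"
  shows "algebraic_over Fp_x (z_coeff 0 F)"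
proof -
  obtain Q where Q: "Q \<noteq> 0" "\<And>j. Polynomial.coeff Q j \<in> zpolys {}" "poly Q F = 0"
    using assms unfolding algebraic_over_Fp_xz_iff by blast
  have z0: "z_coeff 0 0 = (0 :: 'a mod_ring fls)"
    by (rule fls_eqI) (simp add: z_coeff_nth)
  obtain j where "Polynomial.coeff Q j \<noteq> 0"
    using Q(1) by (auto simp: poly_eq_iff)
  then have "Polynomial.coeff (map_poly (z_coeff 0) Q) j \<noteq> 0"
    using z_coeff_0_eq_0[OF Q(2)] by (auto simp: coeff_map_poly z0)
  then have "map_poly (z_coeff 0) Q \<noteq> 0"
    by auto
  moreover have "poly (map_poly (z_coeff 0) Q) (z_coeff 0 F) = 0"
    by (subst poly_map_poly_hom) (simp_all add: Q(3) z0 z_coeff_add z_coeff_0_mult)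
  ultimately show ?thesis
    unfolding algebraic_over_def using z_coeff_0_Fp_x[OF Q(2)]
    by (intro exI[of _ "map_poly (z_coeff 0) Q"]) (auto simp: coeff_map_poly z0)
qed

text \<open>
  The exponents are split off one variable at a time, beginning with the variable of largest index.
\<close>
lemma algebraic_z_coeff:
  assumes "algebraic_over (Fp_xz {..<k}) (to_Rp F)" "Poly_Mapping.keys \<alpha> \<subseteq> {..<k}"
  shows "algebraic_over Fp_x (z_coeff \<alpha> F)"
  using assms
proof (induction k arbitrary: F \<alpha>)
  case 0
  then show ?case
    using algebraic_z_coeff_0[of F] by simp
next
  case (Suc k)
  let ?m = "Poly_Mapping.lookup \<alpha> k"
  let ?\<beta> = "\<alpha> - Poly_Mapping.single k ?m"
  have "{..<Suc k} - {k} = {..<k}"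
    by auto
  then obtain G where G: "algebraic_over (Fp_xz {..<k}) (to_Rp G)"
    "\<And>n \<alpha>. Poly_Mapping.lookup \<alpha> k = 0 \<Longrightarrow>
      Poly_Mapping.lookup (G $$ n) \<alpha> = Poly_Mapping.lookup (F $$ n) (\<alpha> + Poly_Mapping.single k ?m)"
    using algebraic_slice[OF Suc.prems(1), of k ?m] by auto
  have "?\<beta> + Poly_Mapping.single k ?m = \<alpha>"
    by (rule poly_mapping_eqI) (simp add: lookup_add lookup_minus lookup_single when_def)
  then have "z_coeff \<alpha> F = z_coeff ?\<beta> G"
    by (intro fls_eqI) (simp add: z_coeff_nth G(2) lookup_minus)
  moreover have "Poly_Mapping.keys ?\<beta> \<subseteq> {..<k}"
  proof
    fix i assume "i \<in> Poly_Mapping.keys ?\<beta>"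
    then have "i \<in> Poly_Mapping.keys \<alpha>" "i \<noteq> k"
      by (auto simp: in_keys_iff lookup_minus lookup_single when_def split: if_splits)
    then show "i \<in> {..<k}"
      using Suc.prems(2) by (auto simp: less_Suc_eq)
  qed
  ultimately show ?case
    using Suc.IH[OF G(1)] by simp
qed

lemma algebraic_z_coeff_of_proj:
  assumes "\<And>k. algebraic_over (Fp_xz {..<k}) (to_Rp (proj k F))"
  shows "algebraic_over Fp_x (z_coeff \<alpha> F)"
proof -
  obtain k where k: "Poly_Mapping.keys \<alpha> \<subseteq> {..<k}"
    using finite_nat_bounded[OF finite_keys] by blast
  then have "z_coeff \<alpha> (proj k F) = z_coeff \<alpha> F"
    by (intro fls_eqI) (simp add: z_coeff_nth proj_eq_restrict_ser)
  then show ?thesis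
    using algebraic_z_coeff[OF assms k] by simp
qed

lemma zpolys_UNIV_bounded: "a \<in> zpolys UNIV \<Longrightarrow> \<exists>m. a \<in> zpolys {..<m}"
  unfolding zpolys_def
proof (induction rule: ring_adjoin.induct)
  case (base a)
  then consider "a = fls_X" | i where "a = Zl i"
    by auto
  then show ?case
  proof cases
    case 1
    then show ?thesis by (auto intro: ring_adjoin.base)
  next
    case 2
    then show ?thesis by (intro exI[of _ "Suc i"]) (auto intro: ring_adjoin.base)
  qed
next
  case one
  then show ?case by (auto intro: ring_adjoin.one)
next
  case (diff a b)
  then obtain m n where "a \<in> zpolys {..<m}" "b \<in> zpolys {..<n}"
    unfolding zpolys_def by blast
  then have "a \<in> zpolys {..<max m n}" "b \<in> zpolys {..<max m n}"
    using zpolys_mono[of "{..<m}" "{..<max m n}"] zpolys_mono[of "{..<n}" "{..<max m n}"] by auto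
  then show ?case
    unfolding zpolys_def by (blast intro: ring_adjoin.diff)
next
  case (mult a b)
  then obtain m n where "a \<in> zpolys {..<m}" "b \<in> zpolys {..<n}"
    unfolding zpolys_def by blast
  then have "a \<in> zpolys {..<max m n}" "b \<in> zpolys {..<max m n}"
    using zpolys_mono[of "{..<m}" "{..<max m n}"] zpolys_mono[of "{..<n}" "{..<max m n}"] by auto
  then show ?case
    unfolding zpolys_def by (blast intro: ring_adjoin.mult)
qed

lemma coeffs_zpolys_UNIV_bounded:
  assumes "\<And>j. Polynomial.coeff Q j \<in> zpolys UNIV"
  shows "\<exists>m\<ge>k. \<forall>j. Polynomial.coeff Q j \<in> zpolys {..<m}"
proof -
  obtain b where b: "\<And>j. Polynomial.coeff Q j \<in> zpolys {..<b j}"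
    using zpolys_UNIV_bounded[OF assms] by metis
  define m where "m = Max (insert k (b ` {..Polynomial.degree Q}))"
  have "Polynomial.coeff Q j \<in> zpolys {..<m}" for j
  proof (cases "j \<le> Polynomial.degree Q")
    case True
    then have "b j \<le> m"
      unfolding m_def by (intro Max_ge) auto
    then show ?thesis
      using b[of j] zpolys_mono[of "{..<b j}" "{..<m}"] by auto
  next
    case False
    then show ?thesis
      by (simp add: coeff_eq_0 zpolys_def ring_adjoin_0)
  qed
  moreover have "k \<le> m"
    unfolding m_def by (intro Max_ge) auto
  ultimately show ?thesis by blast
qed

text \<open>
  The coefficients of a relation involve only the first \<open>m\<close> variables for some \<open>m\<close>.  The relation is
  therefore unaffected by the projection to these variables, and the finitely many remaining
  variables can be set to zero one by one.
\<close>
lemma algebraic_proj: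
  assumes F: "algebraic_over (Fp_xz UNIV) (to_Rp F)"
  shows "algebraic_over (Fp_xz {..<k}) (to_Rp (proj k F))"
proof -
  obtain Q where Q: "Q \<noteq> 0" "\<And>j. Polynomial.coeff Q j \<in> zpolys UNIV" "poly Q F = 0"
    using F unfolding algebraic_over_Fp_xz_iff by blast
  obtain m where m: "m \<ge> k" "\<And>j. Polynomial.coeff Q j \<in> zpolys {..<m}"
    using coeffs_zpolys_UNIV_bounded[OF Q(2)] by blast
  have "proj m 0 = (0 :: 'a zser)"
    by (simp add: proj_eq_restrict_ser)
  then have "map_poly (proj m) Q = Q"
    using restrict_zpolys_id[OF is_face_keys, of "{..<m}" "{..<m}", OF _ _ m(2)]
    by (intro poly_eqI) (simp add: coeff_map_poly proj_eq_restrict_ser)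
  moreover have "poly (map_poly (proj m) Q) (proj m F) = proj m (poly Q F)"
    by (rule poly_map_poly_hom)
      (simp_all add: proj_eq_restrict_ser restrict_ser_add restrict_ser_mult is_face_keys)
  ultimately have "poly Q (proj m F) = 0"
    using Q(3) by (simp add: \<open>proj m 0 = 0\<close>)
  then have "algebraic_over (Fp_xz {..<m}) (to_Rp (proj m F))"
    unfolding algebraic_over_Fp_xz_iff using Q(1) m(2) by blast
  with m(1) show ?thesis
  proof (induction rule: inc_induct)
    case (step n)
    have "drop_var n (proj (Suc n) F) = proj n F"
    proof (rule zser_eqI)
      fix r and \<alpha> :: exponent
      have "Poly_Mapping.keys \<alpha> \<subseteq> {..<n} \<longleftrightarrow> Poly_Mapping.lookup \<alpha> n = 0 \<and> Poly_Mapping.keys \<alpha> \<subseteq> {..<Suc n}"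
        using in_keys_iff[of n \<alpha>] unfolding lessThan_Suc subset_insert_iff
        by (cases "n \<in> Poly_Mapping.keys \<alpha>") auto
      then show "Poly_Mapping.lookup (drop_var n (proj (Suc n) F) $$ r) \<alpha> = Poly_Mapping.lookup (proj n F $$ r) \<alpha>"
        by (auto simp: drop_var_def proj_eq_restrict_ser)
    qed
    moreover have "{..<Suc n} - {n} = {..<n}"
      by auto
    ultimately show ?case
      using algebraic_drop_var[of "{..<Suc n}" "proj (Suc n) F" n] step by simp
  qed
qed

lemma field_adjoin_of_nat: "of_nat n \<in> field_adjoin S"
  by (induction n) (auto intro: field_adjoin_0 field_adjoin_add field_adjoin.one)

lemma field_adjoin_prod: "(\<And>i. i \<in> A \<Longrightarrow> f i \<in> field_adjoin S) \<Longrightarrow> (\<Prod>i\<in>A. f i) \<in> field_adjoin S"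
  by (induction A rule: infinite_finite_induct) (auto intro: field_adjoin.intros)

lemma to_fract_const_field_adjoin:
  fixes c :: "'p::prime_card mod_ring"
  shows "to_fract (Poly_Mapping.single 0 c :: 'p zpoly) \<in> field_adjoin S"
proof -
  obtain n where "c = of_nat n"
    using surj_of_nat_mod_ring by blast
  moreover have "to_fract (of_nat n :: 'p zpoly) = of_nat n"
    by (induction n) simp_all
  ultimately show ?thesis
    by (simp add: field_adjoin_of_nat flip: of_nat_single)
qed

lemma to_fract_prod: "to_fract (\<Prod>i\<in>A. f i) = (\<Prod>i\<in>A. to_fract (f i))"
  by (induction A rule: infinite_finite_induct) simp_all

lemma to_fract_power: "to_fract (a ^ n) = to_fract a ^ n"
  by (induction n) simp_all

lemma to_Rp_proj_Rp_sub: "to_Rp (proj k F) \<in> Rp_sub k"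
proof -
  have "to_fract (kill_vars k P) \<in> field_adjoin (Zfrac ` {..<k})" for P :: "'a zpoly"
    unfolding kill_vars_def to_fract_sum to_fract_mult to_fract_prod to_fract_power
    by (intro field_adjoin_sum field_adjoin.mult field_adjoin_prod field_adjoin_power to_fract_const_field_adjoin)
      (auto intro: field_adjoin.base field_adjoin_0 simp flip: Zfrac_def)
  moreover have "kill_vars k 0 = (0 :: 'a zpoly)"
    by (simp add: kill_vars_def)
  ultimately show ?thesis
    by (simp add: Rp_sub_def to_Rp_nth proj_def map_fls_nth)
qed

section \<open>Series of Artin-Schreier type\<close>

lemma CHAR_zpoly [simp]: "CHAR('p::prime_card zpoly) = CARD('p)"
proof (rule CHAR_eqI)
  show "of_nat CARD('p) = (0 :: 'p zpoly)"
    by (simp add: of_nat_single flip: semiring_char_mod_ring)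
  fix n
  assume "of_nat n = (0 :: 'p zpoly)"
  then have "Poly_Mapping.lookup (Poly_Mapping.single 0 (of_nat n) :: 'p zpoly) 0 = 0"
    by (simp flip: of_nat_single)
  then have "of_nat n = (0 :: 'p mod_ring)"
    by (simp only: lookup_single_eq)
  then show "CARD('p) dvd n"
    by (rule of_nat_0_mod_ring_dvd)
qed

lemma frobenius_sum:
  fixes f :: "'b \<Rightarrow> 'p::prime_card zpoly fps"
  shows "(\<Sum>i\<in>A. f i) ^ CARD('p) = (\<Sum>i\<in>A. f i ^ CARD('p))"
  by (rule freshmans_dream_sum) (simp_all add: prime_card)

lemma frobenius_add:
  fixes a b :: "'p::prime_card zpoly fps"
  shows "(a + b) ^ CARD('p) = a ^ CARD('p) + b ^ CARD('p)"
  by (rule freshmans_dream) (simp_all add: prime_card)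

lemma card_gt_1: "CARD('p::prime_card) > 1"
  using prime_card[where 'a = 'p] by (rule prime_gt_1_nat)

lemma frobenius_minus_1: "(- 1) ^ CARD('p) = (- 1 :: 'p::prime_card zpoly fps)"
  using frobenius_add[of 1 "- 1 :: 'p zpoly fps"] card_gt_1[where 'p = 'p]
  by (simp add: power_0_left eq_neg_iff_add_eq_0 add.commute)

lemma fps_X_power_dvd_iff:
  fixes F :: "'a::comm_ring_1 fps"
  shows "fps_X ^ N dvd F \<longleftrightarrow> (\<forall>m<N. fps_nth F m = 0)"
proof
  assume "fps_X ^ N dvd F"
  then show "\<forall>m<N. fps_nth F m = 0"
    by (auto elim!: dvdE simp: fps_X_power_mult_nth)
next
  assume "\<forall>m<N. fps_nth F m = 0"
  then have "F = fps_X ^ N * fps_shift N F"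
    by (intro fps_ext) (simp add: fps_X_power_mult_nth)
  then show "fps_X ^ N dvd F"
    by (metis dvd_triv_left)
qed

lemma fps_nth_eq_0_if_dvd: "fps_X ^ N dvd F \<Longrightarrow> m < N \<Longrightarrow> fps_nth (F :: 'a::comm_ring_1 fps) m = 0"
  by (simp add: fps_X_power_dvd_iff)

lemma fps_eq_0_if_X_powers_dvd:
  fixes F :: "'a::comm_ring_1 fps"
  assumes "\<And>N. fps_X ^ N dvd F"
  shows "F = 0"
proof (rule fps_ext)
  show "fps_nth F n = fps_nth 0 n" for n
    using fps_nth_eq_0_if_dvd[OF assms[of "Suc n"]] by simp
qed

lemma fps_X_power_dvd_power:
  fixes f :: "'a::comm_ring_1 fps"
  assumes "fps_X dvd f" "N \<le> M"
  shows "fps_X ^ N dvd f ^ M"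
  using assms by (meson dvd_power_same dvd_trans le_imp_power_dvd)

lemma less_card_power: "n < CARD('p::prime_card) ^ n"
  using less_exp[of n] power_mono[of 2 "CARD('p)" n] card_gt_1[where 'p = 'p] by linarith

lemma dvd_power_card:
  fixes a b :: "'a::comm_semiring_1"
  assumes "a dvd b"
  shows "a dvd b ^ CARD('p::prime_card)"
proof -
  have "b dvd b ^ CARD('p)"
    using card_gt_1[where 'p = 'p] by (intro dvd_power) simp
  with assms show ?thesis
    by (rule dvd_trans)
qed

text \<open>
  As \<open>f ^ (p ^ j)\<close> is divisible by \<open>x ^ (p ^ j)\<close> and \<open>j < p ^ j\<close>, only the first \<open>m + 1\<close> summands
  contribute to the coefficient of \<open>x ^ m\<close>.
\<close>
lemma sigma_nth:
  fixes f :: "'p::prime_card zpoly fps"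
  assumes f: "fps_X dvd f" and m: "m < N"
  shows "fps_nth (sigma f) m = fps_nth (\<Sum>j<N. f ^ (CARD('p) ^ j)) m"
proof -
  let ?t = "\<lambda>j. f ^ (CARD('p) ^ j)"
  let ?S = "Abs_fps (\<lambda>m. fps_nth (\<Sum>j<Suc m. ?t j) m)"
  have 0: "fps_nth (?t j) m = 0" if "m < j" for j m
    using fps_nth_eq_0_if_dvd[OF fps_X_power_dvd_power[OF f, of "Suc m" "CARD('p) ^ j"]] that
      less_card_power[of j, where 'p = 'p]
    by simp
  have eq: "fps_nth (\<Sum>j<N. ?t j) m = fps_nth ?S m" if "m < N" for N m
    unfolding fps_sum_nth fps_nth_Abs_fps
    by (rule sum.mono_neutral_right) (use that 0 in auto)
  have "?t sums ?S"
    unfolding sums_def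
    by (rule tendsto_fpsI) (metis (mono_tags, lifting) eq eventually_sequentially less_eq_Suc_le)
  then have "sigma f = ?S"
    unfolding sigma_def by (simp add: sums_iff)
  then show ?thesis
    using eq[OF m] by simp
qed

text \<open>
  The Frobenius map shifts the summands of a partial sum by one.  This gives the equation
  modulo every power of \<open>x\<close>.
\<close>
lemma sigma_equation:
  fixes f :: "'p::prime_card zpoly fps"
  assumes f: "fps_X dvd f"
  shows "sigma f - sigma f ^ CARD('p) = f"
proof -
  let ?P = "CARD('p)"
  have "fps_X ^ N dvd sigma f - sigma f ^ ?P - f" for N
  proof -
    define S where "S = (\<Sum>j<N. f ^ (?P ^ j))"
    define d where "d = sigma f - S"
    have d: "fps_X ^ N dvd d"
      unfolding fps_X_power_dvd_iff d_def S_def using sigma_nth[OF f] by simp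
    have "S ^ ?P = (\<Sum>j<N. f ^ (?P ^ Suc j))"
      unfolding S_def frobenius_sum by (simp add: mult.commute flip: power_mult)
    then have "S + f ^ (?P ^ N) = f + S ^ ?P"
      using sum.lessThan_Suc_shift[of "\<lambda>j. f ^ (?P ^ j)" N] by (simp add: S_def)
    moreover have "sigma f ^ ?P = d ^ ?P + S ^ ?P"
      unfolding frobenius_add[symmetric] by (simp add: d_def)
    ultimately have "sigma f - sigma f ^ ?P - f = d - d ^ ?P - f ^ (?P ^ N)"
      by (simp add: d_def algebra_simps)
    moreover have "fps_X ^ N dvd d ^ ?P"
      using d by (rule dvd_power_card)
    moreover have "fps_X ^ N dvd f ^ (?P ^ N)"
      using fps_X_power_dvd_power[OF f] less_card_power[of N, where 'p = 'p] by (simp add: less_imp_le)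
    ultimately show ?thesis
      using d by (simp add: dvd_diff)
  qed
  then show ?thesis
    using fps_eq_0_if_X_powers_dvd[of "sigma f - sigma f ^ ?P - f"] by simp
qed

lemma sigma_dvd:
  fixes f :: "'p::prime_card zpoly fps"
  assumes f: "fps_X ^ N dvd f" and N: "N > 0"
  shows "fps_X ^ N dvd sigma f"
proof -
  have "fps_X dvd f"
    using f N by (meson dvd_power dvd_trans)
  moreover have "fps_X ^ N dvd (\<Sum>j<N. f ^ (CARD('p) ^ j))"
  proof (rule dvd_sum)
    fix j
    have "f dvd f ^ (CARD('p) ^ j)"
      by (intro dvd_power) simp
    with f show "fps_X ^ N dvd f ^ (CARD('p) ^ j)"
      by (rule dvd_trans)
  qed
  ultimately show ?thesis
    unfolding fps_X_power_dvd_iff using sigma_nth by metis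
qed

text \<open>
  These orders make the infinite product converge and the error terms of the differential equation
  tend to zero.
\<close>
lemma gser_dvd: "fps_X ^ Suc i dvd (gser i :: 'p::prime_card zpoly fps)"
proof (induction i)
  case 0
  then show ?case
    using sigma_dvd[of 1 "fps_X :: 'p zpoly fps"] by simp
next
  case (Suc i)
  have P: "CARD('p) \<ge> 2"
    using card_gt_1[where 'p = 'p] by simp
  have "Suc (Suc i) \<le> Suc i * 2" by simp
  also have "\<dots> \<le> Suc i * CARD('p)"
    using P by (intro mult_le_mono2)
  finally have "(fps_X :: 'p zpoly fps) ^ Suc (Suc i) dvd fps_X ^ (Suc i * CARD('p))"
    by (rule le_imp_power_dvd)
  also have "\<dots> dvd gser i ^ CARD('p)"
    unfolding power_mult by (rule dvd_power_same[OF Suc.IH])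
  finally have "fps_X ^ Suc (Suc i) dvd gser i ^ CARD('p) * (fps_const (Z i) :: 'p zpoly fps)"
    by (rule dvd_mult2)
  then show ?case
    unfolding gser.simps by (rule sigma_dvd) simp
qed

lemma gser_dvd_X: "fps_X dvd gser i"
  using gser_dvd[of i] by (meson dvd_power dvd_trans zero_less_Suc)

lemma gser_0_equation: "gser 0 - gser 0 ^ CARD('p) = (fps_X :: 'p::prime_card zpoly fps)"
  by (simp add: sigma_equation)

lemma gser_Suc_equation:
  "gser (Suc i) - gser (Suc i) ^ CARD('p) = (gser i ^ CARD('p) * fps_const (Z i) :: 'p::prime_card zpoly fps)"
proof -
  have "fps_X dvd (gser i ^ CARD('p) * fps_const (Z i) :: 'p zpoly fps)"
    by (intro dvd_mult2 dvd_power_card gser_dvd_X)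
  then show ?thesis
    by (simp add: sigma_equation)
qed


section \<open>The differential equation of the polynomial H\<close>

lemma of_nat_card_mod_ring: "of_nat CARD('p) = (0 :: 'p::prime_card mod_ring)"
  by (metis of_nat_CHAR semiring_char_mod_ring)

lemma fermat_mod_ring:
  fixes a :: "'p::prime_card mod_ring"
  assumes a: "a \<noteq> 0"
  shows "a ^ (CARD('p) - 1) = 1"
proof -
  obtain j where j: "a = of_nat j"
    using surj_of_nat_mod_ring by blast
  have "\<not> CARD('p) dvd j"
    using a of_nat_eq_0_iff_char_dvd[where 'a = "'p mod_ring", of j] by (simp add: j)
  then have "[j ^ (CARD('p) - 1) = 1] (mod CARD('p))"
    by (rule fermat_theorem[OF prime_card])
  then have "of_nat (j ^ (CARD('p) - 1)) = (of_nat 1 :: 'p mod_ring)"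
    by (simp only: of_nat_eq_iff_cong_CHAR semiring_char_mod_ring)
  then show ?thesis
    by (simp only: j of_nat_power of_nat_1)
qed

text \<open>
  The linear polynomial with constant term 1 and root \<open>j\<close>; its \<open>j\<close>-th power is a factor of \<open>H\<close>.
\<close>
definition H_factor :: "nat \<Rightarrow> 'p::prime_card mod_ring poly" where
  "H_factor j = [:1, - (1 / of_nat j):]"

lemma of_nat_mod_ring_nonzero: "j \<in> {1..<CARD('p)} \<Longrightarrow> of_nat j \<noteq> (0 :: 'p::prime_card mod_ring)"
  using of_nat_0_mod_ring_dvd[where 'a = 'p, of j] by (auto simp: nat_dvd_not_less)

text \<open>
  Both sides have degree less than \<open>p\<close> and agree at all \<open>p\<close> elements of the prime field: at
  0 they are 1, and elsewhere they vanish, the right side by Fermat.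
\<close>
lemma prod_H_factor:
  "(\<Prod>j=1..<CARD('p). H_factor j) = (1 - Polynomial.monom 1 (CARD('p) - 1) :: 'p::prime_card mod_ring poly)"
  (is "?L = ?T")
proof (rule poly_eqI_degree[where A = UNIV])
  have P: "CARD('p) > 1"
    by (rule card_gt_1)
  let ?J = "{1..<CARD('p)}"
  have "Polynomial.degree ?L \<le> (\<Sum>j\<in>?J. Polynomial.degree (H_factor j :: 'p mod_ring poly))"
    using degree_prod_sum_le[of ?J "H_factor :: nat \<Rightarrow> 'p mod_ring poly"] by (simp add: o_def)
  also have "\<dots> \<le> (\<Sum>j\<in>?J. 1)"
    by (intro sum_mono) (simp add: H_factor_def)
  finally show "Polynomial.degree ?L < card (UNIV :: 'p mod_ring set)"
    using P by simp
  have "Polynomial.degree ?T \<le> CARD('p) - 1"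
    by (intro degree_diff_le) (simp_all add: degree_monom_le)
  then show "Polynomial.degree ?T < card (UNIV :: 'p mod_ring set)"
    using P by simp
  fix a :: "'p mod_ring"
  show "poly ?L a = poly ?T a"
  proof (cases "a = 0")
    case True
    then show ?thesis
      using P by (simp add: poly_prod H_factor_def poly_monom power_0_left)
  next
    case False
    obtain j where j: "j < CARD('p)" "a = of_nat j"
      using surj_of_nat_mod_ring by blast
    then have "j \<in> ?J"
      using False by (cases j) auto
    moreover from this have "poly (H_factor j) a = 0"
      using of_nat_mod_ring_nonzero[of j, where 'p = 'p] by (simp add: H_factor_def j)
    ultimately have "poly ?L a = 0"
      unfolding poly_prod by (intro prod_zero) auto
    then show ?thesis
      using fermat_mod_ring[OF False] by (simp add: poly_monom)
  qed
qed

text \<open>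
  Let \<open>T\<close> be the product of the linear factors and \<open>Q j\<close> the cofactor of the \<open>j\<close>-th one.  The product
  rule gives \<open>t * T' = (\<Sum>j. T - Q j) = - T - (\<Sum>j. Q j)\<close>, whereas \<open>T = 1 - t ^ (p - 1)\<close> gives
  \<open>t * T' = t ^ (p - 1) = 1 - T\<close>.
\<close>
lemma sum_H_cofactor:
  "(\<Sum>j=1..<CARD('p). \<Prod>i\<in>{1..<CARD('p)} - {j}. H_factor i) = (- 1 :: 'p::prime_card mod_ring poly)"
proof -
  let ?J = "{1..<CARD('p)}"
  define T where "T = (1 - Polynomial.monom 1 (CARD('p) - 1) :: 'p mod_ring poly)"
  define Q :: "nat \<Rightarrow> 'p mod_ring poly" where "Q j = (\<Prod>i\<in>?J - {j}. H_factor i)" for j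
  have P: "CARD('p) > 1"
    by (rule card_gt_1)
  have T: "(\<Prod>j\<in>?J. H_factor j) = T"
    unfolding T_def by (rule prod_H_factor)
  have minus_1: "of_nat (CARD('p) - 1) = (- 1 :: 'p mod_ring)"
    using P of_nat_card_mod_ring[where 'p = 'p] by (simp add: of_nat_diff)
  have "[:0, 1:] * pderiv T = (\<Sum>j\<in>?J. [:0, 1:] * (Q j * pderiv (H_factor j)))"
    unfolding T[symmetric] pderiv_prod Q_def by (rule sum_distrib_left)
  also have "\<dots> = (\<Sum>j\<in>?J. T - Q j)"
  proof (rule sum.cong)
    fix j assume j: "j \<in> ?J"
    have X: "[:0, 1:] * pderiv (H_factor j :: 'p mod_ring poly) = H_factor j - 1"
      by (rule poly_eqI) (simp add: H_factor_def pderiv_pCons coeff_pCons split: nat.split)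
    have "[:0, 1:] * (Q j * pderiv (H_factor j)) = Q j * (H_factor j - 1)"
      by (simp only: mult.left_commute[of "[:0, 1:]" "Q j"] X)
    moreover have "Q j * H_factor j = T"
      unfolding Q_def T[symmetric] by (subst mult.commute, rule prod.remove[symmetric]) (use j in auto)
    ultimately show "[:0, 1:] * (Q j * pderiv (H_factor j)) = T - Q j"
      by (simp add: right_diff_distrib)
  qed simp
  also have "\<dots> = of_nat (CARD('p) - 1) * T - (\<Sum>j\<in>?J. Q j)"
    by (simp add: sum_subtractf)
  also have "of_nat (CARD('p) - 1) = (- 1 :: 'p mod_ring poly)"
    unfolding of_nat_poly minus_1 by (rule poly_eqI) (simp add: coeff_pCons split: nat.split)
  also have "[:0, 1:] * pderiv T = Polynomial.monom 1 (CARD('p) - 1)"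
  proof -
    have "pderiv T = Polynomial.monom 1 (CARD('p) - 2)"
      unfolding T_def pderiv_diff pderiv_monom minus_1
      by (simp add: minus_monom numeral_2_eq_2)
    moreover have "CARD('p) - 1 = Suc (CARD('p) - 2)"
      using P by simp
    ultimately show ?thesis
      by (simp add: monom_Suc)
  qed
  finally have "(\<Sum>j\<in>?J. Q j) + 1 = 0"
    by (simp add: T_def algebra_simps)
  then show ?thesis
    unfolding Q_def[symmetric] by (simp only: eq_neg_iff_add_eq_0)
qed

text \<open>
  The exponents in \<open>H\<close> are chosen such that the \<open>j\<close>-th factor contributes \<open>- 1 / (1 - t / j)\<close> to the
  logarithmic derivative.  Multiplied by the product of all linear factors, these contributions
  add up to the negative of the sum of the cofactors.
\<close>
lemma H_poly_equation:
  "pderiv H_poly * (1 - Polynomial.monom 1 (CARD('p) - 1)) = (H_poly :: 'p::prime_card mod_ring poly)"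
proof -
  let ?J = "{1..<CARD('p)}"
  let ?L = "H_factor :: nat \<Rightarrow> 'p mod_ring poly"
  let ?Q = "\<lambda>j. \<Prod>i\<in>?J - {j}. ?L i"
  have H: "H_poly = (\<Prod>j\<in>?J. ?L j ^ j)"
    by (simp add: H_poly_def H_factor_def)
  have "pderiv H_poly * (\<Prod>j\<in>?J. ?L j) =
      (\<Sum>j\<in>?J. (\<Prod>i\<in>?J - {j}. ?L i ^ i) * pderiv (?L j ^ j) * (\<Prod>j\<in>?J. ?L j))"
    unfolding H pderiv_prod by (rule sum_distrib_right)
  also have "\<dots> = (\<Sum>j\<in>?J. - (H_poly * ?Q j))"
  proof (rule sum.cong)
    fix j assume j: "j \<in> ?J"
    have d: "pderiv (?L j ^ j) = - (?L j ^ (j - 1))"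
      using of_nat_mod_ring_nonzero[OF j] by (simp add: pderiv_power H_factor_def pderiv_pCons)
    have "?L j ^ j = ?L j ^ (j - 1) * ?L j"
      by (rule power_minus_mult[symmetric]) (use j in simp)
    then have Hj: "H_poly = (?L j ^ (j - 1) * ?L j) * (\<Prod>i\<in>?J - {j}. ?L i ^ i)"
      unfolding H using prod.remove[of ?J j "\<lambda>j. ?L j ^ j"] j by simp
    have P: "(\<Prod>j\<in>?J. ?L j) = ?L j * ?Q j"
      by (rule prod.remove) (use j in auto)
    show "(\<Prod>i\<in>?J - {j}. ?L i ^ i) * pderiv (?L j ^ j) * (\<Prod>j\<in>?J. ?L j) = - (H_poly * ?Q j)"
      unfolding d P Hj by (simp only: mult_minus_left mult_minus_right ac_simps)
  qed simp
  also have "\<dots> = H_poly"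
    using sum_H_cofactor[where 'p = 'p] by (simp add: sum_negf flip: sum_distrib_left)
  finally show ?thesis
    by (simp only: prod_H_factor)
qed

section \<open>Substituting series into polynomials\<close>

lemmas fps_to_fls_mult = fls_times_fps_to_fls

abbreviation emb :: "'p::prime_card zpoly fps \<Rightarrow> 'p Rp" where
  "emb F \<equiv> to_Rp (fps_to_fls F)"

lemma emb_add: "emb (F + G) = emb F + emb G"
  by (simp add: to_Rp_add)

lemma emb_diff: "emb (F - G) = emb F - emb G"
  by (simp add: to_Rp_diff)

lemma emb_mult: "emb (F * G) = emb F * emb G"
  by (simp add: fps_to_fls_mult to_Rp_mult)

lemma emb_power: "emb (F ^ n) = emb F ^ n"
  by (simp add: fps_to_fls_power to_Rp_power)

lemma emb_X: "emb fps_X = fls_X"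
  by simp

lemma emb_Z: "emb (fps_const (Z i)) = Zser i"
  by simp

lemma emb_nth: "emb F $$ n = (if n < 0 then 0 else to_fract (fps_nth F (nat n)))"
  by (simp add: to_Rp_nth)

text \<open>
  Evaluation of a polynomial over the prime field; \<open>H_at\<close> is the case of \<open>H_poly\<close>.
\<close>
definition poly_at :: "'p::prime_card mod_ring poly \<Rightarrow> 'p zpoly fps \<Rightarrow> 'p zpoly fps" where
  "poly_at p f = poly (map_poly const_ser p) f"

lemma const_ser_0: "const_ser 0 = 0" and const_ser_1: "const_ser 1 = 1"
  by (simp_all add: const_ser_def)

lemma const_ser_add: "const_ser (a + b) = const_ser a + const_ser b"
  by (simp add: const_ser_def single_add)

lemma const_ser_mult: "const_ser (a * b) = const_ser a * const_ser b"
  by (simp add: const_ser_def mult_single)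

lemma poly_at_0: "poly_at 0 f = 0"
  by (simp add: poly_at_def)

lemma poly_at_pCons: "poly_at (pCons a p) f = const_ser a + f * poly_at p f"
  by (simp add: poly_at_def Polynomial.map_poly_pCons const_ser_0)

lemma poly_at_add: "poly_at (p + q) f = poly_at p f + poly_at q f"
proof (induction p q rule: poly_induct2)
  case (pCons a p b q)
  have "poly_at (pCons a p + pCons b q) f = const_ser (a + b) + f * poly_at (p + q) f"
    by (simp only: add_pCons poly_at_pCons)
  then show ?case
    by (simp only: pCons.IH poly_at_pCons const_ser_add distrib_left add_ac)
qed (simp add: poly_at_0)

lemma poly_at_smult: "poly_at (Polynomial.smult c p) f = const_ser c * poly_at p f"
proof (induction p)
  case (pCons a p)
  then show ?case
    by (simp only: smult_pCons poly_at_pCons const_ser_mult distrib_left mult.left_commute)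
qed (simp add: poly_at_0)

lemma poly_at_mult: "poly_at (p * q) f = poly_at p f * poly_at q f"
proof (induction p)
  case (pCons a p)
  have "poly_at (pCons a p * q) f = const_ser a * poly_at q f + f * poly_at (p * q) f"
    by (simp only: mult_pCons_left poly_at_add poly_at_smult poly_at_pCons const_ser_0 add_0_left)
  then show ?case
    by (simp only: pCons.IH poly_at_pCons distrib_right mult.assoc)
qed (simp add: poly_at_0)

lemma poly_at_diff: "poly_at (p - q) f = poly_at p f - poly_at q f"
  using poly_at_add[of "p - q" q f] by (simp only: diff_add_cancel add_diff_cancel_right')

lemma poly_at_1: "poly_at 1 f = 1"
  using poly_at_pCons[of 1 0 f] by (simp only: one_pCons[symmetric] poly_at_0 const_ser_1 mult_zero_right add_0_right)

lemma poly_at_monom: "poly_at (Polynomial.monom 1 n) f = f ^ n"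
  by (induction n) (simp_all add: monom_0 monom_Suc poly_at_pCons poly_at_0 const_ser_0 const_ser_1)

lemma H_at_eq_poly_at: "H_at f = poly_at H_poly f"
  by (simp add: H_at_def poly_at_def)

definition dH_at :: "'p::prime_card zpoly fps \<Rightarrow> 'p zpoly fps" where
  "dH_at f = poly_at (pderiv H_poly) f"

text \<open>
  The equation of \<open>H\<close> is multiplied by \<open>f\<close> so that the left side of an Artin-Schreier equation
  appears.
\<close>
lemma dH_at_equation: "dH_at f * (f - f ^ CARD('p)) = H_at f * (f :: 'p::prime_card zpoly fps)"
proof -
  have "H_at f = poly_at (pderiv H_poly * (1 - Polynomial.monom 1 (CARD('p) - 1))) f"
    by (subst H_poly_equation) (rule H_at_eq_poly_at)
  also have "\<dots> = dH_at f * (1 - f ^ (CARD('p) - 1))"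
    by (simp only: poly_at_mult poly_at_diff poly_at_1 poly_at_monom dH_at_def)
  finally have eq: "H_at f = dH_at f * (1 - f ^ (CARD('p) - 1))" .
  have "H_at f * f = dH_at f * (1 - f ^ (CARD('p) - 1)) * f"
    by (simp only: eq)
  also have "\<dots> = dH_at f * (f - f ^ (CARD('p) - 1) * f)"
    by (simp only: mult.assoc left_diff_distrib mult_1_left)
  also have "f ^ (CARD('p) - 1) * f = f ^ CARD('p)"
    by (rule power_minus_mult) simp
  finally show ?thesis
    by (rule sym)
qed

lemma H_at_dvd:
  assumes "fps_X ^ N dvd f"
  shows "fps_X ^ N dvd H_at f - (1 :: 'p::prime_card zpoly fps)"
proof -
  have "f dvd poly_at p f - const_ser (poly p 0)" for p
    by (induction p) (simp_all add: poly_at_0 poly_at_pCons const_ser_0)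
  moreover have "poly H_poly 0 = (1 :: 'p mod_ring)"
    by (simp add: H_poly_def poly_prod)
  ultimately have "f dvd H_at f - 1"
    unfolding H_at_eq_poly_at by (metis const_ser_1)
  with assms show ?thesis
    by (rule dvd_trans)
qed


section \<open>Convergence of the infinite product\<close>

definition exp_factor :: "nat \<Rightarrow> 'p::prime_card zpoly fps" where
  "exp_factor i = H_at ((- 1) ^ i * gser i)"

definition exp_partial :: "nat \<Rightarrow> 'p::prime_card zpoly fps" where
  "exp_partial n = (\<Prod>i\<le>n. exp_factor i)"

lemma exp_partial_Suc: "exp_partial (Suc n) = exp_partial n * exp_factor (Suc n)"
  by (simp add: exp_partial_def)

lemma exp_factor_dvd: "fps_X ^ Suc i dvd exp_factor i - 1"
  unfolding exp_factor_def by (intro H_at_dvd dvd_mult gser_dvd)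

text \<open>
  Each further factor is congruent to 1 modulo a power of \<open>x\<close> that grows with its index.
\<close>
lemma exp_partial_agree:
  assumes "n \<le> m" "j \<le> Suc n"
  shows "fps_nth (exp_partial m :: 'p::prime_card zpoly fps) j = fps_nth (exp_partial n) j"
  using assms(1)
proof (induction rule: dec_induct)
  case (step m)
  have "fps_X ^ Suc (Suc m) dvd exp_partial m * (exp_factor (Suc m) - 1 :: 'p zpoly fps)"
    by (intro dvd_mult exp_factor_dvd)
  then have "fps_nth (exp_partial m * (exp_factor (Suc m) - 1 :: 'p zpoly fps)) j = 0"
    by (rule fps_nth_eq_0_if_dvd) (use assms(2) step.hyps in simp)
  then have "fps_nth (exp_partial (Suc m) :: 'p zpoly fps) j = fps_nth (exp_partial m) j"
    by (simp add: exp_partial_Suc right_diff_distrib)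
  then show ?case
    using step.IH by simp
qed simp

lemma exp_tilde_nth:
  assumes "j \<le> Suc n"
  shows "fps_nth (exp_tilde :: 'p::prime_card zpoly fps) j = fps_nth (exp_partial n) j"
proof -
  let ?E = "Abs_fps (\<lambda>m. fps_nth (exp_partial m) m) :: 'p zpoly fps"
  have eq: "fps_nth (exp_partial n) j = fps_nth ?E j" if "j \<le> Suc n" for n j
  proof -
    have "fps_nth (exp_partial n) j = fps_nth (exp_partial (max n j) :: 'p zpoly fps) j"
      by (rule exp_partial_agree[symmetric]) (use that in auto)
    also have "\<dots> = fps_nth (exp_partial j) j"
      by (rule exp_partial_agree) auto
    finally show ?thesis by simp
  qed
  have "exp_partial \<longlonglongrightarrow> ?E"
    by (rule tendsto_fpsI) (metis (mono_tags, lifting) eq eventually_sequentially le_SucI)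
  \<comment> \<open>The definition of a convergent product demands a nonzero limit.\<close>
  moreover have "?E \<noteq> 0"
  proof
    assume "?E = 0"
    then have "fps_nth ?E 0 = 0"
      by (metis fps_zero_nth)
    moreover have "fps_nth (exp_factor 0 - 1) 0 = (0 :: 'p zpoly)"
      by (rule fps_nth_eq_0_if_dvd[OF exp_factor_dvd]) simp
    ultimately show False
      by (simp add: exp_partial_def)
  qed
  ultimately have "exp_factor has_prod ?E"
    unfolding has_prod_def raw_has_prod_def exp_partial_def[abs_def] by simp
  then have "exp_tilde = ?E"
    unfolding exp_tilde_def exp_factor_def[abs_def] by (rule has_prod_unique[symmetric])
  then show ?thesis
    using eq[OF assms] by simp
qed


section \<open>The differential equation of the infinite product\<close>

lemma Rp_deriv_0 [simp]: "Rp_deriv 0 = (0 :: 'p::prime_card Rp)"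
  by (rule iffD1[OF add_cancel_left_right, OF Rp_deriv_add[of "0 :: 'p Rp" 0, unfolded add_0_left, symmetric]])

lemma Rp_deriv_1 [simp]: "Rp_deriv 1 = (0 :: 'p::prime_card Rp)"
  by (rule iffD1[OF add_cancel_left_right,
        OF Rp_deriv_mult[of "1 :: 'p Rp" 1, unfolded mult_1_left mult_1_right, symmetric]])

lemma Rp_deriv_diff: "Rp_deriv (F - G) = Rp_deriv F - Rp_deriv G"
  using Rp_deriv_add[of "F - G" G] by simp

lemma Rp_deriv_of_nat [simp]: "Rp_deriv (of_nat n) = 0"
  by (induction n) (simp_all add: Rp_deriv_add)

lemma Rp_deriv_power: "Rp_deriv (F ^ n) = of_nat n * F ^ (n - 1) * Rp_deriv F"
proof (induction n)
  case (Suc n)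
  show ?case
    by (cases n) (use Suc in \<open>simp_all add: Rp_deriv_mult algebra_simps\<close>)
qed simp

lemma of_nat_card_zser: "of_nat CARD('p) = (0 :: 'p::prime_card zser)"
  by (metis CHAR_zpoly fls_const_0 fls_of_nat of_nat_CHAR)

lemma of_nat_card_Rp: "of_nat CARD('p) = (0 :: 'p::prime_card Rp)"
proof -
  have "to_Rp (of_nat n) = (of_nat n :: 'p Rp)" for n
    by (induction n) (simp_all add: to_Rp_add)
  then show ?thesis
    by (metis of_nat_card_zser to_Rp_0)
qed

lemma Rp_deriv_power_card: "Rp_deriv (F ^ CARD('p)) = (0 :: 'p::prime_card Rp)"
  by (simp add: Rp_deriv_power of_nat_card_Rp)

lemma Rp_deriv_const_ser:
  fixes a :: "'p::prime_card mod_ring"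
  shows "Rp_deriv (emb (const_ser a)) = 0"
proof -
  obtain n where a: "a = of_nat n"
    using surj_of_nat_mod_ring by blast
  have "emb (const_ser (of_nat n :: 'p mod_ring)) = of_nat n" for n
    by (induction n) (simp_all add: const_ser_0 const_ser_add const_ser_1 to_Rp_add)
  then show ?thesis
    by (simp add: a)
qed

lemma Rp_deriv_poly_at: "Rp_deriv (emb (poly_at p f)) = emb (poly_at (pderiv p) f) * Rp_deriv (emb f)"
  by (induction p)
    (simp_all add: poly_at_0 poly_at_pCons pderiv_pCons poly_at_add emb_add emb_mult Rp_deriv_add Rp_deriv_mult
      Rp_deriv_const_ser const_ser_0 algebra_simps del: fps_to_fls_plus)

lemma Rp_deriv_gser_0: "Rp_deriv (emb (gser 0)) = (1 :: 'p::prime_card Rp)"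
proof -
  have "emb (gser 0 - gser 0 ^ CARD('p)) = (fls_X :: 'p Rp)"
    unfolding gser_0_equation by (rule emb_X)
  then have "Rp_deriv (emb (gser 0) - emb (gser 0) ^ CARD('p)) = (1 :: 'p Rp)"
    by (simp only: emb_diff emb_power Rp_deriv_X)
  then show ?thesis
    by (simp only: Rp_deriv_diff Rp_deriv_power_card diff_zero)
qed

abbreviation Zprod :: "nat \<Rightarrow> 'p::prime_card Rp" where
  "Zprod i \<equiv> (\<Prod>j<i. Zser j)"

lemma emb_gser_Suc:
  "emb (gser (Suc i)) - emb (gser (Suc i)) ^ CARD('p) = emb (gser i) ^ CARD('p) * (Zser i :: 'p::prime_card Rp)"
proof -
  have "emb (gser (Suc i) - gser (Suc i) ^ CARD('p)) = (emb (gser i ^ CARD('p) * fps_const (Z i)) :: 'p Rp)"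
    by (simp only: gser_Suc_equation)
  then show ?thesis
    by (simp only: emb_diff emb_power emb_mult emb_Z)
qed

lemma Rp_deriv_gser_Suc:
  "Rp_deriv (emb (gser (Suc i))) = emb (gser i) ^ CARD('p) / (fls_X * (Zprod i :: 'p::prime_card Rp))"
proof -
  have "Rp_deriv (emb (gser (Suc i)) - emb (gser (Suc i)) ^ CARD('p)) =
      emb (gser i) ^ CARD('p) * (Rp_deriv (Zser i) :: 'p Rp)"
    unfolding emb_gser_Suc Rp_deriv_mult Rp_deriv_power_card by simp
  then show ?thesis
    by (simp only: Rp_deriv_diff Rp_deriv_power_card diff_zero Rp_deriv_Zser times_divide_eq_right mult_1_right)
qed

lemma Zser_nonzero [simp]: "Zser i \<noteq> (0 :: 'p::prime_card Rp)"
  by (simp add: Zser_def Zfrac_def)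

lemma sign_power_card: "((- 1) ^ i) ^ CARD('p) = ((- 1) ^ i :: 'p::prime_card zpoly fps)"
proof (induction i)
  case 0
  show ?case by (simp only: power_0 power_one)
next
  case (Suc i)
  then show ?case by (simp only: power_Suc power_mult_distrib frobenius_minus_1)
qed

lemma dH_at_signed:
  "dH_at ((- 1) ^ i * g) * ((- 1) ^ i * (g - g ^ CARD('p))) =
    H_at ((- 1) ^ i * g) * ((- 1) ^ i * (g :: 'p::prime_card zpoly fps))"
  using dH_at_equation[of "(- 1) ^ i * g"] by (simp only: power_mult_distrib sign_power_card right_diff_distrib)

abbreviation sgn_Rp :: "nat \<Rightarrow> 'p::prime_card Rp" where
  "sgn_Rp i \<equiv> (- 1) ^ i"

lemma to_Rp_uminus: "to_Rp (- F) = - to_Rp F"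
  using to_Rp_diff[of 0 F] by simp

lemma Rp_deriv_uminus: "Rp_deriv (- F) = - Rp_deriv F"
  using Rp_deriv_diff[of 0 F] by simp

lemma emb_sign: "emb ((- 1) ^ i) = (sgn_Rp i :: 'p::prime_card Rp)"
  by (induction i) (simp_all add: to_Rp_uminus)

text \<open>
  In other words, the logarithmic derivative of the factor with index \<open>i\<close> is
  \<open>(- 1) ^ i * g\<^sub>i / (x * z\<^sub>0 * \<dots> * z\<^sub>i\<^sub>-\<^sub>1)\<close>.  The derivative of \<open>g\<^sub>i\<close> is found by differentiating its
  Artin-Schreier equation, in which the \<open>p\<close>-th power is a constant, and the right side of this
  equation cancels against \<open>g\<^sub>i - g\<^sub>i ^ p\<close> in the equation of \<open>H\<close>.
\<close>
lemma Rp_deriv_exp_factor: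
  "Rp_deriv (emb (exp_factor i)) * (fls_X * Zprod i) =
    emb (exp_factor i) * (sgn_Rp i * (emb (gser i) :: 'p::prime_card Rp))"
proof -
  let ?s = "sgn_Rp i :: 'p Rp"
  have sign_const: "Rp_deriv ?s = 0"
    by (induction i) (simp_all add: Rp_deriv_uminus)
  have "Rp_deriv (emb (exp_factor i)) = (emb (dH_at ((- 1) ^ i * gser i)) :: 'p Rp) * (?s * Rp_deriv (emb (gser i)))"
    unfolding exp_factor_def H_at_eq_poly_at Rp_deriv_poly_at dH_at_def emb_mult emb_sign Rp_deriv_mult sign_const
    by simp
  moreover have "Rp_deriv (emb (gser i)) * (fls_X * Zprod i :: 'p Rp) = emb (gser i - gser i ^ CARD('p))"
  proof (cases i)
    case 0
    have g: "emb (gser i - gser i ^ CARD('p)) = (fls_X :: 'p Rp)"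
      unfolding 0 gser_0_equation by (rule emb_X)
    have d: "Rp_deriv (emb (gser i)) = (1 :: 'p Rp)"
      unfolding 0 by (rule Rp_deriv_gser_0)
    show ?thesis
      unfolding g d by (simp add: 0)
  next
    case (Suc j)
    have "emb (gser i - gser i ^ CARD('p)) = (emb (gser j) ^ CARD('p) * Zser j :: 'p Rp)"
      by (simp only: Suc emb_diff emb_power emb_gser_Suc)
    then show ?thesis
      unfolding Suc Rp_deriv_gser_Suc by simp
  qed
  ultimately have "Rp_deriv (emb (exp_factor i)) * (fls_X * Zprod i) =
      emb (dH_at ((- 1) ^ i * gser i)) * (?s * emb (gser i - gser i ^ CARD('p)))"
    by (simp only: mult.assoc)
  also have "\<dots> = emb (dH_at ((- 1) ^ i * gser i) * ((- 1) ^ i * (gser i - gser i ^ CARD('p))))"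
    by (simp only: emb_mult emb_sign)
  also have "\<dots> = emb (exp_factor i) * (?s * emb (gser i))"
    unfolding dH_at_signed by (simp only: emb_mult emb_sign exp_factor_def)
  finally show ?thesis .
qed

text \<open>
  With \<open>g\<^sub>i = g\<^sub>i ^ p + g\<^sub>i\<^sub>-\<^sub>1 ^ p * z\<^sub>i\<^sub>-\<^sub>1\<close> the alternating sum of the logarithmic derivatives of the factors
  telescopes to 1 and a last term containing \<open>g\<^sub>n ^ p\<close>.
\<close>
lemma Rp_deriv_exp_partial:
  "Rp_deriv (emb (exp_partial n)) * (fls_X * Zprod n) =
    emb (exp_partial n) * (fls_X * Zprod n + sgn_Rp n * (emb (gser n) :: 'p::prime_card Rp) ^ CARD('p))"
proof (induction n)
  case 0
  have "emb (gser 0) - emb (gser 0) ^ CARD('p) = (fls_X :: 'p Rp)"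
    by (metis emb_X emb_diff emb_power gser_0_equation)
  then have "emb (gser 0) = fls_X + (emb (gser 0) :: 'p Rp) ^ CARD('p)"
    by (simp only: diff_eq_eq)
  then show ?case
    using Rp_deriv_exp_factor[of 0, where 'p = 'p] by (simp add: exp_partial_def del: gser.simps)
next
  case (Suc n)
  let ?E = "emb (exp_partial n) :: 'p Rp" and ?h = "emb (exp_factor (Suc n)) :: 'p Rp"
  let ?W = "fls_X * Zprod n :: 'p Rp" and ?z = "Zser n :: 'p Rp"
  let ?G = "emb (gser n) ^ CARD('p) :: 'p Rp" and ?g = "emb (gser (Suc n)) :: 'p Rp"
  have W: "fls_X * Zprod (Suc n) = ?W * ?z"
    by (simp add: mult.assoc)
  have h: "Rp_deriv ?h * (?W * ?z) = ?h * (sgn_Rp (Suc n) * ?g)"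
    using Rp_deriv_exp_factor[of "Suc n", where 'p = 'p] unfolding W .
  have g: "?g = ?g ^ CARD('p) + ?G * ?z"
    using emb_gser_Suc[of n, where 'p = 'p] by (simp only: diff_eq_eq add.commute)
  have "Rp_deriv (emb (exp_partial (Suc n))) * (?W * ?z) =
      (Rp_deriv ?E * ?W) * (?h * ?z) + ?E * (Rp_deriv ?h * (?W * ?z))"
    unfolding exp_partial_Suc emb_mult Rp_deriv_mult by (simp only: distrib_left distrib_right ac_simps)
  also have "\<dots> = ?E * (?W + sgn_Rp n * ?G) * (?h * ?z) + ?E * (?h * (sgn_Rp (Suc n) * (?g ^ CARD('p) + ?G * ?z)))"
    unfolding Suc.IH h using g by simp
  also have "\<dots> = (?E * ?h) * (?W * ?z + sgn_Rp (Suc n) * ?g ^ CARD('p))"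
    by (simp add: algebra_simps)
  finally show ?case
    unfolding W exp_partial_Suc emb_mult .
qed

lemma Rp_deriv_nth: "Rp_deriv F $$ m = of_int (m + 1) * F $$ (m + 1) + xD_frac (F $$ (m + 1))"
  by (simp add: Rp_deriv_def map_fls_nth add.commute)

text \<open>
  The last term of the telescoping sum has large order in \<open>x\<close>, so the partial product satisfies the
  differential equation up to this order.
\<close>
lemma exp_partial_error:
  assumes m: "m < int n"
  shows "Rp_deriv (emb (exp_partial n)) $$ m = (emb (exp_partial n) :: 'p::prime_card Rp) $$ m"
proof -
  let ?E = "emb (exp_partial n) :: 'p Rp"
  have "fps_X ^ Suc n dvd (exp_partial n * ((- 1) ^ n * gser n ^ CARD('p)) :: 'p zpoly fps)"
    by (intro dvd_mult dvd_power_card gser_dvd)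
  then obtain t where t: "exp_partial n * ((- 1) ^ n * gser n ^ CARD('p)) = (fps_X ^ Suc n * t :: 'p zpoly fps)"
    by (elim dvdE)
  have et: "?E * (sgn_Rp n * emb (gser n) ^ CARD('p)) = fls_X ^ Suc n * emb t"
    using arg_cong[OF t, of emb] by (simp only: emb_mult emb_power[of "gser n"] emb_power[of fps_X] emb_sign emb_X)
  have W: "fls_const (\<Prod>j<n. Zfrac j) = (Zprod n :: 'p Rp)"
    by (induction n) (simp_all add: Zser_def fls_const_mult_const[symmetric])
  have W0: "fls_X * Zprod n \<noteq> (0 :: 'p Rp)"
    by simp
  have "(Rp_deriv ?E - ?E) * (fls_X * Zprod n) = fls_X ^ Suc n * emb t"
    using Rp_deriv_exp_partial[of n, where 'p = 'p] et by (simp add: algebra_simps)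
  also have "\<dots> = (fls_X ^ n * (emb t / Zprod n)) * (fls_X * Zprod n)"
    by simp
  finally have "Rp_deriv ?E - ?E = fls_X ^ n * (emb t / Zprod n)"
    using W0 by (simp only: mult_cancel_right) simp
  also have "emb t / Zprod n = emb t * fls_const (1 / (\<Prod>j<n. Zfrac j))"
  proof -
    have "fls_const (1 / (\<Prod>j<n. Zfrac j)) = (1 / Zprod n :: 'p Rp)"
      unfolding W[symmetric] fls_const_divide_const[symmetric] fls_const_1 ..
    then show ?thesis
      by (simp only: times_divide_eq_right mult_1_right)
  qed
  also have "(fls_X ^ n * (emb t * fls_const (1 / (\<Prod>j<n. Zfrac j)))) $$ m = 0"
    using m by (simp add: fls_X_power_times_conv_shift emb_nth)
  finally show ?thesis
    by simp
qed

text \<open>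
  A coefficient of the derivative depends on a single coefficient of the series, so the equation can
  be checked on partial products.
\<close>
theorem exp_tilde_ode: "Rp_deriv (emb exp_tilde) = (emb exp_tilde :: 'p::prime_card Rp)"
proof (rule fls_eqI)
  fix m
  \<comment> \<open>Large enough for the coefficient of \<open>x ^ (m + 1)\<close> and for the bound on the error.\<close>
  let ?n = "nat \<bar>m\<bar> + 1"
  have eq: "emb exp_tilde $$ j = (emb (exp_partial ?n) :: 'p Rp) $$ j" if "j \<le> m + 1" for j
    using that by (simp add: emb_nth exp_tilde_nth[of "nat j" ?n])
  have "Rp_deriv (emb exp_tilde) $$ m = (Rp_deriv (emb (exp_partial ?n)) :: 'p Rp) $$ m"
    unfolding Rp_deriv_nth by (simp only: eq[of "m + 1"] order_refl)
  also have "\<dots> = emb (exp_partial ?n) $$ m"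
    by (rule exp_partial_error) simp
  also have "\<dots> = emb exp_tilde $$ m"
    by (rule eq[symmetric]) simp
  finally show "Rp_deriv (emb exp_tilde) $$ m = (emb exp_tilde :: 'p Rp) $$ m" .
qed

section \<open>Comparison with the xeric solution\<close>

definition pth_power_monomial :: "nat \<Rightarrow> int \<Rightarrow> exponent \<Rightarrow> bool" where
  "pth_power_monomial p n \<alpha> \<longleftrightarrow> int p dvd n \<and> (\<forall>i. p dvd Poly_Mapping.lookup \<alpha> i)"

text \<open>
  The terms whose monomial is a \<open>p\<close>-th power; all of them are constants of the derivation.
\<close>
definition const_part :: "'p::prime_card zser \<Rightarrow> 'p zser" where
  "const_part = restrict_ser (pth_power_monomial CARD('p))"

lemma of_nat_card_zfrac: "of_nat CARD('p) = (0 :: 'p::prime_card zfrac)"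
proof -
  have "to_fract (of_nat n) = (of_nat n :: 'p zfrac)" for n
    by (induction n) simp_all
  then show ?thesis
    by (metis CHAR_zpoly of_nat_CHAR to_fract_0)
qed

lemma of_nat_zfrac_eq_0: "CARD('p) dvd n \<Longrightarrow> of_nat n = (0 :: 'p::prime_card zfrac)"
  by (auto elim!: dvdE simp: of_nat_card_zfrac)

lemma of_int_zfrac_eq_0: "int CARD('p) dvd n \<Longrightarrow> of_int n = (0 :: 'p::prime_card zfrac)"
proof (elim dvdE)
  fix k assume "n = int CARD('p) * k"
  then show "of_int n = (0 :: 'p zfrac)"
    by (simp only: of_int_mult of_int_of_nat_eq of_nat_card_zfrac mult_zero_left)
qed

lemma const_part_idem: "const_part (const_part F) = const_part F"
  by (rule zser_eqI) (simp add: const_part_def)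

lemma Rp_deriv_const_part: "Rp_deriv (to_Rp (const_part F)) = (0 :: 'p::prime_card Rp)"
proof (rule fls_eqI)
  fix m
  let ?P = "const_part F $$ (m + 1)"
  have key: "pth_power_monomial CARD('p) (m + 1) \<alpha>" if "\<alpha> \<in> Poly_Mapping.keys ?P" for \<alpha>
    using that by (auto simp: in_keys_iff const_part_def split: if_splits)
  have "xD_log \<alpha> = (0 :: 'p zfrac)" if "\<alpha> \<in> Poly_Mapping.keys ?P" for \<alpha>
    unfolding xD_log_def using key[OF that]
    by (intro sum.neutral ballI) (simp add: of_nat_zfrac_eq_0 pth_power_monomial_def)
  then have "xD_poly ?P = 0"
    by (simp add: xD_poly_def)
  moreover have "of_int (m + 1) * to_fract ?P = 0"
  proof (cases "?P = 0")
    case False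
    then obtain \<alpha> where "\<alpha> \<in> Poly_Mapping.keys ?P"
      by fastforce
    then have "int CARD('p) dvd m + 1"
      using key by (simp add: pth_power_monomial_def)
    then show ?thesis
      by (simp only: of_int_zfrac_eq_0 mult_zero_left)
  qed (simp only: to_fract_0 mult_zero_right)
  ultimately show "Rp_deriv (to_Rp (const_part F)) $$ m = (0 :: 'p Rp) $$ m"
    unfolding Rp_deriv_nth to_Rp_nth xD_frac_to_fract by (simp only: add_0_right fls_zero_nth)
qed

text \<open>
  A monomial that is multiplied by a \<open>p\<close>-th power is itself a \<open>p\<close>-th power if and only if the product
  is, so \<open>const_part\<close> is linear over its image.
\<close>
lemma const_part_mult:
  fixes F G :: "'p::prime_card zser"
  shows "const_part (F * const_part G) = const_part F * const_part G"
proof -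
  let ?c = "\<lambda>n \<alpha>. of_bool (pth_power_monomial CARD('p) n \<alpha>) :: 'p mod_ring"
  have "weight ?c (F * const_part G) =
      weight ?c F * weight ?c (const_part G) + weight (\<lambda>_ _. 0) F * weight (\<lambda>_ _. 0) (const_part G)"
  proof (rule weight_mult)
    fix n \<alpha> m \<beta>
    assume "\<beta> \<in> Poly_Mapping.keys (const_part G $$ m)"
    then have \<beta>: "pth_power_monomial CARD('p) m \<beta>"
      by (auto simp: in_keys_iff const_part_def split: if_splits)
    then have "pth_power_monomial CARD('p) (n + m) (\<alpha> + \<beta>) \<longleftrightarrow> pth_power_monomial CARD('p) n \<alpha>"
      by (simp add: pth_power_monomial_def lookup_add dvd_add_left_iff)
    then show "?c (n + m) (\<alpha> + \<beta>) = ?c n \<alpha> * ?c m \<beta> + 0 * 0"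
      using \<beta> by simp
  qed
  then show ?thesis
    using const_part_idem[of G] by (simp add: const_part_def restrict_ser_def)
qed


text \<open>
  Multiplying the equation by \<open>z\<^sub>0 * \<dots> * z\<^sub>M\<^sub>-\<^sub>1\<close> turns a monomial \<open>z ^ \<alpha>\<close> into the sum of the monomials with
  exponent \<open>\<alpha> + E k\<close> and coefficient \<open>a k \<alpha>\<close>, where \<open>E k = e\<^sub>k + \<dots> + e\<^sub>M\<^sub>-\<^sub>1\<close>, \<open>a 0 \<alpha> = n\<close> and
  \<open>a (i + 1) \<alpha> = \<alpha>\<^sub>i\<close>.  Let \<open>\<tau>\<close> be the largest exponent in the lexicographic order.  By induction
  on \<open>k\<close>, only \<open>\<tau>\<close> itself contributes to the monomial with exponent \<open>\<tau> + E k\<close>: another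
  contribution \<open>\<beta> + E l\<close> with \<open>l > k\<close> would have \<open>\<beta> > \<tau>\<close>, and one with \<open>l < k\<close> has
  \<open>a l \<beta> = a l \<tau>\<close>, which vanishes modulo \<open>p\<close> by the induction hypothesis.  Hence \<open>p\<close> divides all
  \<open>a k \<tau>\<close>.
\<close>
lemma top_monomial_of_kernel:
  fixes P :: "'p::prime_card zpoly"
  assumes P: "P \<noteq> 0" and ker: "of_nat n * to_fract P + xD_poly P = 0"
  shows "CARD('p) dvd n \<and> (\<exists>\<alpha>. Poly_Mapping.lookup P \<alpha> \<noteq> 0 \<and> (\<forall>i. CARD('p) dvd Poly_Mapping.lookup \<alpha> i))"
proof -
  let ?K = "Poly_Mapping.keys P"
  obtain M where "(\<Union>\<alpha>\<in>?K. Poly_Mapping.keys \<alpha>) \<subseteq> {..<M}"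
    using finite_nat_bounded[of "\<Union>\<alpha>\<in>?K. Poly_Mapping.keys \<alpha>"] by auto
  then have M: "i < M" if "\<alpha> \<in> ?K" "i \<in> Poly_Mapping.keys \<alpha>" for \<alpha> i
    using that by blast
  define E :: "nat \<Rightarrow> exponent" where "E k = (\<Sum>j\<in>{k..<M}. Poly_Mapping.single j 1)" for k
  define a where "a k \<alpha> = (case k of 0 \<Rightarrow> n | Suc i \<Rightarrow> Poly_Mapping.lookup \<alpha> i)" for k and \<alpha> :: exponent
  have E: "Poly_Mapping.lookup (E k) j = (if k \<le> j \<and> j < M then 1 else 0)" for k j
    by (simp add: E_def lookup_sum lookup_single when_def)
  have split: "Poly_Mapping.single (\<alpha> + \<beta>) 1 = (Poly_Mapping.single \<alpha> 1 * Poly_Mapping.single \<beta> 1 :: 'p zpoly)"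
    for \<alpha> \<beta> :: exponent
    by (simp add: mult_single)
  have zE: "to_fract (Poly_Mapping.single (E k) 1) = (\<Prod>j\<in>{k..<M}. Zfrac j :: 'p zfrac)" for k
  proof -
    have "Poly_Mapping.single (\<Sum>j\<in>J. Poly_Mapping.single j 1) 1 = (\<Prod>j\<in>J. Z j :: 'p zpoly)" for J :: "nat set"
      by (induction J rule: infinite_finite_induct) (simp_all add: Z_def split)
    then show ?thesis
      by (simp only: E_def to_fract_prod Zfrac_def)
  qed
  \<comment> \<open>The cleared equation, as a polynomial in the variables.\<close>
  define T where "T = (\<Sum>\<alpha>\<in>?K. \<Sum>k<Suc M. Poly_Mapping.single (\<alpha> + E k) (of_nat (a k \<alpha>) * Poly_Mapping.lookup P \<alpha>))"
  have "to_fract T = (of_nat n * to_fract P + xD_poly P) * to_fract (Poly_Mapping.single (E 0) 1)"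
  proof -
    have of_nat: "to_fract (of_nat m) = (of_nat m :: 'p zfrac)" for m
      by (induction m) simp_all
    have scale: "to_fract (Poly_Mapping.single (\<alpha> + \<beta>) (of_nat m * c)) =
        of_nat m * (to_fract (Poly_Mapping.single \<alpha> c) * to_fract (Poly_Mapping.single \<beta> 1))"
      for \<alpha> \<beta> :: exponent and m and c :: "'p mod_ring"
    proof -
      have "Poly_Mapping.single (\<alpha> + \<beta>) (of_nat m * c) =
          of_nat m * (Poly_Mapping.single \<alpha> c * Poly_Mapping.single \<beta> 1)"
        by (simp only: of_nat_single o_apply mult_single add_0_left mult_1_right)
      then show ?thesis
        by (simp only: to_fract_mult of_nat)
    qed
    have "to_fract (\<Sum>k<Suc M. Poly_Mapping.single (\<alpha> + E k) (of_nat (a k \<alpha>) * Poly_Mapping.lookup P \<alpha>)) =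
        (of_nat n * to_fract (Poly_Mapping.single \<alpha> (Poly_Mapping.lookup P \<alpha>)) +
          to_fract (Poly_Mapping.single \<alpha> (Poly_Mapping.lookup P \<alpha>)) * xD_log \<alpha>) * to_fract (Poly_Mapping.single (E 0) 1)"
      if "\<alpha> \<in> ?K" for \<alpha>
    proof -
      let ?t = "to_fract (Poly_Mapping.single \<alpha> (Poly_Mapping.lookup P \<alpha>))"
      let ?w = "to_fract (Poly_Mapping.single (E 0) 1) :: 'p zfrac"
      have "xD_log \<alpha> = (\<Sum>i<M. of_nat (Poly_Mapping.lookup \<alpha> i) * (xD_Z i / Zfrac i :: 'p zfrac))"
        unfolding xD_log_def using M[OF that] by (intro sum.mono_neutral_left) (auto simp: in_keys_iff)
      then have "xD_log \<alpha> * ?w = (\<Sum>i<M. of_nat (Poly_Mapping.lookup \<alpha> i) * (xD_Z i / Zfrac i * ?w))"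
        by (simp add: sum_distrib_right mult.assoc)
      also have "\<dots> = (\<Sum>i<M. of_nat (Poly_Mapping.lookup \<alpha> i) * to_fract (Poly_Mapping.single (E (Suc i)) 1))"
      proof (rule sum.cong)
        fix i assume "i \<in> {..<M}"
        then have "?w = (\<Prod>j\<in>{0..<Suc i}. Zfrac j) * (\<Prod>j\<in>{Suc i..<M}. Zfrac j)"
          unfolding zE by (intro prod.atLeastLessThan_concat[symmetric]) auto
        also have "(\<Prod>j\<in>{0..<Suc i}. Zfrac j) = (\<Prod>j<i. Zfrac j) * (Zfrac i :: 'p zfrac)"
          by (simp add: atLeast0LessThan)
        finally have "xD_Z i / Zfrac i * ?w = (\<Prod>j\<in>{Suc i..<M}. Zfrac j)"
          by (simp add: xD_Z_def Zfrac_def)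
        then show "of_nat (Poly_Mapping.lookup \<alpha> i) * (xD_Z i / Zfrac i * ?w) =
            of_nat (Poly_Mapping.lookup \<alpha> i) * to_fract (Poly_Mapping.single (E (Suc i)) 1)"
          by (simp only: zE)
      qed simp
      finally have log: "xD_log \<alpha> * ?w =
          (\<Sum>i<M. of_nat (Poly_Mapping.lookup \<alpha> i) * to_fract (Poly_Mapping.single (E (Suc i)) 1))" .
      have "to_fract (\<Sum>k<Suc M. Poly_Mapping.single (\<alpha> + E k) (of_nat (a k \<alpha>) * Poly_Mapping.lookup P \<alpha>)) =
          of_nat n * (?t * ?w) + (\<Sum>i<M. of_nat (Poly_Mapping.lookup \<alpha> i) * (?t * to_fract (Poly_Mapping.single (E (Suc i)) 1)))"
        by (simp only: to_fract_sum to_fract_add scale sum.lessThan_Suc_shift a_def nat.case)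
      also have "(\<Sum>i<M. of_nat (Poly_Mapping.lookup \<alpha> i) * (?t * to_fract (Poly_Mapping.single (E (Suc i)) 1))) =
          ?t * (xD_log \<alpha> * ?w)"
        by (simp only: log sum_distrib_left mult.left_commute)
      finally show ?thesis
        by (simp only: distrib_right mult.assoc)
    qed
    then have "to_fract T = (\<Sum>\<alpha>\<in>?K. of_nat n * to_fract (Poly_Mapping.single \<alpha> (Poly_Mapping.lookup P \<alpha>)) +
          to_fract (Poly_Mapping.single \<alpha> (Poly_Mapping.lookup P \<alpha>)) * xD_log \<alpha>) * to_fract (Poly_Mapping.single (E 0) 1)"
      unfolding T_def to_fract_sum[of _ ?K] sum_distrib_right by (intro sum.cong refl) auto
    also have "(\<Sum>\<alpha>\<in>?K. of_nat n * to_fract (Poly_Mapping.single \<alpha> (Poly_Mapping.lookup P \<alpha>)) +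
          to_fract (Poly_Mapping.single \<alpha> (Poly_Mapping.lookup P \<alpha>)) * xD_log \<alpha>) =
        of_nat n * to_fract (\<Sum>\<alpha>\<in>?K. Poly_Mapping.single \<alpha> (Poly_Mapping.lookup P \<alpha>)) + xD_poly P"
      by (simp only: sum.distrib xD_poly_def to_fract_sum sum_distrib_left)
    finally show ?thesis
      by (simp only: poly_mapping_sum_singles)
  qed
  then have T0: "T = 0"
    by (simp add: ker)
  define \<tau> where "\<tau> = Max ?K"
  have \<tau>: "\<tau> \<in> ?K" "\<And>\<beta>. \<beta> \<in> ?K \<Longrightarrow> \<beta> \<le> \<tau>"
    unfolding \<tau>_def using P by (auto intro: Max_in)
  have dvd: "CARD('p) dvd a k \<tau>" if "k \<le> M" for k
    using that
  proof (induction k rule: less_induct)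
    case (less k)
    have summand: "(of_nat (a l \<beta>) * Poly_Mapping.lookup P \<beta> when \<beta> + E l = \<tau> + E k) =
        (if \<beta> = \<tau> \<and> l = k then of_nat (a k \<tau>) * Poly_Mapping.lookup P \<tau> else 0)"
      if \<beta>: "\<beta> \<in> ?K" and l: "l < Suc M" for \<beta> l
    proof (cases "\<beta> + E l = \<tau> + E k")
      case eq: True
      then have eq': "Poly_Mapping.lookup \<beta> j + Poly_Mapping.lookup (E l) j =
          Poly_Mapping.lookup \<tau> j + Poly_Mapping.lookup (E k) j" for j
        by (metis lookup_add)
      \<comment> \<open>If two exponents meet, they differ by a sum of consecutive unit vectors.\<close>
      consider "l = k" | "k < l" | "l < k"
        by linarith
      then show ?thesis
      proof cases
        case 1
        then show ?thesis
          using eq by simp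
      next
        case 2
        have "Poly_Mapping.lookup \<tau> k < Poly_Mapping.lookup \<beta> k"
          using eq'[of k] 2 l by (simp add: E)
        moreover have "Poly_Mapping.lookup \<tau> j = Poly_Mapping.lookup \<beta> j" if "j < k" for j
          using eq'[of j] 2 that by (simp add: E)
        ultimately have "\<tau> < \<beta>"
          unfolding less_poly_mapping.rep_eq less_fun_def by blast
        then show ?thesis
          using \<tau>(2)[OF \<beta>] by simp
      next
        case 3
        have "a l \<beta> = a l \<tau>"
        proof (cases l)
          case (Suc i)
          then show ?thesis
            using eq'[of i] 3 by (simp add: E a_def)
        qed (simp add: a_def)
        moreover have "CARD('p) dvd a l \<tau>"
          using less.IH[OF 3] 3 less.prems by simp
        ultimately have "of_nat (a l \<beta>) = (0 :: 'p mod_ring)"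
          by (auto elim!: dvdE simp: of_nat_card_mod_ring)
        then show ?thesis
          using 3 by simp
      qed
    qed auto
    have "0 = Poly_Mapping.lookup T (\<tau> + E k)"
      by (simp add: T0)
    also have "\<dots> = (\<Sum>\<beta>\<in>?K. \<Sum>l<Suc M. of_nat (a l \<beta>) * Poly_Mapping.lookup P \<beta> when \<beta> + E l = \<tau> + E k)"
      by (simp only: T_def lookup_sum lookup_single)
    also have "\<dots> = (\<Sum>\<beta>\<in>?K. \<Sum>l<Suc M. if \<beta> = \<tau> \<and> l = k then of_nat (a k \<tau>) * Poly_Mapping.lookup P \<tau> else 0)"
      by (intro sum.cong refl summand) auto
    also have "\<dots> = (\<Sum>\<beta>\<in>?K. if \<beta> = \<tau> then of_nat (a k \<tau>) * Poly_Mapping.lookup P \<tau> else 0)"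
      using less.prems by (intro sum.cong refl) (auto simp: sum.delta)
    also have "\<dots> = of_nat (a k \<tau>) * Poly_Mapping.lookup P \<tau>"
      using \<tau>(1) by (simp add: sum.delta)
    finally have "of_nat (a k \<tau>) = (0 :: 'p mod_ring)"
      using \<tau>(1) by (simp add: in_keys_iff)
    then show ?case
      by (rule of_nat_0_mod_ring_dvd)
  qed
  have "CARD('p) dvd Poly_Mapping.lookup \<tau> i" for i
  proof (cases "i < M")
    case True
    then show ?thesis
      using dvd[of "Suc i"] by (simp add: a_def)
  next
    case False
    then have "Poly_Mapping.lookup \<tau> i = 0"
      using M[OF \<tau>(1), of i] by (auto simp: in_keys_iff)
    then show ?thesis
      by simp
  qed
  moreover have "CARD('p) dvd n"
    using dvd[of 0] by (simp add: a_def)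
  ultimately show ?thesis
    using \<tau>(1) by (auto simp: in_keys_iff)
qed

text \<open>
  The difference \<open>d\<close> of two xeric solutions has no monomial that is a \<open>p\<close>-th power.  If its coefficients
  below \<open>x ^ n\<close> vanish, comparing coefficients of \<open>x ^ (n - 1)\<close> in \<open>d' = d\<close> shows that the
  coefficient of \<open>x ^ n\<close> is in the kernel of the preceding lemma, hence zero.
\<close>
lemma xeric_exp_unique:
  assumes y: "xeric_exp y" and y': "xeric_exp (y' :: 'p::prime_card zpoly fps)"
  shows "y = y'"
proof -
  define d where "d = y - y'"
  have ode: "Rp_deriv (emb d) = emb d"
    using y y' unfolding d_def emb_diff Rp_deriv_diff xeric_exp_def by simp
  have pth: "Poly_Mapping.lookup (fps_nth d k) \<alpha> = 0"
    if "CARD('p) dvd k" "\<And>i. CARD('p) dvd Poly_Mapping.lookup \<alpha> i" for k \<alpha>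
    using y y' that by (simp add: xeric_exp_def d_def lookup_minus)
  have "fps_nth d n = 0" for n
  proof (induction n rule: less_induct)
    case (less n)
    have "emb d $$ (int n - 1) = (0 :: 'p zfrac)"
      using less[of "n - 1"] by (simp add: emb_nth nat_diff_distrib')
    then have "Rp_deriv (emb d) $$ (int n - 1) = 0"
      by (simp only: ode)
    then have "of_nat n * to_fract (fps_nth d n) + xD_poly (fps_nth d n) = 0"
      by (simp add: Rp_deriv_nth emb_nth xD_frac_to_fract)
    then show ?case
      using top_monomial_of_kernel[of "fps_nth d n" n] pth by blast
  qed
  then have "d = 0"
    by (intro fps_ext) simp
  then show ?thesis
    by (simp add: d_def)
qed

lemma exp_tilde_nth_0: "fps_nth exp_tilde 0 = (1 :: 'p::prime_card zpoly)"
proof -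
  have "fps_nth (exp_factor 0 - 1) 0 = (0 :: 'p zpoly)"
    by (rule fps_nth_eq_0_if_dvd[OF exp_factor_dvd]) simp
  then show ?thesis
    using exp_tilde_nth[of 0 0, where 'p = 'p] by (simp add: exp_partial_def)
qed

text \<open>
  The quotient of the infinite product by its constant part is a xeric solution: dividing by a
  constant preserves the differential equation, and the constant part of the quotient is 1 because
  \<open>const_part\<close> is linear over constants.
\<close>
theorem exp_p_times_const_part:
  "const_part (fps_to_fls exp_tilde) $$ 0 = (1 :: 'p::prime_card zpoly)"
  "fps_to_fls exp_p * const_part (fps_to_fls exp_tilde) = (fps_to_fls exp_tilde :: 'p zser)"
proof -
  define C where "C = const_part (fps_to_fls exp_tilde :: 'p zser)"
  define c where "c = fls_regpart C"
  have C: "fps_to_fls c = C"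
  proof (rule fls_eqI)
    fix n
    have "C $$ n = 0" if "n < 0"
      by (rule poly_mapping_eqI) (use that in \<open>simp add: C_def const_part_def\<close>)
    then show "fps_to_fls c $$ n = C $$ n"
      by (simp add: c_def)
  qed
  have C0: "C $$ 0 = 1"
    by (rule poly_mapping_eqI)
      (auto simp: C_def const_part_def exp_tilde_nth_0 lookup_one when_def pth_power_monomial_def)
  then show "const_part (fps_to_fls exp_tilde) $$ 0 = (1 :: 'p zpoly)"
    by (simp add: C_def)
  \<comment> \<open>The constant coefficient 1 makes \<open>c\<close> invertible although the coefficients do not form a field.\<close>
  then have "c * fps_right_inverse c 1 = 1"
    by (intro fps_right_inverse) (simp add: c_def flip: C_def)
  define y where "y = exp_tilde * fps_right_inverse c 1"
  have "y * c = exp_tilde * (c * fps_right_inverse c 1)"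
    by (simp only: y_def mult.assoc mult.commute[of "fps_right_inverse c 1" c])
  then have yc: "y * c = exp_tilde"
    using \<open>c * fps_right_inverse c 1 = 1\<close> by simp
  have yC: "fps_to_fls y * C = fps_to_fls exp_tilde"
    unfolding C[symmetric] fps_to_fls_mult[symmetric] yc ..
  have "C \<noteq> 0"
    using C0 by auto
  have "xeric_exp y"
    unfolding xeric_exp_def
  proof (intro conjI allI impI)
    have "Rp_deriv (emb y * to_Rp C) = emb y * to_Rp C"
      using exp_tilde_ode[where 'p = 'p] by (simp only: yC flip: to_Rp_mult)
    then have "Rp_deriv (emb y) * to_Rp C = emb y * to_Rp C"
      by (simp only: Rp_deriv_mult C_def Rp_deriv_const_part mult_zero_right add_0_right)
    then show "Rp_deriv (emb y) = emb y"
      using \<open>C \<noteq> 0\<close> by simp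
  next
    fix k and \<alpha> :: exponent
    assume "CARD('p) dvd k \<and> (\<forall>i. CARD('p) dvd Poly_Mapping.lookup \<alpha> i)"
    then have pth: "pth_power_monomial CARD('p) (int k) \<alpha>"
      by (simp add: pth_power_monomial_def)
    have "const_part (fps_to_fls y) * C = 1 * C"
      using const_part_mult[of "fps_to_fls y" "fps_to_fls exp_tilde"] by (simp add: yC flip: C_def)
    then have "const_part (fps_to_fls y) = 1"
      using \<open>C \<noteq> 0\<close> by (simp only: mult_cancel_right) simp
    then have "Poly_Mapping.lookup (const_part (fps_to_fls y) $$ int k) \<alpha> = Poly_Mapping.lookup ((1 :: 'p zser) $$ int k) \<alpha>"
      by simp
    then show "Poly_Mapping.lookup (fps_nth y k) \<alpha> = (if k = 0 \<and> \<alpha> = 0 then 1 else 0)"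
      using pth by (auto simp: const_part_def lookup_one split: if_splits)
  qed
  then have "exp_p = y"
    unfolding exp_p_def using xeric_exp_unique by blast
  then show "fps_to_fls exp_p * const_part (fps_to_fls exp_tilde) = (fps_to_fls exp_tilde :: 'p zser)"
    using yC by (simp add: C_def)
qed

section \<open>Projections of the Artin-Schreier series\<close>

abbreviation gs :: "nat \<Rightarrow> 'p::prime_card zser" where
  "gs i \<equiv> fps_to_fls (gser i)"

lemma proj_add: "proj k (F + G) = proj k F + proj k G"
  by (simp add: proj_eq_restrict_ser restrict_ser_add)

lemma proj_diff: "proj k (F - G) = proj k F - proj k G"
  by (simp add: proj_eq_restrict_ser restrict_ser_diff)

lemma proj_mult: "proj k (F * G) = proj k F * proj k G"
  by (simp add: proj_eq_restrict_ser restrict_ser_mult is_face_keys)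

lemma proj_power: "proj k (F ^ n) = proj k F ^ n"
  by (simp add: proj_eq_restrict_ser restrict_ser_power is_face_keys)

lemma proj_0: "proj k 0 = 0"
  by (simp add: proj_eq_restrict_ser)

lemma proj_1: "proj k 1 = 1"
  by (simp add: proj_eq_restrict_ser restrict_ser_1 is_face_keys)

lemma proj_X: "proj k fls_X = fls_X"
  by (simp add: proj_eq_restrict_ser restrict_ser_X)

lemma proj_Z: "proj k (Zl i) = (if i < k then Zl i else 0)"
  by (simp add: proj_eq_restrict_ser restrict_ser_Z)

lemma proj_gs_0: "proj k (gs 0) - proj k (gs 0) ^ CARD('p) = (fls_X :: 'p::prime_card zser)"
proof -
  have "fps_to_fls (gser 0 - gser 0 ^ CARD('p)) = (fls_X :: 'p zser)"
    unfolding gser_0_equation by (rule fps_X_to_fls)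
  then have "proj k (gs 0 - gs 0 ^ CARD('p)) = (fls_X :: 'p zser)"
    by (simp only: fps_to_fls_minus fps_to_fls_power proj_X)
  then show ?thesis
    by (simp only: proj_diff proj_power)
qed

lemma proj_gs_Suc:
  "proj k (gs (Suc i)) - proj k (gs (Suc i)) ^ CARD('p) =
    proj k (gs i) ^ CARD('p) * (if i < k then Zl i else 0 :: 'p::prime_card zser)"
proof -
  have "fps_to_fls (gser (Suc i) - gser (Suc i) ^ CARD('p)) = (gs i ^ CARD('p) * Zl i :: 'p zser)"
    unfolding gser_Suc_equation by (simp only: fps_to_fls_mult fps_to_fls_power fps_const_to_fls)
  then have "proj k (gs (Suc i) - gs (Suc i) ^ CARD('p)) = proj k (gs i ^ CARD('p) * Zl i :: 'p zser)"
    by (simp only: fps_to_fls_minus fps_to_fls_power)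
  then show ?thesis
    by (simp only: proj_diff proj_power proj_mult proj_Z)
qed

lemma fls_eq_0_if_eq_power:
  fixes F :: "'a::idom fls"
  assumes F: "F = F ^ n" "n > 1" and pos: "\<And>m. m \<le> 0 \<Longrightarrow> F $$ m = 0"
  shows "F = 0"
proof (rule ccontr)
  assume "F \<noteq> 0"
  have "fls_subdegree F = int n * fls_subdegree F"
    using arg_cong[OF F(1), of fls_subdegree] unfolding fls_subdegree_pow .
  then have "fls_subdegree F = 0"
    using \<open>n > 1\<close> by simp
  then show False
    using pos[of "fls_subdegree F"] \<open>F \<noteq> 0\<close> nth_fls_subdegree_nonzero[of F] by simp
qed

text \<open>
  The projection kills the right side of the Artin-Schreier equation, so the projected series equals
  its own \<open>p\<close>-th power, which is impossible for a nonzero series of positive order.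
\<close>
lemma proj_gs_eq_0:
  assumes "k \<le> i"
  shows "proj k (gs (Suc i)) = (0 :: 'p::prime_card zser)"
proof (rule fls_eq_0_if_eq_power)
  show "proj k (gs (Suc i)) = (proj k (gs (Suc i)) :: 'p zser) ^ CARD('p)"
    using proj_gs_Suc[of k i, where 'p = 'p] assms by (simp del: gser.simps)
  show "CARD('p) > 1"
    by (rule card_gt_1)
  fix m :: int
  assume m: "m \<le> 0"
  have "gs (Suc i) $$ m = (0 :: 'p zpoly)"
    using m fps_nth_eq_0_if_dvd[OF gser_dvd[of "Suc i", where 'p = 'p], of 0] by (auto simp del: gser.simps)
  then show "proj k (gs (Suc i)) $$ m = (0 :: 'p zpoly)"
    by (intro poly_mapping_eqI) (simp add: proj_eq_restrict_ser del: gser.simps)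
qed


text \<open>
  All projected Artin-Schreier series are included; those with index greater than \<open>k\<close> are zero.
\<close>
section \<open>A ring of algebraic series closed under Euler derivations\<close>

definition gring :: "nat \<Rightarrow> 'p::prime_card zser set" where
  "gring k = ring_adjoin (insert fls_X (Zl ` {..<k} \<union> range (\<lambda>i. proj k (gs i))))"

lemma gring_gen:
  "fls_X \<in> gring k" "i < k \<Longrightarrow> Zl i \<in> gring k" "proj k (gs i) \<in> gring k" "1 \<in> gring k" "0 \<in> gring k"
  by (auto simp: gring_def intro: ring_adjoin.base ring_adjoin.one ring_adjoin_0)

lemma gring_closed:
  "a \<in> gring k \<Longrightarrow> b \<in> gring k \<Longrightarrow> a + b \<in> gring k"
  "a \<in> gring k \<Longrightarrow> b \<in> gring k \<Longrightarrow> a - b \<in> gring k"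
  "a \<in> gring k \<Longrightarrow> b \<in> gring k \<Longrightarrow> a * b \<in> gring k"
  "a \<in> gring k \<Longrightarrow> a ^ n \<in> gring k"
  "a \<in> gring k \<Longrightarrow> - a \<in> gring k"
  unfolding gring_def
  by (rule ring_adjoin_add ring_adjoin.diff ring_adjoin.mult ring_adjoin_power ring_adjoin_uminus; assumption)+

lemma gring_const: "fls_const (Poly_Mapping.single 0 c) \<in> (gring k :: 'p::prime_card zser set)"
proof -
  obtain n where c: "c = of_nat n"
    using surj_of_nat_mod_ring by blast
  have "fls_const (Poly_Mapping.single 0 (of_nat n)) = (of_nat n :: 'p zser)"
    by (simp only: fls_of_nat of_nat_single o_apply)
  then show ?thesis
    unfolding c gring_def by (simp only: ring_adjoin_of_nat)
qed

lemma algebraic_proj_gs: "algebraic_over (Fp_xz {..<k}) (to_Rp (proj k (gs i)) :: 'p::prime_card Rp)"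
proof (induction i)
  case 0
  have "algebraic_over (Fp_xz {..<k}) (fls_X :: 'p Rp)"
    unfolding Fp_xz_def by (intro algebraic_over_base field_adjoin.base) auto
  moreover have "to_Rp (proj k (gs 0)) - to_Rp (proj k (gs 0)) ^ CARD('p) = (fls_X :: 'p Rp)"
    unfolding to_Rp_power[symmetric] to_Rp_diff[symmetric] proj_gs_0 by (rule to_Rp_X)
  ultimately show ?case
    using card_gt_1[where 'p = 'p] unfolding Fp_xz_def by (metis algebraic_over_Artin_Schreier)
next
  case (Suc i)
  let ?S = "insert fls_X (Zser ` {..<k}) :: 'p Rp set"
  have pow: "algebraic_over (field_adjoin ?S) (a ^ n)" if "algebraic_over (field_adjoin ?S) a" for a n
    by (induction n) (auto intro: algebraic_over_mult that algebraic_over_base field_adjoin.one)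
  have "algebraic_over (field_adjoin ?S) (if i < k then Zser i else 0 :: 'p Rp)"
    by (auto intro!: algebraic_over_base field_adjoin_0 field_adjoin.base)
  moreover have "to_Rp (proj k (gs (Suc i))) - to_Rp (proj k (gs (Suc i))) ^ CARD('p) =
      to_Rp (proj k (gs i)) ^ CARD('p) * (if i < k then Zser i else 0 :: 'p Rp)"
    unfolding to_Rp_power[symmetric] to_Rp_diff[symmetric] proj_gs_Suc to_Rp_mult
    by (simp only: if_distrib[of to_Rp] to_Rp_Z to_Rp_0)
  ultimately show ?case
    using Suc.IH card_gt_1[where 'p = 'p] unfolding Fp_xz_def
    by (metis (no_types, lifting) algebraic_over_Artin_Schreier algebraic_over_mult pow)
qed

lemma algebraic_gring:
  assumes "a \<in> gring k"
  shows "algebraic_over (Fp_xz {..<k}) (to_Rp a)"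
  using assms unfolding gring_def
proof induction
  case (base a)
  then consider "a = fls_X" | i where "i < k" "a = Zl i" | i where "a = proj k (gs i)"
    by auto
  then show ?case
  proof cases
    case 3
    then show ?thesis
      using algebraic_proj_gs by simp
  qed (auto simp: Fp_xz_def intro!: algebraic_over_base field_adjoin.base)
next
  case one
  then show ?case
    unfolding Fp_xz_def by (simp add: algebraic_over_base field_adjoin.one)
qed (auto simp: Fp_xz_def to_Rp_diff to_Rp_mult intro: algebraic_over_diff algebraic_over_mult)


lemma proj_poly_at_gring:
  assumes "proj k (fps_to_fls f) \<in> gring k"
  shows "proj k (fps_to_fls (poly_at p f)) \<in> gring k"
proof (induction p)
  case (pCons a p)
  have "proj k (fps_to_fls (poly_at (pCons a p) f)) =
      fls_const (Poly_Mapping.single 0 a) + proj k (fps_to_fls f) * proj k (fps_to_fls (poly_at p f))"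
    by (simp add: poly_at_pCons fps_to_fls_mult proj_add proj_mult const_ser_def)
      (simp add: proj_eq_restrict_ser restrict_ser_monomial)
  then show ?case
    using pCons.IH assms by (simp only: gring_closed(1,3) gring_const)
qed (simp add: poly_at_0 proj_0 gring_gen)

lemma fps_to_fls_sign: "fps_to_fls ((- 1) ^ i * f) = (- 1) ^ i * fps_to_fls f"
  by (simp only: fps_to_fls_mult fps_to_fls_power fps_to_fls_uminus fps_one_to_fls)

lemma proj_sign: "proj k ((- 1) ^ i) = ((- 1) ^ i :: 'p::prime_card zser)"
proof -
  have "proj k (- 1) = (- 1 :: 'p zser)"
    using proj_diff[of k 0 "1 :: 'p zser"] by (simp add: proj_0 proj_1)
  then show ?thesis
    by (simp add: proj_power)
qed

lemma proj_exp_factor_gring: "proj k (fps_to_fls (exp_factor i)) \<in> gring k"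
  unfolding exp_factor_def H_at_eq_poly_at
  by (intro proj_poly_at_gring)
    (simp only: fps_to_fls_sign proj_mult proj_sign gring_closed gring_gen)

text \<open>
  The argument of \<open>H\<close> is projected to zero, and the constant term of \<open>H\<close> is 1.
\<close>
lemma proj_exp_factor_eq_1:
  assumes "k \<le> i"
  shows "proj k (fps_to_fls (exp_factor (Suc i))) = (1 :: 'p::prime_card zser)"
proof -
  define f where "f = ((- 1) ^ Suc i * gser (Suc i) :: 'p zpoly fps)"
  have "proj k (fps_to_fls f) = 0"
    unfolding f_def fps_to_fls_sign proj_mult proj_gs_eq_0[OF assms] by (rule mult_zero_right)
  then have "proj k (fps_to_fls (poly_at p f)) = fls_const (Poly_Mapping.single 0 (poly p 0))" for p
    by (cases p) (simp add: poly_at_pCons fps_to_fls_mult proj_add proj_mult const_ser_def,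
        simp add: proj_eq_restrict_ser restrict_ser_monomial)
  moreover have "poly H_poly 0 = (1 :: 'p mod_ring)"
    by (simp add: H_poly_def poly_prod)
  ultimately show ?thesis
    unfolding exp_factor_def H_at_eq_poly_at f_def[symmetric] by simp
qed

lemma proj_exp_partial:
  assumes "k \<le> n"
  shows "proj k (fps_to_fls (exp_partial n)) = (proj k (fps_to_fls (exp_partial k)) :: 'p::prime_card zser)"
  using assms
proof (induction rule: dec_induct)
  case (step n)
  then show ?case
    by (simp only: exp_partial_Suc fps_to_fls_mult proj_mult proj_exp_factor_eq_1 mult_1_right)
qed simp

lemma proj_exp_tilde: "proj k (fps_to_fls exp_tilde) = (proj k (fps_to_fls (exp_partial k)) :: 'p::prime_card zser)"
proof (rule fls_eqI)
  fix m
  let ?n = "max k (nat m)"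
  have "fps_to_fls exp_tilde $$ m = (fps_to_fls (exp_partial ?n) :: 'p zser) $$ m"
    using exp_tilde_nth[of "nat m" ?n, where 'p = 'p] by simp
  then have "proj k (fps_to_fls exp_tilde) $$ m = (proj k (fps_to_fls (exp_partial ?n)) :: 'p zser) $$ m"
    by (intro poly_mapping_eqI) (simp add: proj_eq_restrict_ser)
  then show "proj k (fps_to_fls exp_tilde) $$ m = (proj k (fps_to_fls (exp_partial k)) :: 'p zser) $$ m"
    using proj_exp_partial[of k ?n, where 'p = 'p] by simp
qed

lemma proj_exp_tilde_gring: "proj k (fps_to_fls exp_tilde) \<in> gring k"
proof -
  have "proj k (fps_to_fls (exp_partial n)) \<in> gring k" for n
  proof (induction n)
    case 0
    then show ?case
      using proj_exp_factor_gring by (simp add: exp_partial_def)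
  next
    case (Suc n)
    then show ?case
      unfolding exp_partial_Suc fps_to_fls_mult proj_mult
      by (intro gring_closed proj_exp_factor_gring)
  qed
  then show ?thesis
    by (simp add: proj_exp_tilde)
qed


lemma weight_1_derivation:
  assumes u: "additive_weight u"
  shows "weight u (1 :: 'p::prime_card zser) = 0"
  by (rule iffD1[OF add_cancel_left_right,
        OF weight_derivation[OF u, of 1 1, unfolded mult_1_left mult_1_right, symmetric]])

lemma weight_power:
  assumes u: "additive_weight u"
  shows "weight u (F ^ n) = of_nat n * F ^ (n - 1) * weight u F"
proof (induction n)
  case 0
  then show ?case
    by (simp add: weight_1_derivation[OF u])
next
  case (Suc n)
  show ?case
    by (cases n) (use Suc in \<open>simp_all add: weight_derivation[OF u] algebra_simps\<close>)
qed

lemma weight_power_card: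
  assumes u: "additive_weight u"
  shows "weight u (F ^ CARD('p)) = (0 :: 'p::prime_card zser)"
  unfolding weight_power[OF u] by (simp only: of_nat_card_zser mult_zero_left)

text \<open>
  A derivation kills \<open>p\<close>-th powers, so applied to the Artin-Schreier equation of a generator
  it expresses the derivative of the generator by that of \<open>x\<close> or of a variable.
\<close>
lemma weight_gring:
  fixes u :: "int \<Rightarrow> exponent \<Rightarrow> 'p::prime_card mod_ring"
  assumes u: "additive_weight u" and a: "a \<in> gring k"
  shows "weight u a \<in> gring k"
proof -
  have X: "weight u fls_X \<in> gring k"
  proof -
    have "weight u fls_X = fls_const (Poly_Mapping.single 0 (u 1 0)) * fls_X"
      by (rule zser_eqI) (simp add: fls_X_times_conv_shift lookup_one lookup_single when_def)
    then show ?thesis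
      by (simp only: gring_closed gring_const gring_gen)
  qed
  have Z: "weight u (Zl i) \<in> gring k" if "i < k" for i
  proof -
    have "weight u (Zl i) = fls_const (Poly_Mapping.single 0 (u 0 (Poly_Mapping.single i 1))) * Zl i"
      by (rule zser_eqI) (simp add: Z_def mult_single lookup_single when_def)
    then show ?thesis
      using that by (simp only: gring_closed gring_const gring_gen)
  qed
  have g: "weight u (proj k (gs i)) \<in> gring k" for i
  proof (cases i)
    case 0
    have "weight u (proj k (gs 0) - proj k (gs 0) ^ CARD('p)) = weight u fls_X"
      by (simp only: proj_gs_0)
    then have "weight u (proj k (gs 0)) = weight u fls_X"
      by (simp only: weight_diff weight_power_card[OF u] diff_zero)
    then show ?thesis
      using X by (simp only: 0)
  next
    case (Suc j)
    have "weight u (proj k (gs (Suc j)) - proj k (gs (Suc j)) ^ CARD('p)) =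
        weight u (proj k (gs j) ^ CARD('p) * (if j < k then Zl j else 0))"
      by (simp only: proj_gs_Suc)
    then have "weight u (proj k (gs (Suc j))) = proj k (gs j) ^ CARD('p) * weight u (if j < k then Zl j else 0)"
      by (simp only: weight_diff weight_power_card[OF u] weight_derivation[OF u] diff_zero mult_zero_left add_0_left)
    moreover have "weight u (if j < k then Zl j else 0) \<in> gring k"
      by (cases "j < k") (simp_all add: Z gring_gen)
    ultimately show ?thesis
      by (simp only: Suc gring_closed gring_gen)
  qed
  show ?thesis
    using a unfolding gring_def[of k]
  proof induction
    case (base a)
    then show ?case
      using X Z g unfolding gring_def[symmetric] by auto
  next
    case one
    then show ?case
      by (simp add: weight_1_derivation[OF u] ring_adjoin_0)
  next
    case (diff a b)
    then show ?case
      by (simp add: weight_diff ring_adjoin.diff)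
  next
    case (mult a b)
    then show ?case
      by (simp add: weight_derivation[OF u] ring_adjoin_add ring_adjoin.mult)
  qed
qed

text \<open>
  The derivation multiplies a monomial by the scalar \<open>u\<close>, and \<open>1 - u ^ (p - 1)\<close> is the indicator of
  \<open>u = 0\<close> by Fermat.
\<close>
lemma restrict_kernel_gring:
  fixes u :: "int \<Rightarrow> exponent \<Rightarrow> 'p::prime_card mod_ring"
  assumes u: "additive_weight u" and a: "a \<in> (gring k :: 'p zser set)"
  shows "restrict_ser (\<lambda>n \<alpha>. u n \<alpha> = 0) a \<in> gring k"
proof -
  have "(weight u ^^ m) a \<in> gring k" for m
    by (induction m) (simp_all add: a weight_gring[OF u])
  moreover have "restrict_ser (\<lambda>n \<alpha>. u n \<alpha> = 0) a = a - (weight u ^^ (CARD('p) - 1)) a"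
  proof (rule zser_eqI)
    fix n \<alpha>
    have "u n \<alpha> ^ (CARD('p) - 1) = of_bool (u n \<alpha> \<noteq> 0)"
      using fermat_mod_ring[of "u n \<alpha>"] card_gt_1[where 'p = 'p] by (cases "u n \<alpha> = 0") (auto simp: power_0_left)
    then show "Poly_Mapping.lookup (restrict_ser (\<lambda>n \<alpha>. u n \<alpha> = 0) a $$ n) \<alpha> =
        Poly_Mapping.lookup ((a - (weight u ^^ (CARD('p) - 1)) a) $$ n) \<alpha>"
      unfolding weight_funpow by (simp add: lookup_minus)
  qed
  ultimately show ?thesis
    using a by (simp only: gring_closed)
qed

text \<open>
  The conditions on the exponents are imposed one after the other, each by the Euler derivation of
  the corresponding variable.
\<close>
lemma restrict_pth_gring:
  assumes a: "a \<in> (gring k :: 'p::prime_card zser set)"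
  shows "restrict_ser (\<lambda>n \<alpha>. int CARD('p) dvd n \<and> (\<forall>i<j. CARD('p) dvd Poly_Mapping.lookup \<alpha> i)) a \<in> gring k"
proof (induction j)
  case 0
  have "restrict_ser (\<lambda>n \<alpha>. (of_int n :: 'p mod_ring) = 0) a \<in> gring k"
    by (intro restrict_kernel_gring a) (simp add: additive_weight_def)
  moreover have "of_int n = (0 :: 'p mod_ring) \<longleftrightarrow> int CARD('p) dvd n" for n
    using of_int_eq_0_iff_char_dvd[where 'a = "'p mod_ring"] by simp
  ultimately show ?case
    by simp
next
  case (Suc j)
  let ?A = "\<lambda>j n \<alpha>. int CARD('p) dvd n \<and> (\<forall>i<j. CARD('p) dvd Poly_Mapping.lookup \<alpha> i)"
  have "restrict_ser (\<lambda>n \<alpha>. (of_nat (Poly_Mapping.lookup \<alpha> j) :: 'p mod_ring) = 0) (restrict_ser (?A j) a) \<in> gring k"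
    by (intro restrict_kernel_gring Suc.IH) (simp add: additive_weight_def lookup_add)
  moreover have "of_nat m = (0 :: 'p mod_ring) \<longleftrightarrow> CARD('p) dvd m" for m
    using of_nat_eq_0_iff_char_dvd[where 'a = "'p mod_ring"] by simp
  moreover have "restrict_ser (\<lambda>n \<alpha>. CARD('p) dvd Poly_Mapping.lookup \<alpha> j) (restrict_ser (?A j) a) = restrict_ser (?A (Suc j)) a"
    by (rule zser_eqI) (auto simp: less_Suc_eq)
  ultimately show ?case
    by simp
qed

text \<open>
  Extracting \<open>p\<close>-th powers commutes with the projection, after which only finitely many exponents
  have to be tested.
\<close>
lemma proj_const_part_gring: "proj k (const_part (fps_to_fls exp_tilde)) \<in> (gring k :: 'p::prime_card zser set)"
proof -
  let ?A = "\<lambda>n \<alpha>. int CARD('p) dvd n \<and> (\<forall>i<k. CARD('p) dvd Poly_Mapping.lookup \<alpha> i)"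
  have "restrict_ser ?A (proj k (fps_to_fls exp_tilde)) = proj k (const_part (fps_to_fls exp_tilde) :: 'p zser)"
  proof (rule zser_eqI)
    fix n and \<alpha> :: exponent
    have "?A n \<alpha> \<longleftrightarrow> pth_power_monomial CARD('p) n \<alpha>" if "Poly_Mapping.keys \<alpha> \<subseteq> {..<k}"
    proof -
      have "Poly_Mapping.lookup \<alpha> i = 0" if "\<not> i < k" for i
        using that \<open>Poly_Mapping.keys \<alpha> \<subseteq> {..<k}\<close> by (auto simp: in_keys_iff subset_iff)
      then show ?thesis
        unfolding pth_power_monomial_def by (metis dvd_0_right)
    qed
    then show "Poly_Mapping.lookup (restrict_ser ?A (proj k (fps_to_fls exp_tilde)) $$ n) \<alpha> =
        Poly_Mapping.lookup (proj k (const_part (fps_to_fls exp_tilde)) $$ n :: 'p zpoly) \<alpha>"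
      by (auto simp: proj_eq_restrict_ser const_part_def)
  qed
  then show ?thesis
    using restrict_pth_gring[OF proj_exp_tilde_gring, of k k, where 'p = 'p] by simp
qed

section \<open>Algebraicity of the projections\<close>

lemma algebraic_proj_exp_tilde:
  "algebraic_over (Fp_xz {..<k}) (to_Rp (proj k (fps_to_fls exp_tilde)) :: 'p::prime_card Rp)"
  by (intro algebraic_gring proj_exp_tilde_gring)

lemma algebraic_proj_exp_p:
  "algebraic_over (Fp_xz {..<k}) (to_Rp (proj k (fps_to_fls exp_p)) :: 'p::prime_card Rp)"
proof -
  let ?c = "const_part (fps_to_fls exp_tilde) :: 'p zser"
  have "Poly_Mapping.lookup (proj k ?c $$ 0) 0 = 1"
    using exp_p_times_const_part(1)[where 'p = 'p] by (simp add: proj_eq_restrict_ser)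
  then have c: "to_Rp (proj k ?c) \<noteq> 0"
    by (metis fls_zero_nth lookup_zero to_Rp_eq_0_iff zero_neq_one)
  have "to_Rp (proj k (fps_to_fls exp_p)) * to_Rp (proj k ?c) = to_Rp (proj k (fps_to_fls exp_tilde))"
    unfolding to_Rp_mult[symmetric] proj_mult[symmetric] exp_p_times_const_part(2) ..
  then have "to_Rp (proj k (fps_to_fls exp_p)) = to_Rp (proj k (fps_to_fls exp_tilde)) / to_Rp (proj k ?c)"
    using c by (simp only: eq_divide_eq) simp
  moreover have "algebraic_over (Fp_xz {..<k}) (to_Rp (proj k ?c))"
    by (intro algebraic_gring proj_const_part_gring)
  ultimately show ?thesis
    using algebraic_proj_exp_tilde[of k, where 'p = 'p] unfolding Fp_xz_def by (simp only: algebraic_over_divide)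
qed

theorem corollary3p7:
  fixes y :: "'p::prime_card zpoly fls"
  assumes "y = fps_to_fls exp_tilde \<or> y = fps_to_fls exp_p \<or>
    (\<exists>h. algebraic_over (Fp_xz UNIV) (to_Rp h) \<and> y = h * fps_to_fls exp_p)"
  shows "(\<forall>k. to_Rp (proj k y) \<in> Rp_sub k \<and> algebraic_over (Fp_xz {..<k}) (to_Rp (proj k y))) \<and>
    (\<forall>\<alpha>. algebraic_over Fp_x (z_coeff \<alpha> y))"
proof -
  have "algebraic_over (Fp_xz {..<k}) (to_Rp (proj k y))" for k
    using assms
  proof (elim disjE exE conjE)
    assume "y = fps_to_fls exp_tilde"
    then show ?thesis
      by (simp only: algebraic_proj_exp_tilde)
  next
    assume "y = fps_to_fls exp_p"
    then show ?thesis
      by (simp only: algebraic_proj_exp_p)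
  next
    fix h
    assume h: "algebraic_over (Fp_xz UNIV) (to_Rp h)" and y: "y = h * fps_to_fls exp_p"
    show ?thesis
      using algebraic_proj[OF h, of k] algebraic_proj_exp_p[of k, where 'p = 'p]
      unfolding y proj_mult to_Rp_mult Fp_xz_def by (rule algebraic_over_mult)
  qed
  then show ?thesis
    using to_Rp_proj_Rp_sub algebraic_z_coeff_of_proj by blast
qed

end
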